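(* Let $t\ge1$ be a fixed integer. Then for all sufficiently large $n$, $$\mathrm{ex}(n,K_3,P_{2t+2}^{\triangle})=\left|\mathcal{S}^{+}_{\mathrm{bi}}(n,t)\right|.$$
   Context: $P_k$ denotes the path with $k$ edges. The $\triangle$-blowup $F^{\triangle}$ of a graph $F$ is obtained by replacing each edge $uv$ by a triangle $uvw_{uv}$ with a new vertex $w_{uv}$, distinct edges receiving distinct new vertices. $\mathrm{ex}(n,K_3,F^{\triangle})$ is the maximum number of triangles in an $n$-vertex graph with no copy of $F^{\triangle}$. $T(m)$ is the balanced complete bipartite graph on $m$ vertices and $T^{+}(m)$ is obtained from $T(m)$ by adding one edge inside the smaller part. $S^{+}(n,t)=K_t\vee T^{+}(n-t)$ is the join of $K_t$ and $T^+(n-t)$ (disjoint copies plus all edges between them), and $\mathcal{S}^{+}_{\mathrm{bi}}(n,t)$ is the set of $3$-subsets inducing a triangle in $S^{+}(n,t)$. *)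

theory Defs
  imports Main
begin

type_synonym 'a graph = "'a set \<times> 'a set set"

definition verts :: "'a graph \<Rightarrow> 'a set" where "verts G = fst G"
definition edges :: "'a graph \<Rightarrow> 'a set set" where "edges G = snd G"

definition simple_graph :: "'a graph \<Rightarrow> bool" where
  "simple_graph G \<longleftrightarrow> finite (verts G) \<and>
     (\<forall>e \<in> edges G. e \<subseteq> verts G \<and> card e = 2)"

definition contains_copy :: "'a graph \<Rightarrow> 'b graph \<Rightarrow> bool" where
  "contains_copy G H \<longleftrightarrow> (\<exists>f. inj_on f (verts H) \<and> f ` verts H \<subseteq> verts G \<and>
      (\<forall>e \<in> edges H. f ` e \<in> edges G))"

definition triangles :: "'a graph \<Rightarrow> 'a set set" where
  "triangles G = {T. T \<subseteq> verts G \<and> card T = 3 \<and>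
      (\<forall>x\<in>T. \<forall>y\<in>T. x \<noteq> y \<longrightarrow> {x, y} \<in> edges G)}"

(* triangle blowup: each edge uv becomes a triangle u v w_uv, new vertex Inr {u,v} *)
definition tri_blowup :: "'b graph \<Rightarrow> ('b + 'b set) graph" where
  "tri_blowup F = (Inl ` verts F \<union> Inr ` edges F,
     (\<Union>e \<in> edges F. { Inl ` e } \<union> { {Inl u, Inr e} | u. u \<in> e }))"

definition path_graph :: "nat \<Rightarrow> nat graph" where
  "path_graph k = ({0..k}, {{i, Suc i} | i. i < k})"

definition ex_K3 :: "nat \<Rightarrow> 'b graph \<Rightarrow> nat" where
  "ex_K3 n F = Max {card (triangles G) | G :: nat graph.
      simple_graph G \<and> verts G = {..<n} \<and> \<not> contains_copy G F}"

(* S^+(n,t) = K_t join T^+(n-t) on vertex set {0..<n}: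
   A = {0..<t} clique, B = {t..<t + (n-t) div 2} smaller part,
   C = {t + (n-t) div 2..<n} larger part, extra edge {t, t+1} inside B. *)
definition S_plus :: "nat \<Rightarrow> nat \<Rightarrow> nat graph" where
  "S_plus n t = (let A = {..<t}; B = {t..<t + (n - t) div 2}; C = {t + (n - t) div 2..<n} in
     ({..<n},
      {{x, y} | x y. x \<in> A \<and> y \<in> A \<and> x \<noteq> y}
      \<union> {{x, y} | x y. x \<in> A \<and> y \<in> B \<union> C}
      \<union> {{x, y} | x y. x \<in> B \<and> y \<in> C}
      \<union> {{t, Suc t}}))"

definition S_plus_bi :: "nat \<Rightarrow> nat \<Rightarrow> nat set set" where
  "S_plus_bi n t = triangles (S_plus n t)"

end

theory Submission
  imports Defs
begin

text \<open>
  A copy of the triangle blowup of a path is a loose path of triangles. Call an edge heavy if it lies in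
  at least a constant number of triangles and light otherwise. In a graph without a loose path of
  \<^term>\<open>2 * t + 2\<close> triangles, greedy extension shows that there are only linearly many heavy edges,
  triangles with three light edges, and pairs of triangles sharing a light edge and having one heavy edge
  each. In particular there are at most quadratically many triangles, so by Goodman's inequality the graph has
  at most \<^term>\<open>n * n div 4\<close> edges up to a linear error. Only boundedly many vertices, the hubs, have
  linear heavy degree, and almost all triangles with two heavy edges consist of a hub and a light edge.
  All but boundedly many vertices are heavily joined to at most \<^term>\<open>t\<close> hubs, as a heavy path zigzags
  through a common set of hubs. Counting triangles by their light edges, with weight one half for triangles
  with a single heavy edge, shows that a light edge carries weight at most \<^term>\<open>t\<close>, with equality only if
  both ends see the same \<^term>\<open>t\<close> hubs. Hence in a near-extremal graph almost all vertices are attached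
  to one \<^term>\<open>t\<close>-set \<^term>\<open>S\<close>.

  Triangles outside \<^term>\<open>S\<close> touching attached vertices can be linked through \<^term>\<open>S\<close>, so any two of
  them share an edge, apart from a degenerate case. They therefore form a book or there are at most four
  of them. If a book has \<^term>\<open>c\<close> pages, these form an independent set, and removing the spine leaves a
  triangle-free graph with at most \<^term>\<open>a * (m - a)\<close> edges for some \<^term>\<open>a \<ge> c\<close>; so edges and pages
  together number at most \<^term>\<open>(m + 1) * (m + 1) div 4 + 1\<close>. Each unattached vertex costs a linear number
  of triangles.
\<close>

subsection \<open>Loose paths of triangles\<close>

text \<open>The codegree threshold exceeds the size of any path together with the vertices it has to
  avoid, so a heavy edge can always be completed to a triangle by a fresh vertex and acts as a path
  edge by itself. The main term is t * n^2 / 4 triangles, so a family may be discarded only if its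
  size is O(n) or a small constant times n^2. Triangles with a single heavy edge are not shown to be
  negligible in this sense: up to O(n), they are only bounded by half the number of edges whose ends
  both see fewer than t hubs. This fits because such an edge has at most t - 1 common hubs, which
  leaves room for one half. The only quadratic error comes from pairs of heavy edges at a non-hub.
  It has size \<open>lin_const\<close> * n^2 / q, where hubs are the vertices of heavy degree at
  least n / q, so q can be fixed after the quadratic loss that is forced when no t-set has almost
  all vertices attached.\<close>

text \<open>Discard a fibre of \<open>f\<close> or \<open>g\<close> with fewer than \<open>p\<close>
  elements as long as there is one. Each round removes a value from one of the two images, so the
  number of rounds is at most the sum of their sizes, and the second assumption says that only the
  empty set survives.\<close>

lemma fiber_cleaning:
  assumes "finite Z"
    and "\<And>Z'. \<lbrakk>Z' \<subseteq> Z; Z' \<noteq> {};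
      \<forall>z\<in>Z'. p \<le> card {u\<in>Z'. f u = f z} \<and> p \<le> card {u\<in>Z'. g u = g z}\<rbrakk> \<Longrightarrow> False"
  shows "card Z \<le> p * (card (f ` Z) + card (g ` Z))"
  using assms
proof (induction "card Z" arbitrary: Z rule: less_induct)
  case less
  have shrink: "card Z \<le> p * (card (f ` Z) + card (g ` Z))"
    if z: "z \<in> Z" and Z1: "Z1 = Z - F" "F \<subseteq> Z" "z \<in> F" "card F < p"
      and drop: "card (f ` Z1) + card (g ` Z1) < card (f ` Z) + card (g ` Z)" for z Z1 F
  proof -
    have "card Z1 < card Z"
      using z Z1 less.prems(1) by (intro psubset_card_mono) auto
    moreover have "finite Z1" using Z1 less.prems(1) by auto
    ultimately have IH: "card Z1 \<le> p * (card (f ` Z1) + card (g ` Z1))"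
      using less.hyps[of Z1] less.prems(2) Z1(1) by blast
    have "card Z = card Z1 + card F"
      using Z1(1,2) less.prems(1) card_Diff_subset[of F Z] card_mono[of Z F] finite_subset[of F Z]
      by simp
    also have "\<dots> \<le> p * (card (f ` Z1) + card (g ` Z1)) + p" using IH Z1(4) by linarith
    also have "\<dots> = p * Suc (card (f ` Z1) + card (g ` Z1))" by simp
    also have "\<dots> \<le> p * (card (f ` Z) + card (g ` Z))" using drop by (intro mult_le_mono2) linarith
    finally show ?thesis .
  qed
  show ?case
  proof (cases "Z = {}")
    case False
    then obtain z where z: "z \<in> Z"
      and "\<not> (p \<le> card {u\<in>Z. f u = f z} \<and> p \<le> card {u\<in>Z. g u = g z})"
      using less.prems(2)[of Z] by blast
    then consider "card {u\<in>Z. f u = f z} < p" | "card {u\<in>Z. g u = g z} < p" by linarith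
    then show ?thesis
    proof cases
      case 1
      let ?Z1 = "Z - {u\<in>Z. f u = f z}"
      have "f z \<notin> f ` ?Z1" by auto
      then have "f ` ?Z1 \<subset> f ` Z" using z by blast
      then have "card (f ` ?Z1) < card (f ` Z)" using less.prems(1) by (simp add: psubset_card_mono)
      moreover have "card (g ` ?Z1) \<le> card (g ` Z)" using less.prems(1) by (intro card_mono) auto
      ultimately have "card (f ` ?Z1) + card (g ` ?Z1) < card (f ` Z) + card (g ` Z)" by linarith
      then show ?thesis using shrink[OF z, of ?Z1 "{u\<in>Z. f u = f z}"] 1 z by auto
    next
      case 2
      let ?Z1 = "Z - {u\<in>Z. g u = g z}"
      have "g z \<notin> g ` ?Z1" by auto
      then have "g ` ?Z1 \<subset> g ` Z" using z by blast
      then have "card (g ` ?Z1) < card (g ` Z)" using less.prems(1) by (simp add: psubset_card_mono)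
      moreover have "card (f ` ?Z1) \<le> card (f ` Z)" using less.prems(1) by (intro card_mono) auto
      ultimately have "card (f ` ?Z1) + card (g ` ?Z1) < card (f ` Z) + card (g ` Z)" by linarith
      then show ?thesis using shrink[OF z, of ?Z1 "{u\<in>Z. g u = g z}"] 2 z by auto
    qed
  qed auto
qed

locale ugraph =
  fixes V :: "'a set" and adj :: "'a \<Rightarrow> 'a \<Rightarrow> bool"
  assumes finV: "finite V"
    and adj_sym: "adj x y \<Longrightarrow> adj y x"
    and adj_irrefl: "\<not> adj x x"
    and adj_V: "adj x y \<Longrightarrow> x \<in> V"
begin

lemma adj_V2: "adj x y \<Longrightarrow> y \<in> V"
  using adj_V adj_sym by blast

lemma adj_commute: "adj x y \<longleftrightarrow> adj y x"
  using adj_sym by blast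

definition tri :: "'a \<Rightarrow> 'a \<Rightarrow> 'a \<Rightarrow> bool" where
  "tri x y z \<longleftrightarrow> adj x y \<and> adj y z \<and> adj x z"

definition cod :: "'a \<Rightarrow> 'a \<Rightarrow> 'a set" where
  "cod x y = {z. adj x z \<and> adj y z}"

definition clq :: "nat \<Rightarrow> 'a set \<Rightarrow> 'a set set" where
  "clq j W = {T. T \<subseteq> W \<and> card T = j \<and> pairwise adj T}"

lemma finite_cod [simp]: "finite (cod x y)"
  by (rule finite_subset[OF _ finV]) (auto simp: cod_def adj_V2)

lemma cod_commute: "cod x y = cod y x"
  by (auto simp: cod_def)

lemma finite_clq: "finite W \<Longrightarrow> finite (clq j W)"
  by (rule finite_subset[of _ "Pow W"]) (auto simp: clq_def)

lemma clq_mono: "W \<subseteq> W' \<Longrightarrow> clq j W \<subseteq> clq j W'"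
  by (auto simp: clq_def)

lemma pair_in_clq: "{x, y} \<in> clq 2 W \<longleftrightarrow> x \<in> W \<and> y \<in> W \<and> adj x y"
  using adj_irrefl adj_sym by (cases "x = y") (auto simp: clq_def pairwise_def)

lemma clq2E:
  assumes "e \<in> clq 2 W"
  obtains x y where "e = {x, y}" "x \<in> W" "y \<in> W" "adj x y"
  using assms unfolding clq_def pairwise_def by (auto simp: card_2_iff)

lemma tri_in_clq:
  "{x, y, z} \<in> clq 3 W \<and> x \<noteq> y \<and> y \<noteq> z \<and> x \<noteq> z \<longleftrightarrow> x \<in> W \<and> y \<in> W \<and> z \<in> W \<and> tri x y z"
  using adj_irrefl adj_sym by (auto simp: clq_def pairwise_def tri_def card_insert_if)

lemma tri_clq: "tri x y z \<Longrightarrow> {x, y, z} \<subseteq> W \<Longrightarrow> {x, y, z} \<in> clq 3 W"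
  using tri_in_clq[of x y z W] by auto

lemma clq3E:
  assumes "T \<in> clq 3 W"
  obtains x y z where "T = {x, y, z}" "x \<in> W" "y \<in> W" "z \<in> W" "tri x y z" "x \<noteq> y" "y \<noteq> z" "x \<noteq> z"
  using assms unfolding clq_def pairwise_def tri_def by (auto simp: card_3_iff)

lemma clq3_adj: "T \<in> clq 3 W \<Longrightarrow> x \<in> T \<Longrightarrow> y \<in> T \<Longrightarrow> x \<noteq> y \<Longrightarrow> adj x y"
  by (auto simp: clq_def pairwise_def)

text \<open>In the step, \<open>b\<close> is the apex over the path edge from \<open>v\<close> to
  the new end \<open>c\<close>. Keeping the vertex set instead of the sequence is enough, since an
  extension only has to be fresh.\<close>

inductive lpath :: "nat \<Rightarrow> 'a \<Rightarrow> 'a set \<Rightarrow> bool" where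
  lpath_0: "v \<in> V \<Longrightarrow> lpath 0 v {v}"
| lpath_Suc: "lpath j v P \<Longrightarrow> tri v b c \<Longrightarrow> b \<notin> P \<Longrightarrow> c \<notin> P \<Longrightarrow>
    lpath (Suc j) c (insert b (insert c P))"

lemma lpath_props:
  "lpath j v P \<Longrightarrow> finite P \<and> card P = 2 * j + 1 \<and> v \<in> P \<and> P \<subseteq> V"
proof (induction rule: lpath.induct)
  case (lpath_Suc j v P b c)
  then have "b \<noteq> c" using adj_irrefl unfolding tri_def by blast
  moreover have "b \<in> V" "c \<in> V" using lpath_Suc.hyps(2) adj_V adj_V2 unfolding tri_def by blast+
  ultimately show ?case using lpath_Suc by auto
qed auto

lemma lpath_embedding:
  assumes "lpath j v P"
  shows "\<exists>p w. p j = v \<and> P = p ` {..j} \<union> w ` {..<j} \<and> inj_on p {..j} \<and> inj_on w {..<j} \<and>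
    p ` {..j} \<inter> w ` {..<j} = {} \<and> (\<forall>i<j. tri (p i) (w i) (p (Suc i)))"
  using assms
proof (induction rule: lpath.induct)
  case (lpath_0 v)
  then show ?case by (intro exI[of _ "\<lambda>_. v"]) auto
next
  case (lpath_Suc j v P b c)
  from lpath_Suc.IH obtain p w where pw: "p j = v" "P = p ` {..j} \<union> w ` {..<j}" "inj_on p {..j}" "inj_on w {..<j}"
    "p ` {..j} \<inter> w ` {..<j} = {}" "\<forall>i<j. tri (p i) (w i) (p (Suc i))"
    by (elim exE conjE)
  define p' where "p' = p(Suc j := c)"
  define w' where "w' = w(j := b)"
  have bc: "b \<noteq> c" using lpath_Suc.hyps(2) adj_irrefl unfolding tri_def by blast
  have "p' ` {..j} = p ` {..j}" "w' ` {..<j} = w ` {..<j}"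
    by (auto simp: p'_def w'_def intro!: image_cong)
  moreover have "p' (Suc j) = c" "w' j = b" by (simp_all add: p'_def w'_def)
  ultimately have im: "p' ` {..Suc j} = insert c (p ` {..j})" "w' ` {..<Suc j} = insert b (w ` {..<j})"
    by (simp_all add: atMost_Suc lessThan_Suc)
  have inj: "inj_on p' {..Suc j}" "inj_on w' {..<Suc j}"
    using pw(2) lpath_Suc.hyps(3,4) inj_on_fun_updI[OF pw(3)] inj_on_fun_updI[OF pw(4)]
    unfolding p'_def w'_def atMost_Suc lessThan_Suc inj_on_insert
    by (auto simp: image_iff)
  have "\<forall>i<Suc j. tri (p' i) (w' i) (p' (Suc i))"
    using pw(1,6) lpath_Suc.hyps(2) unfolding p'_def w'_def by (auto simp: less_Suc_eq)
  moreover have "p' ` {..Suc j} \<inter> w' ` {..<Suc j} = {}"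
    unfolding im using pw(2,5) lpath_Suc.hyps(3,4) bc by auto
  moreover have "insert b (insert c P) = p' ` {..Suc j} \<union> w' ` {..<Suc j}"
    unfolding im pw(2) by auto
  ultimately show ?case using inj \<open>p' (Suc j) = c\<close>
    by - (rule exI[of _ p'], rule exI[of _ w'], intro conjI)
qed

end

section \<open>Loose paths of triangles as copies of the blown-up path\<close>

definition induced_adj :: "'a graph \<Rightarrow> 'a \<Rightarrow> 'a \<Rightarrow> bool" where
  "induced_adj G x y \<longleftrightarrow> {x, y} \<in> edges G"

lemma ugraph_of_simple_graph:
  assumes "simple_graph G"
  shows "ugraph (verts G) (induced_adj G)"
proof
  show "finite (verts G)" using assms by (simp add: simple_graph_def)
  show "induced_adj G x y \<Longrightarrow> induced_adj G y x" for x y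
    by (simp add: induced_adj_def insert_commute)
  show "\<not> induced_adj G x x" for x
    using assms unfolding induced_adj_def simple_graph_def by fastforce
  show "induced_adj G x y \<Longrightarrow> x \<in> verts G" for x y
    using assms unfolding induced_adj_def simple_graph_def by fastforce
qed

lemma Min_path_edge: "Min {i, Suc i} = i"
  by simp

lemma lpath_contains_copy:
  assumes G: "simple_graph G" and lp: "ugraph.lpath (verts G) (induced_adj G) k v P"
  shows "contains_copy G (tri_blowup (path_graph k))"
proof -
  interpret ugraph "verts G" "induced_adj G" using ugraph_of_simple_graph[OF G] .
  obtain p w where pw: "P = p ` {..k} \<union> w ` {..<k}" "inj_on p {..k}" "inj_on w {..<k}"
    "p ` {..k} \<inter> w ` {..<k} = {}" "\<forall>i<k. tri (p i) (w i) (p (Suc i))"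
    using lpath_embedding[OF lp] by (elim exE conjE)
  \<comment> \<open>An apex of the blowup has the form \<open>Inr {i, Suc i}\<close>, and its index
    is the minimum of that edge.\<close>
  define f where "f = case_sum p (\<lambda>e. w (Min e))"
  have V: "verts (tri_blowup (path_graph k)) = Inl ` {..k} \<union> Inr ` {{i, Suc i} | i. i < k}"
    by (auto simp: tri_blowup_def verts_def edges_def path_graph_def)
  have fV: "f ` verts (tri_blowup (path_graph k)) = P"
  proof -
    have "f ` Inr ` {{i, Suc i} | i. i < k} = w ` {..<k}"
      unfolding f_def by (auto simp: image_iff) (metis Min_path_edge)
    then show ?thesis unfolding V pw(1) image_Un by (simp add: image_image f_def)
  qed
  have "inj_on f (verts (tri_blowup (path_graph k)))"
    unfolding V
  proof (intro inj_onI)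
    fix a b assume a: "a \<in> Inl ` {..k} \<union> Inr ` {{i, Suc i} | i. i < k}"
      and b: "b \<in> Inl ` {..k} \<union> Inr ` {{i, Suc i} | i. i < k}" and eq: "f a = f b"
    have pw_ne: "p i \<noteq> w l" if "i \<le> k" "l < k" for i l using pw(4) that by blast
    from a b eq show "a = b"
      using pw(2,3) pw_ne by (auto simp: f_def Min_path_edge dest: inj_onD) (metis pw_ne)+
  qed
  moreover have "P \<subseteq> verts G" using lpath_props[OF lp] by blast
  moreover have "f ` e \<in> edges G" if "e \<in> edges (tri_blowup (path_graph k))" for e
  proof -
    have "\<exists>i<k. e = Inl ` {i, Suc i} \<or> e = {Inl i, Inr {i, Suc i}} \<or> e = {Inl (Suc i), Inr {i, Suc i}}"
      using that by (auto simp: tri_blowup_def edges_def path_graph_def)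
    then obtain i where i: "i < k"
      "e = Inl ` {i, Suc i} \<or> e = {Inl i, Inr {i, Suc i}} \<or> e = {Inl (Suc i), Inr {i, Suc i}}" by blast
    have "tri (p i) (w i) (p (Suc i))" using pw(5) i(1) by blast
    then show ?thesis using i(2)
      by (auto simp: f_def tri_def induced_adj_def insert_commute)
  qed
  ultimately show ?thesis unfolding contains_copy_def fV[symmetric] by blast
qed

lemma card_subset_image_Sigma:
  assumes "X \<subseteq> h ` Sigma P A" "finite P" "\<And>u. u \<in> P \<Longrightarrow> finite (A u) \<and> card (A u) \<le> b"
  shows "card X \<le> card P * b"
proof -
  have fin: "finite (Sigma P A)" using assms(2,3) by blast
  have "card X \<le> card (h ` Sigma P A)" using assms(1) fin by (intro card_mono) auto
  also have "\<dots> \<le> card (Sigma P A)" using fin by (rule card_image_le)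
  also have "\<dots> = (\<Sum>u\<in>P. card (A u))" using assms(2,3) by (simp add: card_SigmaI)
  also have "\<dots> \<le> card P * b" using sum_bounded_above[of P "\<lambda>u. card (A u)" b] assms(3) by simp
  finally show ?thesis .
qed

locale lpath_free = ugraph +
  fixes t :: nat
  assumes t_pos: "1 \<le> t" and no_lpath: "\<not> lpath (2 * t + 2) v P"
begin

subsection \<open>Heavy and light edges\<close>

text \<open>A path has at most 4t + 5 vertices, and at most 2t + 6 further vertices and the next end
  have to be avoided; this leaves some slack.\<close>

definition codeg_bound :: nat where "codeg_bound = 10 * t + 20"

definition heavy :: "'a \<Rightarrow> 'a \<Rightarrow> bool" where
  "heavy x y \<longleftrightarrow> adj x y \<and> codeg_bound \<le> card (cod x y)"

definition light :: "'a \<Rightarrow> 'a \<Rightarrow> bool" where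
  "light x y \<longleftrightarrow> adj x y \<and> card (cod x y) < codeg_bound"

lemma heavy_commute: "heavy x y \<longleftrightarrow> heavy y x"
  unfolding heavy_def by (metis adj_commute cod_commute)

lemma light_commute: "light x y \<longleftrightarrow> light y x"
  unfolding light_def by (metis adj_commute cod_commute)

lemma adj_heavy_light: "adj x y \<longleftrightarrow> heavy x y \<or> light x y"
  unfolding heavy_def light_def by auto

lemma not_heavy_light: "heavy x y \<Longrightarrow> light x y \<Longrightarrow> False"
  unfolding heavy_def light_def by auto

lemma heavy_fresh:
  assumes "heavy x y" "finite F" "card F < codeg_bound"
  obtains b where "b \<notin> F" "tri x b y"
proof -
  have "\<not> cod x y \<subseteq> F"
    using assms card_mono[of F "cod x y"] unfolding heavy_def by auto
  then obtain b where "b \<notin> F" "adj x b" "adj y b" unfolding cod_def by blast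
  then show ?thesis using that assms(1) adj_sym unfolding heavy_def tri_def by blast
qed

text \<open>Empty on pairs that are not light, so that the size bound holds for all arguments and
  counting needs no side condition.\<close>

definition light_cod :: "'a \<Rightarrow> 'a \<Rightarrow> 'a set" where
  "light_cod x y = (if light x y then cod x y else {})"

lemma light_cod: "finite (light_cod x y) \<and> card (light_cod x y) \<le> codeg_bound"
  by (auto simp: light_cod_def light_def codeg_bound_def)

lemma in_light_cod: "z \<in> light_cod x y \<longleftrightarrow> light x y \<and> adj x z \<and> adj y z"
  by (auto simp: light_cod_def cod_def)

text \<open>A state \<^term>\<open>(v, R)\<close> is the current endpoint of a loose path together with vertices
  reserved for its next triangle.\<close>

lemma greedy:
  fixes Q :: "('a \<times> 'a set) set"
  assumes start: "(v0, R0) \<in> Q" "v0 \<in> V" "v0 \<notin> R0"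
    and step: "\<And>v R P. \<lbrakk>(v, R) \<in> Q; finite P; card P \<le> 4 * t + 5; v \<in> P; R \<inter> P = {}\<rbrakk> \<Longrightarrow>
      \<exists>b c R'. (c, R') \<in> Q \<and> b \<notin> P \<and> c \<notin> P \<and> tri v b c \<and> R' \<inter> insert b (insert c P) = {}"
  shows False
proof -
  have "\<exists>v R P. lpath j v P \<and> (v, R) \<in> Q \<and> R \<inter> P = {}" if "j \<le> 2 * t + 2" for j
    using that
  proof (induction j)
    case 0
    then show ?case using start lpath_0 by fastforce
  next
    case (Suc j)
    then obtain v R P where vRP: "lpath j v P" "(v, R) \<in> Q" "R \<inter> P = {}" by auto
    have "finite P" "card P \<le> 4 * t + 5" "v \<in> P" using lpath_props[OF vRP(1)] Suc.prems by auto
    then obtain b c R' where "(c, R') \<in> Q" "b \<notin> P" "c \<notin> P" "tri v b c" "R' \<inter> insert b (insert c P) = {}"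
      using step[OF vRP(2)] vRP(3) by blast
    then show ?case using lpath_Suc[OF vRP(1)] by blast
  qed
  then show False using no_lpath by blast
qed

definition extends :: "'a set \<Rightarrow> 'a \<Rightarrow> 'a \<times> 'a set \<Rightarrow> bool" where
  "extends P v q \<longleftrightarrow> (\<exists>b. b \<notin> P \<and> fst q \<notin> P \<and> tri v b (fst q) \<and> snd q \<inter> insert b (insert (fst q) P) = {})"

text \<open>Each \<zeta> in \<open>Z\<close> is a bridge that can be crossed both ways between the
  states \<open>f \<zeta>\<close> and \<open>g \<zeta>\<close>. If cleaning left something, every
  remaining state would have at least \<open>p\<close> bridges, fewer than \<open>p\<close> of them
  blocked by the current path, and \<open>greedy\<close> could go on to a forbidden path. So the
  number of bridges is linear in the number of states.\<close>

lemma fiber_greedy: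
  fixes f g :: "'z \<Rightarrow> 'a \<times> 'a set"
  assumes Z: "finite Z"
    and start: "\<And>\<zeta>. \<zeta> \<in> Z \<Longrightarrow> fst (f \<zeta>) \<in> V \<and> fst (f \<zeta>) \<notin> snd (f \<zeta>)"
    and stepf: "\<And>v R P. \<lbrakk>finite P; card P \<le> 4 * t + 5; v \<in> P; R \<inter> P = {}\<rbrakk> \<Longrightarrow>
      card {\<zeta>\<in>Z. f \<zeta> = (v, R) \<and> \<not> extends P v (g \<zeta>)} < p"
    and stepg: "\<And>v R P. \<lbrakk>finite P; card P \<le> 4 * t + 5; v \<in> P; R \<inter> P = {}\<rbrakk> \<Longrightarrow>
      card {\<zeta>\<in>Z. g \<zeta> = (v, R) \<and> \<not> extends P v (f \<zeta>)} < p"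
  shows "card Z \<le> p * (card (f ` Z) + card (g ` Z))"
proof (rule fiber_cleaning[OF Z])
  fix Z' assume Z': "Z' \<subseteq> Z" "Z' \<noteq> {}"
    and big: "\<forall>z\<in>Z'. p \<le> card {u\<in>Z'. f u = f z} \<and> p \<le> card {u\<in>Z'. g u = g z}"
  define Q where "Q = f ` Z' \<union> g ` Z'"
  have pick: "\<exists>\<zeta>\<in>Z'. extends P v (h' \<zeta>)"
    if "z \<in> Z'" "h z = (v, R)" "p \<le> card {u\<in>Z'. h u = h z}"
      "card {\<zeta>\<in>Z. h \<zeta> = (v, R) \<and> \<not> extends P v (h' \<zeta>)} < p" for P v R z and h h' :: "'z \<Rightarrow> 'a \<times> 'a set"
  proof (rule ccontr)
    assume "\<not> ?thesis"
    then have "{u\<in>Z'. h u = h z} \<subseteq> {\<zeta>\<in>Z. h \<zeta> = (v, R) \<and> \<not> extends P v (h' \<zeta>)}"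
      using that(2) Z'(1) by auto
    then have "card {u\<in>Z'. h u = h z} \<le> card {\<zeta>\<in>Z. h \<zeta> = (v, R) \<and> \<not> extends P v (h' \<zeta>)}"
      using Z by (intro card_mono) auto
    then show False using that(3,4) by linarith
  qed
  obtain z0 where z0: "z0 \<in> Z'" using Z'(2) by blast
  have step: "\<exists>q\<in>Q. extends P v q"
    if "(v, R) \<in> Q" "finite P" "card P \<le> 4 * t + 5" "v \<in> P" "R \<inter> P = {}" for v R P
  proof -
    from that(1) consider z where "z \<in> Z'" "f z = (v, R)" | z where "z \<in> Z'" "g z = (v, R)"
      unfolding Q_def by force
    then show ?thesis
    proof cases
      case (1 z)
      then show ?thesis using pick[of z f v R P g] big stepf[of P v R] that unfolding Q_def by blast
    next
      case (2 z)
      then show ?thesis using pick[of z g v R P f] big stepg[of P v R] that unfolding Q_def by blast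
    qed
  qed
  show False
  proof (rule greedy[of "fst (f z0)" "snd (f z0)" Q])
    show "(fst (f z0), snd (f z0)) \<in> Q" using z0 unfolding Q_def by simp
    show "fst (f z0) \<in> V" "fst (f z0) \<notin> snd (f z0)" using start z0 Z'(1) by auto
    show "\<exists>b c R'. (c, R') \<in> Q \<and> b \<notin> P \<and> c \<notin> P \<and> tri v b c \<and> R' \<inter> insert b (insert c P) = {}"
      if "(v, R) \<in> Q" "finite P" "card P \<le> 4 * t + 5" "v \<in> P" "R \<inter> P = {}" for v R P
      using step[OF that] unfolding extends_def by (metis prod.collapse)
  qed
qed

text \<open>A blocked configuration has a path vertex in one of at most three roles, and then at
  most \<open>codeg_bound\<close> squared choices are left. As a path has at most
  \<open>codeg_bound\<close> vertices, 3 times the cube bounds their number; the factor 4 makes this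
  strict.\<close>

definition fiber_bound :: nat where "fiber_bound = 4 * codeg_bound ^ 3"

lemma codeg_bound_pos: "1 \<le> codeg_bound" by (simp add: codeg_bound_def)

lemma lt_fiber_bound: "card P \<le> 4 * t + 5 \<Longrightarrow> x \<le> 3 * (card P * (codeg_bound * codeg_bound)) \<Longrightarrow> x < fiber_bound"
proof -
  assume "card P \<le> 4 * t + 5" and x: "x \<le> 3 * (card P * (codeg_bound * codeg_bound))"
  then have "card P * (codeg_bound * codeg_bound) \<le> codeg_bound * (codeg_bound * codeg_bound)" unfolding codeg_bound_def by (intro mult_le_mono1) linarith
  then have "x \<le> 3 * (codeg_bound * (codeg_bound * codeg_bound))" using x by linarith
  also have "\<dots> = 3 * codeg_bound ^ 3" by (simp add: power3_eq_cube)
  also have "\<dots> < fiber_bound" unfolding fiber_bound_def using codeg_bound_pos by simp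
  finally show "x < fiber_bound" .
qed

lemma few_bad:
  assumes X: "X \<subseteq> h1 ` Sigma P A1 \<union> h2 ` Sigma P A2 \<union> h3 ` Sigma P A3"
    and P: "finite P" "card P \<le> 4 * t + 5"
    and A: "\<And>u. finite (A1 u) \<and> card (A1 u) \<le> codeg_bound * codeg_bound" "\<And>u. finite (A2 u) \<and> card (A2 u) \<le> codeg_bound * codeg_bound"
      "\<And>u. finite (A3 u) \<and> card (A3 u) \<le> codeg_bound * codeg_bound"
  shows "card X < fiber_bound"
proof -
  let ?c = "card P * (codeg_bound * codeg_bound)"
  have "card (h1 ` Sigma P A1) \<le> ?c" "card (h2 ` Sigma P A2) \<le> ?c" "card (h3 ` Sigma P A3) \<le> ?c"
    using P(1) A by (auto intro!: card_subset_image_Sigma[OF order_refl])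
  then have "card (h1 ` Sigma P A1 \<union> h2 ` Sigma P A2 \<union> h3 ` Sigma P A3) \<le> ?c + ?c + ?c"
    by (intro order_trans[OF card_Un_le] add_mono)
  moreover have "finite (h1 ` Sigma P A1 \<union> h2 ` Sigma P A2 \<union> h3 ` Sigma P A3)"
    using P(1) A by (intro finite_UnI finite_imageI finite_SigmaI) auto
  then have "card X \<le> card (h1 ` Sigma P A1 \<union> h2 ` Sigma P A2 \<union> h3 ` Sigma P A3)"
    using X by (rule card_mono)
  ultimately show ?thesis using lt_fiber_bound[OF P(2), of "card X"] by linarith
qed

lemma light_cod_square: "finite (light_cod x y) \<and> card (light_cod x y) \<le> codeg_bound * codeg_bound"
proof -
  have "codeg_bound \<le> codeg_bound * codeg_bound" using codeg_bound_pos by simp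
  then show ?thesis using light_cod[of x y] by linarith
qed

lemma light_cod_Times: "finite (light_cod x y \<times> light_cod x y) \<and> card (light_cod x y \<times> light_cod x y) \<le> codeg_bound * codeg_bound"
  using light_cod[of x y] by (simp add: card_cartesian_product mult_le_mono)

section \<open>Linear bounds for heavy edges and exceptional configurations of light edges\<close>

definition heavy_pairs :: "('a \<times> 'a) set" where "heavy_pairs = {(x, y). heavy x y}"

lemma finite_heavy_pairs: "finite heavy_pairs"
  by (rule finite_subset[of _ "V \<times> V"]) (auto simp: heavy_pairs_def heavy_def adj_V adj_V2 finV)

text \<open>The states are single vertices with empty reserve, since a heavy edge finds a fresh apex
  in any case. A pair is blocked only if its far end lies on the path.\<close>

lemma card_heavy_pairs: "card heavy_pairs \<le> fiber_bound * (2 * card V)"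
proof -
  let ?f = "\<lambda>(x, y). (x, {}) :: 'a \<times> 'a set" and ?g = "\<lambda>(x, y). (y, {}) :: 'a \<times> 'a set"
  have ext: "extends P v (u, {})" if h: "heavy v u" and u: "u \<notin> P" and P: "finite P" "card P \<le> 4 * t + 5" for P v u
  proof -
    have "card P < codeg_bound" using P(2) unfolding codeg_bound_def by linarith
    then obtain b where "b \<notin> P" "tri v b u" using heavy_fresh[OF h P(1)] by blast
    then show ?thesis using u unfolding extends_def by auto
  qed
  have step: "card {\<zeta>\<in>heavy_pairs. ?f \<zeta> = (v, R) \<and> \<not> extends P v (?g \<zeta>)} < fiber_bound"
    "card {\<zeta>\<in>heavy_pairs. ?g \<zeta> = (v, R) \<and> \<not> extends P v (?f \<zeta>)} < fiber_bound"
    if P: "finite P" "card P \<le> 4 * t + 5" for v R P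
  proof -
    have "{\<zeta>\<in>heavy_pairs. ?f \<zeta> = (v, R) \<and> \<not> extends P v (?g \<zeta>)} \<subseteq> Pair v ` P"
      using ext[OF _ _ P] by (auto simp: heavy_pairs_def)
    then have 1: "card {\<zeta>\<in>heavy_pairs. ?f \<zeta> = (v, R) \<and> \<not> extends P v (?g \<zeta>)} \<le> card P"
      by (meson P(1) surj_card_le)
    have "{\<zeta>\<in>heavy_pairs. ?g \<zeta> = (v, R) \<and> \<not> extends P v (?f \<zeta>)} \<subseteq> (\<lambda>u. (u, v)) ` P"
      using ext[OF iffD1[OF heavy_commute] _ P] by (auto simp: heavy_pairs_def)
    then have 2: "card {\<zeta>\<in>heavy_pairs. ?g \<zeta> = (v, R) \<and> \<not> extends P v (?f \<zeta>)} \<le> card P"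
      by (meson P(1) surj_card_le)
    have "card P \<le> card P * (codeg_bound * codeg_bound)" using codeg_bound_pos by simp
    then have "card P < fiber_bound" using lt_fiber_bound[OF P(2), of "card P"] by linarith
    then show "card {\<zeta>\<in>heavy_pairs. ?f \<zeta> = (v, R) \<and> \<not> extends P v (?g \<zeta>)} < fiber_bound"
      "card {\<zeta>\<in>heavy_pairs. ?g \<zeta> = (v, R) \<and> \<not> extends P v (?f \<zeta>)} < fiber_bound" using 1 2 by linarith+
  qed
  have "card heavy_pairs \<le> fiber_bound * (card (?f ` heavy_pairs) + card (?g ` heavy_pairs))"
    using finite_heavy_pairs step by (intro fiber_greedy) (auto simp: heavy_pairs_def heavy_def adj_V)
  moreover have "?f ` heavy_pairs \<subseteq> (\<lambda>x. (x, {})) ` V" "?g ` heavy_pairs \<subseteq> (\<lambda>x. (x, {})) ` V"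
    by (auto simp: heavy_pairs_def heavy_def adj_V adj_V2)
  then have "card (?f ` heavy_pairs) \<le> card V" "card (?g ` heavy_pairs) \<le> card V"
    by (meson finV surj_card_le)+
  then have "fiber_bound * (card (?f ` heavy_pairs) + card (?g ` heavy_pairs)) \<le> fiber_bound * (2 * card V)" by (intro mult_le_mono2) linarith
  ultimately show ?thesis by linarith
qed

definition light_triples :: "('a \<times> 'a \<times> 'a) set" where
  "light_triples = {(x, y, z). light x y \<and> light y z \<and> light x z}"

text \<open>The triangle leads from \<open>x\<close> to \<open>y\<close> through \<open>z\<close>
  and back. All its edges are light, so the current end and the blocking vertex leave at most
  \<open>codeg_bound\<close> choices for the third vertex.\<close>

lemma card_light_triples: "card light_triples \<le> fiber_bound * (2 * card V)"
proof -
  let ?f = "\<lambda>(x, y, z). (x, {}) :: 'a \<times> 'a set" and ?g = "\<lambda>(x, y, z). (y, {}) :: 'a \<times> 'a set"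
  have fin: "finite light_triples"
    by (rule finite_subset[of _ "V \<times> V \<times> V"]) (auto simp: light_triples_def light_def adj_V adj_V2 finV)
  have tri: "tri x z y" "tri y z x" if "light x y" "light y z" "light x z" for x y z
    using that adj_sym unfolding tri_def light_def by blast+
  have step: "card {\<zeta>\<in>light_triples. ?f \<zeta> = (v, R) \<and> \<not> extends P v (?g \<zeta>)} < fiber_bound"
    "card {\<zeta>\<in>light_triples. ?g \<zeta> = (v, R) \<and> \<not> extends P v (?f \<zeta>)} < fiber_bound"
    if P: "finite P" "card P \<le> 4 * t + 5" for v R P
  proof -
    show "card {\<zeta>\<in>light_triples. ?f \<zeta> = (v, R) \<and> \<not> extends P v (?g \<zeta>)} < fiber_bound"
      by (rule few_bad[of _ "\<lambda>(u, z). (v, u, z)" P "light_cod v" "\<lambda>(u, y). (v, y, u)" "light_cod v" id "\<lambda>_. {}"])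
        (use tri adj_heavy_light light_commute P light_cod_square in
          \<open>auto simp: light_triples_def extends_def image_iff in_light_cod\<close>)
    show "card {\<zeta>\<in>light_triples. ?g \<zeta> = (v, R) \<and> \<not> extends P v (?f \<zeta>)} < fiber_bound"
      by (rule few_bad[of _ "\<lambda>(u, z). (u, v, z)" P "light_cod v" "\<lambda>(u, x). (x, v, u)" "light_cod v" id "\<lambda>_. {}"])
        (use tri adj_heavy_light light_commute P light_cod_square in
          \<open>auto simp: light_triples_def extends_def image_iff in_light_cod\<close>)
  qed
  have "card light_triples \<le> fiber_bound * (card (?f ` light_triples) + card (?g ` light_triples))"
    using fin step by (intro fiber_greedy) (auto simp: light_triples_def light_def adj_V)
  moreover have "?f ` light_triples \<subseteq> (\<lambda>x. (x, {})) ` V" "?g ` light_triples \<subseteq> (\<lambda>x. (x, {})) ` V"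
    by (auto simp: light_triples_def light_def adj_V adj_V2)
  then have "card (?f ` light_triples) \<le> card V" "card (?g ` light_triples) \<le> card V"
    by (meson finV surj_card_le)+
  then have "fiber_bound * (card (?f ` light_triples) + card (?g ` light_triples)) \<le> fiber_bound * (2 * card V)" by (intro mult_le_mono2) linarith
  ultimately show ?thesis by linarith
qed

text \<open>The two ways in which a light edge \<^term>\<open>{x, y}\<close> lies in two triangles with a single heavy
  edge each: the heavy edges meet \<^term>\<open>{x, y}\<close> in the same end or in opposite ends.\<close>

definition same_end :: "('a \<times> 'a \<times> 'a \<times> 'a) set" where
  "same_end = {(x, y, z, z'). light x y \<and> light x z \<and> light x z' \<and> heavy y z \<and> heavy y z' \<and> z \<noteq> z'}"

definition opposite_end :: "('a \<times> 'a \<times> 'a \<times> 'a) set" where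
  "opposite_end = {(x, y, z, z'). light x y \<and> light x z \<and> light y z' \<and> heavy y z \<and> heavy x z' \<and> z \<noteq> z'}"

lemma light_adj: "light x y \<Longrightarrow> adj x y \<and> adj y x"
  unfolding light_def using adj_sym by blast

lemma heavy_adj: "heavy x y \<Longrightarrow> adj x y \<and> adj y x"
  unfolding heavy_def using adj_sym by blast

lemma finite_same_end: "finite same_end" and finite_opposite_end: "finite opposite_end"
  by (rule finite_subset[of _ "V \<times> V \<times> V \<times> V"],
      auto simp: same_end_def opposite_end_def adj_V adj_V2 finV dest!: light_adj heavy_adj)+

text \<open>The path leaves \<open>y\<close> through \<open>z\<close> to \<open>x\<close>, and
  \<open>x\<close> through \<open>z'\<close> to \<open>y\<close>. If \<open>z\<close> were not
  reserved at \<open>y\<close>, it could lie on the path, and the heavy edge \<open>y z\<close>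
  would leave \<open>x\<close> undetermined. Reserving it turns the states into heavy pairs, of
  which there are linearly many, and the other edges at the current end are light.\<close>

lemma card_opposite_end: "card opposite_end \<le> fiber_bound * (2 * card heavy_pairs)"
proof -
  let ?f = "\<lambda>(x, y, z, z'). (y, {z}) :: 'a \<times> 'a set" and ?g = "\<lambda>(x, y, z, z'). (x, {z'}) :: 'a \<times> 'a set"
  have tri: "tri y z x" "tri x z' y" if "(x, y, z, z') \<in> opposite_end" for x y z z'
    using that unfolding opposite_end_def tri_def by (auto dest: light_adj heavy_adj)
  have step: "card {\<zeta>\<in>opposite_end. ?f \<zeta> = (v, R) \<and> \<not> extends P v (?g \<zeta>)} < fiber_bound"
    "card {\<zeta>\<in>opposite_end. ?g \<zeta> = (v, R) \<and> \<not> extends P v (?f \<zeta>)} < fiber_bound"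
    if P: "finite P" "card P \<le> 4 * t + 5" "v \<in> P" "R \<inter> P = {}" for v R P
  proof -
    let ?B = "{\<zeta>\<in>opposite_end. ?f \<zeta> = (v, R) \<and> \<not> extends P v (?g \<zeta>)}"
    have "\<zeta> \<in> (\<lambda>(u, z'). (u, v, the_elem R, z')) ` Sigma P (light_cod v) \<union>
      (\<lambda>(u, x). (x, v, the_elem R, u)) ` Sigma P (light_cod v)" if \<zeta>: "\<zeta> \<in> ?B" for \<zeta>
    proof -
      obtain x z z' where z: "\<zeta> = (x, v, z, z')" "(x, v, z, z') \<in> opposite_end" "R = {z}"
        "\<not> extends P v (x, {z'})" using \<zeta> by (cases \<zeta>) auto
      have "z \<noteq> z'" "x \<noteq> z'" using z(2) heavy_adj[of x z'] adj_irrefl unfolding opposite_end_def by auto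
      then have "x \<in> P \<or> z' \<in> P"
        using z(3,4) tri(1)[OF z(2)] P(4) unfolding extends_def by auto
      moreover have "z' \<in> light_cod v x" "x \<in> light_cod v z'"
        using z(2) unfolding opposite_end_def in_light_cod by (auto dest: light_adj heavy_adj simp: light_commute)
      ultimately show ?thesis using z(1,3) by (force simp: image_iff)
    qed
    note sub = subsetI[OF this]
    show "card ?B < fiber_bound"
      by (rule few_bad[of ?B "\<lambda>(u, z'). (u, v, the_elem R, z')" P "light_cod v" "\<lambda>(u, x). (x, v, the_elem R, u)" "light_cod v"
            id "\<lambda>_. {}"], rule subset_trans[OF sub]) (use P light_cod_square in auto)
    let ?B = "{\<zeta>\<in>opposite_end. ?g \<zeta> = (v, R) \<and> \<not> extends P v (?f \<zeta>)}"
    have "\<zeta> \<in> (\<lambda>(u, z). (v, u, z, the_elem R)) ` Sigma P (light_cod v) \<union>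
      (\<lambda>(u, y). (v, y, u, the_elem R)) ` Sigma P (light_cod v)" if \<zeta>: "\<zeta> \<in> ?B" for \<zeta>
    proof -
      obtain y z z' where z: "\<zeta> = (v, y, z, z')" "(v, y, z, z') \<in> opposite_end" "R = {z'}"
        "\<not> extends P v (y, {z})" using \<zeta> by (cases \<zeta>) auto
      have "z \<noteq> z'" "y \<noteq> z" using z(2) heavy_adj[of y z] adj_irrefl unfolding opposite_end_def by auto
      then have "y \<in> P \<or> z \<in> P"
        using z(3,4) tri(2)[OF z(2)] P(4) unfolding extends_def by auto
      moreover have "z \<in> light_cod v y" "y \<in> light_cod v z"
        using z(2) unfolding opposite_end_def in_light_cod by (auto dest: light_adj heavy_adj simp: light_commute)
      ultimately show ?thesis using z(1,3) by (force simp: image_iff)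
    qed
    note sub = subsetI[OF this]
    show "card ?B < fiber_bound"
      by (rule few_bad[of ?B "\<lambda>(u, z). (v, u, z, the_elem R)" P "light_cod v" "\<lambda>(u, y). (v, y, u, the_elem R)" "light_cod v"
            id "\<lambda>_. {}"], rule subset_trans[OF sub]) (use P light_cod_square in auto)
  qed
  have "card opposite_end \<le> fiber_bound * (card (?f ` opposite_end) + card (?g ` opposite_end))"
    using finite_opposite_end step
    by (intro fiber_greedy) (auto simp: opposite_end_def adj_irrefl dest!: heavy_adj intro: adj_V)
  moreover have "?f ` opposite_end \<subseteq> (\<lambda>(x, y). (x, {y})) ` heavy_pairs" "?g ` opposite_end \<subseteq> (\<lambda>(x, y). (x, {y})) ` heavy_pairs"
    by (force simp: opposite_end_def heavy_pairs_def)+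
  then have "card (?f ` opposite_end) \<le> card heavy_pairs" "card (?g ` opposite_end) \<le> card heavy_pairs"
    using finite_heavy_pairs by (meson surj_card_le)+
  then have "fiber_bound * (card (?f ` opposite_end) + card (?g ` opposite_end)) \<le> fiber_bound * (2 * card heavy_pairs)" by (intro mult_le_mono2) linarith
  ultimately show ?thesis by linarith
qed

text \<open>The heavy degree of \<^term>\<open>y\<close> is unbounded, but there are only linearly many states
  \<^term>\<open>(y, {z'})\<close>, so linearly many labels suffice.\<close>

lemma card_same_end: "card same_end \<le> fiber_bound * (card V + card heavy_pairs)"
proof -
  \<comment> \<open>All three edges at \<open>x\<close> are light, so its reserve can be empty; at
    \<open>y\<close> the next apex \<open>z'\<close> sits on a heavy edge and is reserved.\<close>
  let ?f = "\<lambda>(x, y, z, z'). (x, {}) :: 'a \<times> 'a set" and ?g = "\<lambda>(x, y, z, z'). (y, {z'}) :: 'a \<times> 'a set"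
  have tri: "tri x z y" "tri y z' x" if "(x, y, z, z') \<in> same_end" for x y z z'
    using that unfolding same_end_def tri_def by (auto dest: light_adj heavy_adj)
  have step: "card {\<zeta>\<in>same_end. ?f \<zeta> = (v, R) \<and> \<not> extends P v (?g \<zeta>)} < fiber_bound"
    "card {\<zeta>\<in>same_end. ?g \<zeta> = (v, R) \<and> \<not> extends P v (?f \<zeta>)} < fiber_bound"
    if P: "finite P" "card P \<le> 4 * t + 5" "v \<in> P" "R \<inter> P = {}" for v R P
  proof -
    let ?B = "{\<zeta>\<in>same_end. ?f \<zeta> = (v, R) \<and> \<not> extends P v (?g \<zeta>)}"
    let ?A1 = "\<lambda>u. light_cod v u \<times> light_cod v u" and ?A2 = "\<lambda>u. SIGMA y:light_cod v u. light_cod v y"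
    have "\<zeta> \<in> (\<lambda>(u, z, z'). (v, u, z, z')) ` Sigma P ?A1 \<union> (\<lambda>(u, y, z'). (v, y, u, z')) ` Sigma P ?A2 \<union>
      (\<lambda>(u, y, z). (v, y, z, u)) ` Sigma P ?A2" if \<zeta>: "\<zeta> \<in> ?B" for \<zeta>
    proof -
      obtain y z z' where z: "\<zeta> = (v, y, z, z')" "(v, y, z, z') \<in> same_end"
        "\<not> extends P v (y, {z'})" using \<zeta> by (cases \<zeta>) auto
      have "z \<noteq> z'" "y \<noteq> z'" using z(2) heavy_adj[of y z'] adj_irrefl unfolding same_end_def by auto
      then have "y \<in> P \<or> z \<in> P \<or> z' \<in> P"
        using z(3) tri(1)[OF z(2)] unfolding extends_def by auto
      moreover have "z \<in> light_cod v y" "z' \<in> light_cod v y" "y \<in> light_cod v z" "y \<in> light_cod v z'"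
        using z(2) unfolding same_end_def in_light_cod by (auto dest: light_adj heavy_adj)
      ultimately show ?thesis unfolding z(1) by (force simp: image_iff)
    qed
    moreover have "finite (?A2 u) \<and> card (?A2 u) \<le> codeg_bound * codeg_bound" for u
    proof -
      have "card (?A2 u) \<le> card (light_cod v u) * codeg_bound"
        using light_cod by (intro card_subset_image_Sigma[of _ id]) auto
      also have "\<dots> \<le> codeg_bound * codeg_bound" using light_cod by (intro mult_le_mono1) blast
      finally show ?thesis using light_cod by (intro conjI finite_SigmaI) auto
    qed
    ultimately show "card ?B < fiber_bound"
      by (intro few_bad[of _ "\<lambda>(u, z, z'). (v, u, z, z')" P ?A1 "\<lambda>(u, y, z'). (v, y, u, z')" ?A2
            "\<lambda>(u, y, z). (v, y, z, u)" ?A2] light_cod_Times) (use P in blast)+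
    let ?B = "{\<zeta>\<in>same_end. ?g \<zeta> = (v, R) \<and> \<not> extends P v (?f \<zeta>)}"
    have "\<zeta> \<in> (\<lambda>(u, z). (u, v, z, the_elem R)) ` Sigma P (light_cod v)" if \<zeta>: "\<zeta> \<in> ?B" for \<zeta>
    proof -
      obtain x z z' where z: "\<zeta> = (x, v, z, z')" "(x, v, z, z') \<in> same_end" "R = {z'}"
        "\<not> extends P v (x, {})" using \<zeta> by (cases \<zeta>) auto
      have "x \<in> P"
        using z(3,4) tri(2)[OF z(2)] P(4) unfolding extends_def by auto
      moreover have "z \<in> light_cod v x"
        using z(2) unfolding same_end_def in_light_cod by (auto dest: light_adj heavy_adj simp: light_commute)
      ultimately show ?thesis using z(1,3) by (force simp: image_iff)
    qed
    note sub = subsetI[OF this]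
    show "card ?B < fiber_bound"
      by (rule few_bad[of ?B "\<lambda>(u, z). (u, v, z, the_elem R)" P "light_cod v" id "\<lambda>_. {}" id "\<lambda>_. {}"], rule subset_trans[OF sub]) (use P light_cod_square in auto)
  qed
  have "card same_end \<le> fiber_bound * (card (?f ` same_end) + card (?g ` same_end))"
    using finite_same_end step
    by (intro fiber_greedy) (auto simp: same_end_def adj_irrefl dest!: light_adj heavy_adj intro: adj_V)
  moreover have "?f ` same_end \<subseteq> (\<lambda>x. (x, {})) ` V"
    by (auto simp: same_end_def adj_V dest!: light_adj)
  then have "card (?f ` same_end) \<le> card V" by (meson finV surj_card_le)
  moreover have "?g ` same_end \<subseteq> (\<lambda>(x, y). (x, {y})) ` heavy_pairs"
    by (force simp: same_end_def heavy_pairs_def)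
  then have "card (?g ` same_end) \<le> card heavy_pairs" using finite_heavy_pairs by (meson surj_card_le)
  ultimately have "card same_end \<le> fiber_bound * (card (?f ` same_end) + card (?g ` same_end))" "card (?f ` same_end) + card (?g ` same_end) \<le> card V + card heavy_pairs"
    by linarith+
  then show ?thesis by (meson mult_le_mono2 order_trans)
qed

end

subsection \<open>Linear and quadratic a priori bounds\<close>

text \<open>Cauchy-Schwarz against the constant function 1.\<close>

lemma sum_square_le_card:
  fixes d :: "'a \<Rightarrow> nat"
  shows "(\<Sum>x\<in>V. d x) * (\<Sum>x\<in>V. d x) \<le> card V * (\<Sum>x\<in>V. d x * d x)"
proof -
  have "2 * ((\<Sum>x\<in>V. d x) * (\<Sum>x\<in>V. d x)) = (\<Sum>x\<in>V. \<Sum>y\<in>V. 2 * (d x * d y))"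
    by (subst sum_product) (simp only: sum_distrib_left)
  also have "\<dots> \<le> (\<Sum>x\<in>V. \<Sum>y\<in>V. d x * d x + d y * d y)"
  proof (intro sum_mono)
    fix x y
    have "2 * (a * b) \<le> a * a + b * b" if "a \<le> b" for a b :: nat
      using that by (auto simp: le_iff_add algebra_simps)
    from this[of "d x" "d y"] this[of "d y" "d x"]
    show "2 * (d x * d y) \<le> d x * d x + d y * d y"
      by (cases "d x \<le> d y") (auto simp: algebra_simps)
  qed
  also have "\<dots> = 2 * (card V * (\<Sum>x\<in>V. d x * d x))"
    by (simp add: sum.distrib flip: sum_distrib_left)
  finally show ?thesis by simp
qed

context ugraph
begin

definition nbr :: "'a \<Rightarrow> 'a set" where "nbr x = {y. adj x y}"

lemma finite_nbr [simp]: "finite (nbr x)"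
  by (rule finite_subset[OF _ finV]) (auto simp: nbr_def adj_V2)

lemma card_ordered_edges: "card (SIGMA x:V. nbr x) = 2 * card (clq 2 V)"
proof -
  have "(SIGMA x:V. nbr x) = (\<Union>e\<in>clq 2 V. {(x, y). x \<noteq> y \<and> {x, y} = e})"
    by (auto simp: nbr_def pair_in_clq adj_V adj_V2 adj_irrefl)
  also have "card \<dots> = (\<Sum>e\<in>clq 2 V. card {(x, y). x \<noteq> y \<and> {x, y} = e})"
  proof (rule card_UN_disjoint)
    show "\<forall>e\<in>clq 2 V. finite {(x, y). x \<noteq> y \<and> {x, y} = e}"
    proof
      fix e assume "e \<in> clq 2 V"
      then have "finite e" by (auto elim!: clq2E)
      then show "finite {(x, y). x \<noteq> y \<and> {x, y} = e}"
        by (rule_tac finite_subset[of _ "e \<times> e"]) auto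
    qed
  qed (auto simp: finite_clq finV)
  also have "\<dots> = (\<Sum>e\<in>clq 2 V. 2)"
  proof (rule sum.cong[OF refl])
    fix e assume "e \<in> clq 2 V"
    then obtain x y where e: "e = {x, y}" "x \<noteq> y" using adj_irrefl by (metis clq2E)
    then have "{(a, b). a \<noteq> b \<and> {a, b} = e} = {(x, y), (y, x)}" by (auto simp: doubleton_eq_iff)
    then show "card {(a, b). a \<noteq> b \<and> {a, b} = e} = 2" using e(2) by simp
  qed
  finally show ?thesis by simp
qed

text \<open>For an edge, the two degrees sum to at most n plus the codegree, by inclusion-exclusion.
  Summed over ordered edges, the left side is twice the sum of squared degrees, which Cauchy-Schwarz
  bounds from below, and the codegrees count ordered triangles.\<close>

lemma goodman:
  "2 * ((2 * card (clq 2 V)) * (2 * card (clq 2 V))) \<le>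
    card V * (card V * (2 * card (clq 2 V)) + card {(x, y, z). tri x y z})"
proof -
  let ?O = "SIGMA x:V. nbr x" and ?d = "\<lambda>x. card (nbr x)"
  have finO: "finite ?O" using finV by auto
  have sumd: "(\<Sum>x\<in>V. ?d x) = card ?O" using finV by (simp add: card_SigmaI)
  have swap: "(\<Sum>(x, y)\<in>?O. ?d y) = (\<Sum>(x, y)\<in>?O. ?d x)"
    by (rule sum.reindex_bij_witness[of _ prod.swap prod.swap]) (auto simp: nbr_def adj_V2 adj_sym)
  have sq: "(\<Sum>(x, y)\<in>?O. ?d x) = (\<Sum>x\<in>V. ?d x * ?d x)"
    using finV by (simp add: sum.Sigma[symmetric])
  have "{(x, y, z). tri x y z} = (\<lambda>((x, y), z). (x, y, z)) ` (SIGMA (x, y):?O. cod x y)"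
    by (auto simp: image_iff tri_def nbr_def cod_def adj_V)
  moreover have "inj_on (\<lambda>((x, y), z). (x, y, z)) (SIGMA (x, y):?O. cod x y)"
    by (auto simp: inj_on_def)
  ultimately have "card {(x, y, z). tri x y z} = card (SIGMA (x, y):?O. cod x y)"
    by (metis card_image)
  also have "\<dots> = (\<Sum>(x, y)\<in>?O. card (cod x y))"
    using finO by (subst card_SigmaI) (auto simp: case_prod_beta)
  finally have ot: "(\<Sum>(x, y)\<in>?O. card (cod x y)) = card {(x, y, z). tri x y z}" by simp
  have "?d x + ?d y \<le> card V + card (cod x y)" if "(x, y) \<in> ?O" for x y
  proof -
    have "cod x y = nbr x \<inter> nbr y" by (auto simp: cod_def nbr_def)
    then have "?d x + ?d y = card (nbr x \<union> nbr y) + card (cod x y)"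
      by (metis card_Un_Int finite_nbr)
    moreover have "card (nbr x \<union> nbr y) \<le> card V"
      using finV by (intro card_mono) (auto simp: nbr_def adj_V2)
    ultimately show ?thesis by linarith
  qed
  then have "(\<Sum>(x, y)\<in>?O. ?d x + ?d y) \<le> (\<Sum>(x, y)\<in>?O. card V + card (cod x y))"
    by (intro sum_mono) auto
  then have "2 * (\<Sum>x\<in>V. ?d x * ?d x) \<le> card V * card ?O + card {(x, y, z). tri x y z}"
    using swap sq ot by (simp add: case_prod_beta sum.distrib mult.commute)
  then have "card V * (2 * (\<Sum>x\<in>V. ?d x * ?d x)) \<le> card V * (card V * card ?O + card {(x, y, z). tri x y z})"
    by (rule mult_le_mono2)
  moreover have "card ?O * card ?O \<le> card V * (\<Sum>x\<in>V. ?d x * ?d x)"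
    using sum_square_le_card[of ?d V] sumd by simp
  ultimately have "2 * (card ?O * card ?O) \<le> card V * (card V * card ?O + card {(x, y, z). tri x y z})"
    by linarith
  then show ?thesis unfolding card_ordered_edges .
qed

end

text \<open>\<open>m\<close> stands for the number of ordered edges and \<open>c * (n * n)\<close>
  for the bound on ordered triangles in Goodman's inequality. The negated claim is multiplied by
  \<open>m\<close> and by \<open>c * n\<close>; its strictness in the first product forces
  \<open>m = 0\<close>.\<close>

lemma quadratic_step:
  fixes m n c :: nat
  assumes "2 * (m * m) \<le> n * (n * m + c * (n * n))"
  shows "2 * m \<le> n * n + 2 * c * n"
proof (rule ccontr)
  assume neg: "\<not> ?thesis"
  then have m: "2 * m > n * n + 2 * c * n" by simp
  have "m * (2 * m) \<ge> m * (n * n + 2 * c * n + 1)" using m by (intro mult_le_mono2) linarith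
  then have 1: "m * (2 * c * n) + m \<le> c * (n * n * n)" using assms by (simp add: algebra_simps)
  have "(2 * m) * (c * n) \<ge> (n * n) * (c * n)" using m by (intro mult_le_mono1) linarith
  then have "c * (n * n * n) \<le> m * (2 * c * n)" by (simp add: algebra_simps)
  then have "m = 0" using 1 by linarith
  then show False using m by simp
qed

context lpath_free
begin

text \<open>One constant for all linear counts; the largest, in
  \<open>card_same_or_opposite\<close>, is 7 times the square of \<open>fiber_bound\<close>.\<close>

definition lin_const :: nat where "lin_const = 8 * (fiber_bound * fiber_bound)"

lemma fiber_bound_pos: "1 \<le> fiber_bound" using codeg_bound_pos by (simp add: fiber_bound_def)

lemma codeg_bound_le: "codeg_bound \<le> fiber_bound"
proof -
  have "codeg_bound * 1 \<le> codeg_bound * (4 * (codeg_bound * codeg_bound))" using codeg_bound_pos by (intro mult_le_mono2) simp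
  then show ?thesis by (simp add: fiber_bound_def power3_eq_cube)
qed

lemma fiber_bound_le: "8 * fiber_bound \<le> lin_const"
  using fiber_bound_pos by (simp add: lin_const_def)

lemma card_heavy_pairs': "card heavy_pairs \<le> lin_const * card V"
  using card_heavy_pairs mult_le_mono1[OF fiber_bound_le, of "card V"] by linarith

lemma card_light_triples': "card light_triples \<le> lin_const * card V"
  using card_light_triples mult_le_mono1[OF fiber_bound_le, of "card V"] by linarith

lemma card_same_or_opposite: "card same_end + card opposite_end \<le> lin_const * card V"
proof -
  have "card same_end + card opposite_end \<le> fiber_bound * (card V + card heavy_pairs) + fiber_bound * (2 * card heavy_pairs)"
    using card_same_end card_opposite_end by linarith
  also have "\<dots> = fiber_bound * (card V + 3 * card heavy_pairs)" by (simp add: algebra_simps)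
  also have "\<dots> \<le> fiber_bound * (fiber_bound * card V + 3 * (fiber_bound * (2 * card V)))"
    using card_heavy_pairs fiber_bound_pos by (intro mult_le_mono2 add_mono) simp_all
  also have "\<dots> \<le> lin_const * card V" by (simp add: lin_const_def algebra_simps)
  finally show ?thesis .
qed

text \<open>A light first edge leaves boundedly many third vertices, and only linearly many first
  edges are heavy.\<close>

lemma card_ordered_triangles: "card {(x, y, z). tri x y z} \<le> lin_const * (card V * card V)"
proof -
  have "{(x, y, z). tri x y z} \<subseteq> (\<lambda>((x, y), z). (x, y, z)) ` (SIGMA q:V \<times> V. light_cod (fst q) (snd q)) \<union>
      (\<lambda>((x, y), z). (x, y, z)) ` (SIGMA q:heavy_pairs. V)" (is "_ \<subseteq> ?R")
  proof clarify
    fix x y z assume xyz: "tri x y z" and no: "(x, y, z) \<notin> (\<lambda>((x, y), z). (x, y, z)) ` (SIGMA q:heavy_pairs. V)"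
    have V: "x \<in> V" "y \<in> V" "z \<in> V" using xyz adj_V adj_V2 unfolding tri_def by blast+
    show "(x, y, z) \<in> (\<lambda>((x, y), z). (x, y, z)) ` (SIGMA q:V \<times> V. light_cod (fst q) (snd q))"
    proof (cases "heavy x y")
      case True
      then have "(x, y, z) \<in> (\<lambda>((x, y), z). (x, y, z)) ` (SIGMA q:heavy_pairs. V)"
        using V by (force simp: heavy_pairs_def)
      then show ?thesis using no by blast
    next
      case False
      then have "z \<in> light_cod x y" using xyz adj_heavy_light unfolding tri_def in_light_cod by blast
      then show ?thesis using V by force
    qed
  qed
  moreover have "finite (SIGMA q:V \<times> V. light_cod (fst q) (snd q))" "finite (SIGMA q:heavy_pairs. V)"
    using light_cod finV finite_heavy_pairs by auto
  ultimately have "card {(x, y, z). tri x y z} \<le>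
    card ((\<lambda>((x, y), z). (x, y, z)) ` (SIGMA q:V \<times> V. light_cod (fst q) (snd q)) \<union>
      (\<lambda>((x, y), z). (x, y, z)) ` (SIGMA q:heavy_pairs. V))" by (intro card_mono) auto
  also have "\<dots> \<le> card (V \<times> V) * codeg_bound + card heavy_pairs * card V"
    using light_cod finV finite_heavy_pairs
    by (intro order_trans[OF card_Un_le] add_mono card_subset_image_Sigma[OF order_refl]) auto
  also have "\<dots> \<le> (card V * card V) * fiber_bound + fiber_bound * (2 * card V) * card V"
    using card_heavy_pairs codeg_bound_le by (intro add_mono mult_le_mono) (auto simp: card_cartesian_product)
  also have "\<dots> = 3 * fiber_bound * (card V * card V)" by (simp add: algebra_simps)
  also have "\<dots> \<le> lin_const * (card V * card V)" using fiber_bound_le by (intro mult_le_mono1) linarith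
  finally show ?thesis .
qed

lemma card_triangles_V: "card (clq 3 V) \<le> lin_const * (card V * card V)"
proof -
  have fin: "finite {(x, y, z). tri x y z}"
    by (rule finite_subset[of _ "V \<times> V \<times> V"]) (auto simp: tri_def adj_V adj_V2 finV)
  have "clq 3 V \<subseteq> (\<lambda>(x, y, z). {x, y, z}) ` {(x, y, z). tri x y z}"
    by (force elim!: clq3E)
  then have "card (clq 3 V) \<le> card {(x, y, z). tri x y z}" using fin by (meson surj_card_le)
  then show ?thesis using card_ordered_triangles by linarith
qed

lemma card_edges_V: "4 * card (clq 2 V) \<le> card V * card V + 2 * lin_const * card V"
proof -
  have "2 * ((2 * card (clq 2 V)) * (2 * card (clq 2 V))) \<le>
    card V * (card V * (2 * card (clq 2 V)) + lin_const * (card V * card V))"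
    using goodman card_ordered_triangles by (meson add_left_mono mult_le_mono2 order_trans)
  then show ?thesis using quadratic_step[of "2 * card (clq 2 V)" "card V" lin_const] by simp
qed

end

section \<open>Transfer of the bounds to induced subgraphs\<close>

lemma (in ugraph) ugraph_induced:
  assumes "W \<subseteq> V"
  shows "ugraph W (\<lambda>x y. adj x y \<and> x \<in> W \<and> y \<in> W)"
  using assms finV finite_subset adj_sym adj_irrefl by unfold_locales auto

lemma (in ugraph) lpath_induced:
  assumes "W \<subseteq> V" "ugraph.lpath W (\<lambda>x y. adj x y \<and> x \<in> W \<and> y \<in> W) j v P"
  shows "lpath j v P"
proof -
  interpret I: ugraph W "\<lambda>x y. adj x y \<and> x \<in> W \<and> y \<in> W" using ugraph_induced[OF assms(1)] .
  from assms(2) show ?thesis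
  proof (induction rule: I.lpath.induct)
    case (lpath_0 v)
    then show ?case using assms(1) lpath.lpath_0 by blast
  next
    case (lpath_Suc j v P b c)
    then show ?case using lpath.lpath_Suc unfolding tri_def I.tri_def by blast
  qed
qed

lemma (in ugraph) clq_induced:
  assumes "W \<subseteq> V"
  shows "ugraph.clq (\<lambda>x y. adj x y \<and> x \<in> W \<and> y \<in> W) j W = clq j W"
proof -
  interpret I: ugraph W "\<lambda>x y. adj x y \<and> x \<in> W \<and> y \<in> W" using ugraph_induced[OF assms] .
  show ?thesis unfolding I.clq_def clq_def pairwise_def by blast
qed

context lpath_free
begin

lemma lpath_free_induced:
  assumes "W \<subseteq> V"
  shows "lpath_free W (\<lambda>x y. adj x y \<and> x \<in> W \<and> y \<in> W) t"
proof -
  interpret I: ugraph W "\<lambda>x y. adj x y \<and> x \<in> W \<and> y \<in> W" using ugraph_induced[OF assms] .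
  show ?thesis using t_pos no_lpath lpath_induced[OF assms] by unfold_locales blast+
qed

lemma card_triangles:
  assumes "W \<subseteq> V"
  shows "card (clq 3 W) \<le> lin_const * (card W * card W)"
proof -
  interpret I: lpath_free W "\<lambda>x y. adj x y \<and> x \<in> W \<and> y \<in> W" t using lpath_free_induced[OF assms] .
  show ?thesis using I.card_triangles_V clq_induced[OF assms] by simp
qed

lemma card_edges:
  assumes "W \<subseteq> V"
  shows "4 * card (clq 2 W) \<le> card W * card W + 2 * lin_const * card W"
proof -
  interpret I: lpath_free W "\<lambda>x y. adj x y \<and> x \<in> W \<and> y \<in> W" t using lpath_free_induced[OF assms] .
  show ?thesis using I.card_edges_V clq_induced[OF assms] by simp
qed

subsection \<open>Passing through a set of hubs\<close>

lemma heavy_step: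
  assumes lp: "lpath j v P" and j: "j < 2 * t + 2" and h: "heavy v x" and x: "x \<notin> P"
    and F: "finite F" "card F \<le> 2 * t + 6"
  obtains b where "lpath (Suc j) x (insert b (insert x P))" "b \<notin> F" "b \<notin> P" "b \<noteq> x"
proof -
  have P: "finite P" "card P \<le> 4 * t + 3" using lpath_props[OF lp] j by auto
  have "card (insert x (P \<union> F)) \<le> Suc (card P + card F)"
    using card_Un_le[of P F] P(1) F(1) by (simp add: card_insert_if)
  then have "card (insert x (P \<union> F)) < codeg_bound" using P(2) F(2) unfolding codeg_bound_def by linarith
  then obtain b where b: "b \<notin> insert x (P \<union> F)" "tri v b x"
    using heavy_fresh[OF h, of "insert x (P \<union> F)"] P(1) F(1) by blast
  then show ?thesis using that[of b] lpath_Suc[OF lp b(2)] x by auto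
qed

text \<open>Each vertex of \<^term>\<open>S\<close> is passed through once, using two triangles.\<close>

lemma zigzag:
  assumes "finite S" "lpath j v P" "v \<in> U" "\<And>s u. s \<in> S \<Longrightarrow> u \<in> U \<Longrightarrow> heavy s u"
    and "P \<inter> S = {}" "P \<inter> F = {}" "S \<inter> F = {}" "finite F" "card F + card S \<le> 2 * t + 6"
    and "j + 2 * card S \<le> 2 * t + 2" "codeg_bound \<le> card U"
  shows "\<exists>v' P'. lpath (j + 2 * card S) v' P' \<and> v' \<in> U \<and> P' \<inter> F = {}"
  using assms
proof (induction S arbitrary: j v P rule: finite_induct)
  case empty
  then show ?case by auto
next
  case (insert s S)
  have cardFS: "card (F \<union> S) \<le> 2 * t + 6" "finite (F \<union> S)"
    using insert.prems(7,8) insert.hyps(1,2) card_Un_le[of F S] by auto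
  have 1: "heavy v s" using insert.prems(2,3) heavy_commute by blast
  have 2: "s \<notin> P" using insert.prems(4) by blast
  have 3: "j < 2 * t + 2" using insert.prems(9) insert.hyps by simp
  obtain b where b: "lpath (Suc j) s (Set.insert b (Set.insert s P))" "b \<notin> F \<union> S"
    by (rule heavy_step[OF insert.prems(1) 3 1 2 cardFS(2,1)]) blast
  let ?P1 = "Set.insert b (Set.insert s P)"
  have P1: "finite ?P1" "card ?P1 \<le> 4 * t + 5" "Suc j < 2 * t + 2"
    using lpath_props[OF b(1)] insert.prems(9) insert.hyps by auto
  have "card (?P1 \<union> (F \<union> S)) < card U"
    using P1(2) cardFS(1) card_Un_le[of ?P1 "F \<union> S"] insert.prems(10) unfolding codeg_bound_def by linarith
  then have "\<not> U \<subseteq> ?P1 \<union> (F \<union> S)"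
    using P1(1) cardFS(2) by (meson card_mono finite_UnI not_less)
  then obtain u where u: "u \<in> U" "u \<notin> ?P1" "u \<notin> F \<union> S" by blast
  have 4: "heavy s u" using insert.prems(3) u(1) by blast
  obtain c where c: "lpath (Suc (Suc j)) u (Set.insert c (Set.insert u ?P1))" "c \<notin> F \<union> S"
    by (rule heavy_step[OF b(1) P1(3) 4 u(2) cardFS(2,1)]) blast
  have "\<exists>v' P'. lpath (Suc (Suc j) + 2 * card S) v' P' \<and> v' \<in> U \<and> P' \<inter> F = {}"
  proof (rule insert.IH[OF c(1) u(1)])
    show "Set.insert c (Set.insert u ?P1) \<inter> S = {}" "Set.insert c (Set.insert u ?P1) \<inter> F = {}"
      using b(2) c(2) u(3) insert.prems(4,5,6) insert.hyps(2) by auto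
    show "heavy s' u'" if "s' \<in> S" "u' \<in> U" for s' u' using insert.prems(3) that by blast
  qed (use insert.prems insert.hyps in auto)
  then show ?case using insert.hyps by simp
qed

definition attached :: "'a set \<Rightarrow> 'a set" where
  "attached S = {u \<in> V - S. \<forall>s\<in>S. heavy s u}"

lemma finite_attached [simp]: "finite (attached S)"
  using finV by (simp add: attached_def)

text \<open>Otherwise a zigzag through the t + 1 vertices of \<open>S\<close> would have 2t + 2
  triangles.\<close>

lemma card_attached_less:
  assumes "finite S" "card S = t + 1"
  shows "card (attached S) < codeg_bound"
proof (rule ccontr)
  assume "\<not> ?thesis"
  then have codeg_bound: "codeg_bound \<le> card (attached S)" by simp
  then have "attached S \<noteq> {}" using codeg_bound_pos by auto
  then obtain v where v: "v \<in> attached S" by blast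
  then have "v \<in> V" "v \<notin> S" by (auto simp: attached_def)
  then have "\<exists>v' P'. lpath (0 + 2 * card S) v' P' \<and> v' \<in> attached S \<and> P' \<inter> {} = {}"
    using assms codeg_bound v by (intro zigzag[OF _ lpath_0]) (auto simp: attached_def)
  then show False using no_lpath assms(2) by auto
qed

lemma clq3_obtain:
  assumes "T \<in> clq 3 W" "v \<in> T"
  obtains a b where "T = {v, a, b}" "tri v a b" "v \<noteq> a" "v \<noteq> b" "a \<noteq> b"
proof -
  have "card (T - {v}) = 2" using assms by (auto simp: clq_def card_Diff_singleton)
  then obtain a b where ab: "T - {v} = {a, b}" "a \<noteq> b" by (auto simp: card_2_iff)
  then have T: "T = {v, a, b}" "v \<noteq> a" "v \<noteq> b" using assms(2) by blast+
  then have "tri v a b" using ab(2) assms(1) by (auto simp: tri_def clq3_adj)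
  then show ?thesis using that T ab(2) by blast
qed

lemma tri_rotate: "tri a b c \<Longrightarrow> tri b a c \<and> tri a c b \<and> tri b c a \<and> tri c a b \<and> tri c b a"
  unfolding tri_def using adj_sym by blast

text \<open>Disjoint \<open>T\<close> and \<open>T'\<close> could be linked: \<open>T\<close>, a
  zigzag through t - 1 vertices of \<open>S\<close>, two triangles through the last vertex of
  \<open>S\<close>, then \<open>T'\<close>. This makes 1 + 2(t - 1) + 2 + 1 = 2t + 2
  triangles.\<close>

lemma touching_triangles_meet:
  assumes S: "card S = t" and codeg_bound: "codeg_bound \<le> card (attached S)"
    and T: "T \<in> clq 3 (V - S)" "T \<inter> attached S \<noteq> {}" and T': "T' \<in> clq 3 (V - S)" "T' \<inter> attached S \<noteq> {}"
  shows "T \<inter> T' \<noteq> {}"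
proof
  assume disj: "T \<inter> T' = {}"
  obtain s where "s \<in> S" using S t_pos by fastforce
  have finS: "finite S" using S t_pos card_ge_0_finite[of S] by simp
  \<comment> \<open>\<open>s\<close> is held back because a zigzag ends at some unspecified attached
    vertex; the passage through \<open>s\<close> leads to the prescribed vertex
    \<open>v'\<close>.\<close>
  define S' where "S' = S - {s}"
  have S': "S = insert s S'" "s \<notin> S'" "finite S'" "card S' = t - 1"
    using \<open>s \<in> S\<close> finS S unfolding S'_def by auto
  obtain v where v: "v \<in> T" "v \<in> attached S" using T(2) by blast
  obtain a b where T_eq: "T = {v, a, b}" "tri v a b" using clq3_obtain[OF T(1) v(1)] by metis
  obtain v' where v': "v' \<in> T'" "v' \<in> attached S" using T'(2) by blast
  obtain c d where T'_eq: "T' = {v', c, d}" "tri v' c d" "v' \<noteq> c" "v' \<noteq> d" "c \<noteq> d"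
    using clq3_obtain[OF T'(1) v'(1)] by metis
  have TS: "T \<inter> S = {}" "T' \<inter> S = {}" "T \<subseteq> V" using T(1) T'(1) by (auto simp: clq_def)
  have ne: "a \<noteq> b" "a \<noteq> v" "b \<noteq> v" using T_eq(2) adj_irrefl unfolding tri_def by blast+
  have "tri b a v" using T_eq(2) tri_rotate by blast
  then have 1: "lpath (Suc 0) v (insert a (insert v {b}))"
    using T_eq(1) TS(3) ne by (intro lpath_Suc[OF lpath_0]) auto
  have "card (insert s T') \<le> 4" using T'(1) by (simp add: clq_def card_insert_if card_ge_0_finite)
  have finT': "finite T'" using T'_eq(1) by simp
  have "\<exists>v'' P'. lpath (Suc 0 + 2 * card S') v'' P' \<and> v'' \<in> attached S \<and> P' \<inter> insert s T' = {}"
  proof (rule zigzag[OF S'(3) 1 v(2)])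
    show "heavy s' u" if "s' \<in> S'" "u \<in> attached S" for s' u using that S'(1) by (auto simp: attached_def)
    show "insert a (insert v {b}) \<inter> S' = {}" "insert a (insert v {b}) \<inter> insert s T' = {}"
      using TS(1) S'(1) disj T_eq(1) by auto
    show "S' \<inter> insert s T' = {}" using S'(1,2) TS(2) by auto
    show "card (insert s T') + card S' \<le> 2 * t + 6" using \<open>card (insert s T') \<le> 4\<close> S'(4) by linarith
    show "Suc 0 + 2 * card S' \<le> 2 * t + 2" using S'(4) t_pos by simp
  qed (use finT' codeg_bound in auto)
  then obtain v'' P' where 2: "lpath (Suc (2 * (t - 1))) v'' P'" "v'' \<in> attached S" "P' \<inter> insert s T' = {}"
    using S'(4) by auto
  have 3: "heavy v'' s" using 2(2) \<open>s \<in> S\<close> heavy_commute unfolding attached_def by blast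
  have 4: "s \<notin> P'" "Suc (2 * (t - 1)) < 2 * t + 2" "card T' \<le> 2 * t + 6"
    using 2(3) t_pos T'(1) by (auto simp: clq_def)
  obtain e where e: "lpath (Suc (Suc (2 * (t - 1)))) s (insert e (insert s P'))" "e \<notin> T'"
    by (rule heavy_step[OF 2(1) 4(2) 3 4(1) finT' 4(3)]) blast
  have 5: "heavy s v'" using v'(2) \<open>s \<in> S\<close> unfolding attached_def by blast
  have 6: "v' \<notin> insert e (insert s P')" "Suc (Suc (2 * (t - 1))) < 2 * t + 2"
    using v'(1) e(2) 2(3) TS(2) \<open>s \<in> S\<close> t_pos by auto
  obtain g where g: "lpath (Suc (Suc (Suc (2 * (t - 1))))) v' (insert g (insert v' (insert e (insert s P'))))" "g \<notin> T'"
    by (rule heavy_step[OF e(1) 6(2) 5 6(1) finT' 4(3)]) blast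
  have "c \<notin> insert g (insert v' (insert e (insert s P')))" "d \<notin> insert g (insert v' (insert e (insert s P')))"
    using g(2) e(2) 2(3) TS(2) \<open>s \<in> S\<close> T'_eq by auto
  then have "\<exists>P. lpath (Suc (Suc (Suc (Suc (2 * (t - 1)))))) d P"
    using lpath_Suc[OF g(1) T'_eq(2)] by blast
  moreover have "Suc (Suc (Suc (Suc (2 * (t - 1))))) = 2 * t + 2" using t_pos by simp
  ultimately show False using no_lpath by auto
qed

text \<open>Run through \<open>T\<close> to \<open>v\<close>, through \<open>T'\<close> to an
  attached vertex other than \<open>v\<close>, then zigzag through all of \<open>S\<close>: 2 + 2t
  triangles. Exchanging the two triangles gives the same conclusion for \<open>T\<close>.\<close>

lemma no_touching_bowtie:
  assumes S: "card S = t" and codeg_bound: "codeg_bound \<le> card (attached S)"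
    and T: "T \<in> clq 3 (V - S)" and T': "T' \<in> clq 3 (V - S)"
    and I: "T \<inter> T' = {v}"
  shows "T' \<inter> attached S \<subseteq> {v}"
proof (rule ccontr)
  assume "\<not> ?thesis"
  then obtain w where w: "w \<in> T'" "w \<in> attached S" "w \<noteq> v" by blast
  have finS: "finite S" using S t_pos card_ge_0_finite[of S] by simp
  have vT: "v \<in> T" "v \<in> T'" using I by auto
  obtain a b where T_eq: "T = {v, a, b}" "tri v a b" "v \<noteq> a" "v \<noteq> b" "a \<noteq> b"
    by (rule clq3_obtain[OF T vT(1)])
  obtain d where T'_eq: "T' = {v, w, d}" "tri v w d" "v \<noteq> d" "w \<noteq> d"
  proof -
    obtain x y where xy: "T' = {v, x, y}" "tri v x y" "v \<noteq> x" "v \<noteq> y" "x \<noteq> y"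
      by (rule clq3_obtain[OF T' vT(2)])
    then consider "w = x" | "w = y" using w by blast
    then show ?thesis
    proof cases
      case 1
      then show ?thesis using that[of y] xy by simp
    next
      case 2
      then show ?thesis using that[of x] xy tri_rotate[OF xy(2)] by (simp add: insert_commute)
    qed
  qed
  have TS: "T \<inter> S = {}" "T' \<inter> S = {}" "T \<subseteq> V" using T T' by (auto simp: clq_def)
  have 1: "lpath (Suc 0) v (insert b (insert v {a}))"
    using T_eq TS(3) tri_rotate[OF T_eq(2)] by (intro lpath_Suc[OF lpath_0]) auto
  have 2: "lpath (Suc (Suc 0)) w (insert d (insert w (insert b (insert v {a}))))"
    using T_eq T'_eq I w(3) tri_rotate[OF T'_eq(2)] by (intro lpath_Suc[OF 1]) auto
  have "\<exists>v' P'. lpath (Suc (Suc 0) + 2 * card S) v' P' \<and> v' \<in> attached S \<and> P' \<inter> {} = {}"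
  proof (rule zigzag[OF finS 2 w(2)])
    show "heavy s u" if "s \<in> S" "u \<in> attached S" for s u using that by (auto simp: attached_def)
    show "insert d (insert w (insert b (insert v {a}))) \<inter> S = {}"
      using T_eq(1) T'_eq(1) TS(1,2) by auto
    show "card {} + card S \<le> 2 * t + 6" "Suc (Suc 0) + 2 * card S \<le> 2 * t + 2" using S by simp_all
  qed (use codeg_bound in simp_all)
  moreover have "Suc (Suc 0) + 2 * card S = 2 * t + 2" using S by simp
  ultimately show False using no_lpath by metis
qed

subsection \<open>Stability\<close>

definition heavy_nbr :: "'a \<Rightarrow> 'a set" where "heavy_nbr x = {y. heavy x y}"

lemma finite_heavy_nbr [simp]: "finite (heavy_nbr x)"
  by (rule finite_subset[OF _ finV]) (use heavy_adj adj_V in \<open>auto simp: heavy_nbr_def\<close>)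

lemma sum_heavy_nbr: "(\<Sum>x\<in>V. card (heavy_nbr x)) = card heavy_pairs"
proof -
  have "heavy_pairs = (SIGMA x:V. heavy_nbr x)" using heavy_adj adj_V unfolding heavy_pairs_def heavy_nbr_def by blast
  then show ?thesis using finV by (simp add: card_SigmaI)
qed

definition hub :: "nat \<Rightarrow> 'a set" where
  "hub q = {a \<in> V. card V \<le> q * card (heavy_nbr a)}"

definition hub_nbr :: "nat \<Rightarrow> 'a \<Rightarrow> 'a set" where
  "hub_nbr q v = {a \<in> hub q. heavy a v}"

lemma hub_subset: "hub q \<subseteq> V" and finite_hub [simp]: "finite (hub q)"
  using finV by (auto simp: hub_def)

lemma hub_nbr_subset: "hub_nbr q v \<subseteq> hub q" and finite_hub_nbr [simp]: "finite (hub_nbr q v)"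
  by (auto simp: hub_nbr_def)

lemma card_hub:
  assumes "V \<noteq> {}"
  shows "card (hub q) \<le> q * lin_const"
proof -
  have "card (hub q) * card V = (\<Sum>a\<in>hub q. card V)" by simp
  also have "\<dots> \<le> (\<Sum>a\<in>hub q. q * card (heavy_nbr a))" by (intro sum_mono) (simp add: hub_def)
  also have "\<dots> \<le> (\<Sum>a\<in>V. q * card (heavy_nbr a))" using finV hub_subset by (intro sum_mono2) auto
  also have "\<dots> = q * card heavy_pairs" by (simp add: sum_heavy_nbr flip: sum_distrib_left)
  also have "\<dots> \<le> q * (lin_const * card V)" using card_heavy_pairs' by (rule mult_le_mono2)
  finally have "card (hub q) * card V \<le> (q * lin_const) * card V" by (simp add: mult.assoc)
  then show ?thesis using assms finV by auto
qed

definition cherries :: "nat \<Rightarrow> ('a \<times> 'a \<times> 'a) set" where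
  "cherries q = (SIGMA y:V - hub q. heavy_nbr y \<times> heavy_nbr y)"

text \<open>A non-hub has heavy degree below n / q, so the sum of the squared heavy degrees is at
  most n / q times the number of heavy pairs. This is the quadratic error that a large
  \<open>q\<close> has to control.\<close>

lemma card_cherries: "q * card (cherries q) \<le> lin_const * (card V * card V)"
proof -
  have "q * card (cherries q) = (\<Sum>y\<in>V - hub q. (q * card (heavy_nbr y)) * card (heavy_nbr y))"
    using finV by (simp add: cherries_def card_SigmaI card_cartesian_product sum_distrib_left mult.assoc)
  also have "\<dots> \<le> (\<Sum>y\<in>V - hub q. card V * card (heavy_nbr y))"
    by (intro sum_mono mult_le_mono1) (auto simp: hub_def)
  also have "\<dots> \<le> (\<Sum>y\<in>V. card V * card (heavy_nbr y))" using finV by (intro sum_mono2) auto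
  also have "\<dots> = card V * card heavy_pairs" by (simp add: sum_heavy_nbr flip: sum_distrib_left)
  also have "\<dots> \<le> card V * (lin_const * card V)" using card_heavy_pairs' by (rule mult_le_mono2)
  finally show ?thesis by (simp add: algebra_simps)
qed

section \<open>Triangles with a single heavy edge\<close>

definition one_heavy :: "'a set set" where
  "one_heavy = {T \<in> clq 3 V. \<exists>x y z. T = {x, y, z} \<and> light x y \<and> light x z \<and> heavy y z}"

lemma finite_one_heavy: "finite one_heavy"
  by (rule finite_subset[OF _ finite_clq[OF finV, of 3]]) (auto simp: one_heavy_def)

lemma one_heavy_light_at:
  assumes "T \<in> one_heavy" "v \<in> T"
  shows "\<exists>u w. T = {v, u, w} \<and> w \<in> light_cod v u"
proof -
  obtain x y z where xyz: "T = {x, y, z}" "light x y" "light x z" "heavy y z"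
    using assms(1) unfolding one_heavy_def by blast
  have *: "adj x y" "adj x z" "adj y z" "adj z y" "adj z x" "adj y x"
    using xyz light_adj heavy_adj by blast+
  from assms(2) xyz(1) consider "v = x" | "v = y" | "v = z" by blast
  then show ?thesis
  proof cases
    case 1
    then have "T = {v, y, z}" "z \<in> light_cod v y" using xyz * by (auto simp: in_light_cod)
    then show ?thesis by blast
  next
    case 2
    then have "T = {v, x, z}" "z \<in> light_cod v x" using xyz * light_commute by (auto simp: in_light_cod)
    then show ?thesis by blast
  next
    case 3
    then have "T = {v, x, y}" "y \<in> light_cod v x" using xyz * light_commute by (auto simp: in_light_cod)
    then show ?thesis by blast
  qed
qed

text \<open>Every vertex of such a triangle is on one of its two light edges, and a light edge has
  few common neighbours.\<close>

lemma card_one_heavy_touching: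
  assumes X: "X \<subseteq> V"
  shows "card {T \<in> one_heavy. T \<inter> X \<noteq> {}} \<le> card X * (card V * codeg_bound)"
proof (rule card_subset_image_Sigma)
  let ?A = "\<lambda>v. SIGMA u:V. light_cod v u"
  show "{T \<in> one_heavy. T \<inter> X \<noteq> {}} \<subseteq> (\<lambda>(v, u, w). {v, u, w}) ` Sigma X ?A"
  proof
    fix T assume "T \<in> {T \<in> one_heavy. T \<inter> X \<noteq> {}}"
    then obtain v where v: "T \<in> one_heavy" "v \<in> T" "v \<in> X" by blast
    obtain u w where uw: "T = {v, u, w}" "w \<in> light_cod v u" using one_heavy_light_at[OF v(1,2)] by blast
    then have "u \<in> V" using light_adj adj_V in_light_cod by blast
    then have "(v, u, w) \<in> Sigma X ?A" using v(3) uw(2) by blast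
    then show "T \<in> (\<lambda>(v, u, w). {v, u, w}) ` Sigma X ?A" using uw(1) by force
  qed
  show "finite X" using X finV finite_subset by blast
  show "finite (?A v) \<and> card (?A v) \<le> card V * codeg_bound" for v
  proof
    show "finite (?A v)" using finV light_cod by auto
    show "card (?A v) \<le> card V * codeg_bound"
      using finV light_cod by (intro card_subset_image_Sigma[of _ id]) auto
  qed
qed

definition overfull :: "nat \<Rightarrow> 'a set" where
  "overfull q = {v \<in> V - hub q. t + 1 \<le> card (hub_nbr q v)}"

lemma card_subsets_le: "finite A \<Longrightarrow> card {S. S \<subseteq> A \<and> P S} \<le> 2 ^ card A"
  using card_mono[of "Pow A" "{S. S \<subseteq> A \<and> P S}"] by (auto simp: card_Pow)

lemma card_UN_subsets:
  assumes "finite A" "\<And>S. S \<subseteq> A \<Longrightarrow> P S \<Longrightarrow> card (X S) \<le> b"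
  shows "card (\<Union>S\<in>{S. S \<subseteq> A \<and> P S}. X S) \<le> 2 ^ card A * b"
proof -
  have "finite {S. S \<subseteq> A \<and> P S}" using assms(1) by simp
  then have "card (\<Union>S\<in>{S. S \<subseteq> A \<and> P S}. X S) \<le> (\<Sum>S\<in>{S. S \<subseteq> A \<and> P S}. card (X S))"
    by (rule card_UN_le)
  also have "\<dots> \<le> card {S. S \<subseteq> A \<and> P S} * b"
    using sum_bounded_above[of "{S. S \<subseteq> A \<and> P S}" "\<lambda>S. card (X S)" b] assms(2) by simp
  also have "\<dots> \<le> 2 ^ card A * b" using card_subsets_le[OF assms(1)] by (rule mult_le_mono1)
  finally show ?thesis .
qed

lemma attached_hub_nbr: "v \<in> V - hub q \<Longrightarrow> S \<subseteq> hub_nbr q v \<Longrightarrow> v \<in> attached S"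
  using hub_nbr_subset by (auto simp: attached_def hub_nbr_def)

text \<open>An overfull vertex is attached to some (t + 1)-set of hubs, and each such set has fewer
  than \<open>codeg_bound\<close> attached vertices.\<close>

lemma card_overfull: "card (overfull q) \<le> 2 ^ card (hub q) * codeg_bound"
proof -
  have "overfull q \<subseteq> (\<Union>S\<in>{S. S \<subseteq> hub q \<and> card S = t + 1}. attached S)"
  proof
    fix v assume v: "v \<in> overfull q"
    then have "t + 1 \<le> card (hub_nbr q v)" "v \<in> V - hub q" by (simp_all add: overfull_def)
    obtain S where S: "S \<subseteq> hub_nbr q v" "card S = t + 1"
      by (rule obtain_subset_with_card_n[OF \<open>t + 1 \<le> card (hub_nbr q v)\<close>])
    have "S \<in> {S. S \<subseteq> hub q \<and> card S = t + 1}" using S hub_nbr_subset by auto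
    moreover have "v \<in> attached S" using attached_hub_nbr[OF \<open>v \<in> V - hub q\<close> S(1)] .
    ultimately show "v \<in> (\<Union>S\<in>{S. S \<subseteq> hub q \<and> card S = t + 1}. attached S)" by (rule UN_I)
  qed
  then have "card (overfull q) \<le> card (\<Union>S\<in>{S. S \<subseteq> hub q \<and> card S = t + 1}. attached S)"
    by (intro card_mono) auto
  also have "\<dots> \<le> 2 ^ card (hub q) * codeg_bound"
  proof (rule card_UN_subsets)
    fix S assume "S \<subseteq> hub q" "card S = t + 1"
    then show "card (attached S) \<le> codeg_bound" using card_attached_less[of S] finite_subset[of S "hub q"] by simp
  qed simp
  finally show ?thesis .
qed

definition one_heavy_low :: "nat \<Rightarrow> 'a set set" where
  "one_heavy_low q = {T \<in> one_heavy. T \<subseteq> V - hub q \<and> (\<forall>v\<in>T. card (hub_nbr q v) < t)}"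

text \<open>A triangle outside \<open>one_heavy_low\<close> touches a hub or an overfull vertex, or
  has a vertex attached to a t-set \<open>S\<close> of hubs. For fixed \<open>S\<close>, either few
  vertices are attached, or all these triangles meet each other and hence touch one fixed
  triangle.\<close>

lemma card_one_heavy:
  "card one_heavy \<le> card (one_heavy_low q) + (card (hub q) + 2 ^ card (hub q) * (2 * codeg_bound + 3)) * (card V * codeg_bound)"
proof -
  let ?n = "card V" and ?a = "card (hub q)"
  let ?S = "\<lambda>S. {T \<in> one_heavy. T \<subseteq> V - hub q \<and> T \<inter> attached S \<noteq> {}}"
  let ?Ss = "\<Union>S\<in>{S. S \<subseteq> hub q \<and> card S = t}. ?S S"
  let ?X = "{T \<in> one_heavy. T \<inter> (hub q \<union> overfull q) \<noteq> {}}"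
  have "one_heavy \<subseteq> one_heavy_low q \<union> (?X \<union> ?Ss)"
  proof
    fix T assume T: "T \<in> one_heavy"
    show "T \<in> one_heavy_low q \<union> (?X \<union> ?Ss)"
    proof (rule ccontr)
      assume no: "\<not> ?thesis"
      have TV: "T \<subseteq> V" using T by (auto simp: one_heavy_def clq_def)
      then have "T \<subseteq> V - hub q" using no T by blast
      moreover obtain v where v: "v \<in> T" "\<not> card (hub_nbr q v) < t"
        using no T \<open>T \<subseteq> V - hub q\<close> unfolding one_heavy_low_def by blast
      moreover have "v \<notin> overfull q" using no T v(1) by blast
      ultimately have "card (hub_nbr q v) = t" "v \<in> V - hub q" unfolding overfull_def by auto
      then have "T \<in> ?S (hub_nbr q v)" using T \<open>T \<subseteq> V - hub q\<close> v(1) attached_hub_nbr[of v q "hub_nbr q v"] by blast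
      moreover have "hub_nbr q v \<in> {S. S \<subseteq> hub q \<and> card S = t}"
        using \<open>card (hub_nbr q v) = t\<close> hub_nbr_subset by simp
      ultimately have "T \<in> ?Ss" by (rule UN_I[rotated])
      then show False using no by simp
    qed
  qed
  then have "card one_heavy \<le> card (one_heavy_low q \<union> (?X \<union> ?Ss))"
    using finite_one_heavy by (intro card_mono) (auto simp: one_heavy_low_def)
  also have "\<dots> \<le> card (one_heavy_low q) + (card ?X + card ?Ss)"
    by (intro order_trans[OF card_Un_le] add_mono order_refl card_Un_le)
  finally have 1: "card one_heavy \<le> card (one_heavy_low q) + (card ?X + card ?Ss)" .
  have "card ?X \<le> card (hub q \<union> overfull q) * (?n * codeg_bound)"
    using hub_subset by (intro card_one_heavy_touching) (auto simp: overfull_def)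
  also have "\<dots> \<le> (?a + 2 ^ ?a * codeg_bound) * (?n * codeg_bound)"
    using card_Un_le[of "hub q" "overfull q"] card_overfull[of q] by (intro mult_le_mono1) linarith
  finally have 2: "card ?X \<le> (?a + 2 ^ ?a * codeg_bound) * (?n * codeg_bound)" .
  \<comment> \<open>\<open>codeg_bound\<close> covers the case of few attached vertices, 3 the
    vertices of one fixed triangle.\<close>
  have "card ?Ss \<le> 2 ^ ?a * ((codeg_bound + 3) * (?n * codeg_bound))"
  proof (rule card_UN_subsets)
    fix S assume S: "S \<subseteq> hub q" "card S = t"
    have sub: "?S S \<subseteq> clq 3 (V - S)" using S(1) by (auto simp: one_heavy_def clq_def)
    show "card (?S S) \<le> (codeg_bound + 3) * (?n * codeg_bound)"
    proof (cases "card (attached S) < codeg_bound")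
      case True
      have "card (?S S) \<le> card {T \<in> one_heavy. T \<inter> attached S \<noteq> {}}"
        using finite_one_heavy by (intro card_mono) auto
      also have "\<dots> \<le> card (attached S) * (?n * codeg_bound)" by (rule card_one_heavy_touching) (auto simp: attached_def)
      also have "\<dots> \<le> (codeg_bound + 3) * (?n * codeg_bound)" using True by (intro mult_le_mono1) linarith
      finally show ?thesis .
    next
      case False
      show ?thesis
      proof (cases "?S S = {}")
        case False
        then obtain T0 where T0: "T0 \<in> ?S S" by blast
        have "?S S \<subseteq> {T \<in> one_heavy. T \<inter> T0 \<noteq> {}}"
        proof
          fix T assume "T \<in> ?S S"
          then show "T \<in> {T \<in> one_heavy. T \<inter> T0 \<noteq> {}}"
            using touching_triangles_meet[OF S(2), of T T0] \<open>\<not> card (attached S) < codeg_bound\<close> sub T0 by auto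
        qed
        then have "card (?S S) \<le> card {T \<in> one_heavy. T \<inter> T0 \<noteq> {}}"
          using finite_one_heavy by (intro card_mono) auto
        also have "\<dots> \<le> card T0 * (?n * codeg_bound)" using T0 by (intro card_one_heavy_touching) auto
        also have "\<dots> \<le> (codeg_bound + 3) * (?n * codeg_bound)" using T0 by (intro mult_le_mono1) (simp add: one_heavy_def clq_def)
        finally show ?thesis .
      qed (use card.empty in \<open>metis zero_le\<close>)
    qed
  qed simp
  then have "card ?X + card ?Ss \<le> (?a + 2 ^ ?a * codeg_bound) * (?n * codeg_bound) + (2 ^ ?a * (codeg_bound + 3)) * (?n * codeg_bound)"
    using 2 by (simp only: mult.assoc)
  also have "\<dots> = (?a + 2 ^ ?a * (2 * codeg_bound + 3)) * (?n * codeg_bound)" by (simp add: algebra_simps)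
  finally show ?thesis using 1 by linarith
qed

definition low_edges :: "nat \<Rightarrow> 'a set set" where
  "low_edges q = {e \<in> clq 2 (V - hub q). \<forall>v\<in>e. card (hub_nbr q v) < t}"

lemma one_heavy_two_light_edges:
  assumes "T \<in> one_heavy_low q"
  shows "2 \<le> card {e \<in> {e \<in> low_edges q. \<exists>x y. e = {x, y} \<and> light x y}. e \<subseteq> T}" (is "_ \<le> card ?X")
proof -
  obtain x y z where xyz: "T = {x, y, z}" "light x y" "light x z" "heavy y z"
    using assms unfolding one_heavy_low_def one_heavy_def by blast
  have "{x, y} \<in> low_edges q" "{x, z} \<in> low_edges q"
    using assms xyz light_adj by (auto simp: low_edges_def pair_in_clq one_heavy_low_def)
  then have "{{x, y}, {x, z}} \<subseteq> ?X"
    using xyz by blast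
  moreover have "finite ?X"
    by (rule finite_subset[of _ "Pow T"]) (use xyz(1) in auto)
  ultimately have "card {{x, y}, {x, z}} \<le> card ?X" by (simp only: card_mono)
  moreover have "y \<noteq> z" using xyz(4) heavy_adj adj_irrefl by blast
  then have "card {{x, y}, {x, z}} = 2" by (simp add: doubleton_eq_iff)
  ultimately show ?thesis by linarith
qed

text \<open>Each triangle is counted at its two light edges. An edge in r of the triangles
  contributes r \<le> 1 + r(r - 1), where r(r - 1) counts ordered pairs of distinct triangles on
  that edge; these come from \<open>same_end\<close> and \<open>opposite_end\<close>, so they number
  O(n).\<close>

lemma card_one_heavy_low: "2 * card (one_heavy_low q) \<le> card (low_edges q) + lin_const * card V"
proof -
  let ?L = "{e \<in> low_edges q. \<exists>x y. e = {x, y} \<and> light x y}"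
  let ?q = "\<lambda>e. {T \<in> one_heavy_low q. e \<subseteq> T}"
  have finL: "finite (low_edges q)" using finite_clq[of "V - hub q" 2] finV by (simp add: low_edges_def)
  have finT: "finite (one_heavy_low q)" using finite_one_heavy by (simp add: one_heavy_low_def)
  have "card (one_heavy_low q) * 2 \<le> (\<Sum>T\<in>one_heavy_low q. card {e \<in> ?L. e \<subseteq> T})"
    using sum_bounded_below[of "one_heavy_low q" 2 "\<lambda>T. card {e \<in> ?L. e \<subseteq> T}"] one_heavy_two_light_edges
    by (simp only: of_nat_id mult.commute)
  also have "\<dots> = (\<Sum>e\<in>?L. card (?q e))"
    using finL finT by (intro sum_multicount_gen) auto
  finally have "2 * card (one_heavy_low q) \<le> (\<Sum>e\<in>?L. card (?q e))" by simp
  also have "\<dots> \<le> (\<Sum>e\<in>?L. 1 + card (?q e) * (card (?q e) - 1))"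
  proof (rule sum_mono)
    fix e
    show "card (?q e) \<le> 1 + card (?q e) * (card (?q e) - 1)"
      by (cases "card (?q e)"; cases "card (?q e) - 1") auto
  qed
  also have "\<dots> = card ?L + (\<Sum>e\<in>?L. card (?q e) * (card (?q e) - 1))" by (simp only: sum.distrib card_eq_sum)
  also have "(\<Sum>e\<in>?L. card (?q e) * (card (?q e) - 1)) = card (SIGMA e:?L. SIGMA T:?q e. ?q e - {T})"
    using finL finT by (simp add: card_SigmaI card_Diff_singleton)
  also have "\<dots> \<le> card (same_end \<union> opposite_end)"
  proof (rule surj_card_le)
    show "finite (same_end \<union> opposite_end)" using finite_same_end finite_opposite_end by blast
    show "(SIGMA e:?L. SIGMA T:?q e. ?q e - {T}) \<subseteq>
      (\<lambda>(x, y, z, z'). ({x, y}, {x, y, z}, {x, y, z'})) ` (same_end \<union> opposite_end)"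
    proof
      fix \<tau> assume "\<tau> \<in> (SIGMA e:?L. SIGMA T:?q e. ?q e - {T})"
      then obtain e T T' where \<tau>: "\<tau> = (e, T, T')" "e \<in> ?L" "T \<in> ?q e" "T' \<in> ?q e" "T' \<noteq> T"
        by blast
      then obtain x y where e: "e = {x, y}" "light x y" by blast
      have T: "T \<in> one_heavy_low q" "{x, y} \<subseteq> T" and T': "T' \<in> one_heavy_low q" "{x, y} \<subseteq> T'" "T' \<noteq> T"
        using \<tau>(3-5) e(1) by auto
      have third: "\<exists>z. U = {x, y, z} \<and> (light x z \<and> heavy y z \<or> heavy x z \<and> light y z)"
        if U: "U \<in> one_heavy_low q" "{x, y} \<subseteq> U" for U
      proof -
        have xy: "x \<noteq> y" using e(2) light_adj adj_irrefl by blast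
        obtain u v w where uvw: "U = {u, v, w}" "light u v" "light u w" "heavy v w"
          using U(1) unfolding one_heavy_low_def one_heavy_def by blast
        have "\<not> (x = v \<and> y = w)" "\<not> (x = w \<and> y = v)"
          using uvw(4) e(2) not_heavy_light heavy_commute by blast+
        then consider "x = u" "y = v" | "x = u" "y = w" | "x = v" "y = u" | "x = w" "y = u"
          using U(2) uvw(1) xy by blast
        then show ?thesis
        proof cases
          case 1
          then show ?thesis using uvw by blast
        next
          case 2
          then have "U = {x, y, v}" "light x v" "heavy y v" using uvw heavy_commute by auto
          then show ?thesis by blast
        next
          case 3
          then have "U = {x, y, w}" "heavy x w" "light y w" using uvw by auto
          then show ?thesis by blast
        next
          case 4
          then have "U = {x, y, v}" "heavy x v" "light y v" using uvw heavy_commute by auto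
          then show ?thesis by blast
        qed
      qed
      obtain z where z: "T = {x, y, z}" "light x z \<and> heavy y z \<or> heavy x z \<and> light y z" using third[OF T] by blast
      obtain z' where z': "T' = {x, y, z'}" "light x z' \<and> heavy y z' \<or> heavy x z' \<and> light y z'"
        using third[OF T'(1,2)] by blast
      have ne: "z \<noteq> z'" using z(1) z'(1) T'(3) by blast
      have yx: "light y x" using e(2) light_commute by blast
      show "\<tau> \<in> (\<lambda>(x, y, z, z'). ({x, y}, {x, y, z}, {x, y, z'})) ` (same_end \<union> opposite_end)"
      proof -
        \<comment> \<open>Both configurations distinguish the ends of the light edge, so two of the
          four combinations appear with \<open>x\<close> and \<open>y\<close> exchanged.\<close>
        from z(2) z'(2) consider "(x, y, z, z') \<in> same_end \<union> opposite_end" | "(y, x, z, z') \<in> same_end \<union> opposite_end"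
          using e(2) yx ne unfolding same_end_def opposite_end_def by blast
        then show ?thesis
        proof cases
          case 1
          then show ?thesis by (rule rev_image_eqI) (simp add: \<tau>(1) e(1) z(1) z'(1))
        next
          case 2
          then show ?thesis by (rule rev_image_eqI) (simp add: \<tau>(1) e(1) z(1) z'(1) insert_commute)
        qed
      qed
    qed
  qed
  also have "\<dots> \<le> lin_const * card V" using card_same_or_opposite card_Un_le[of same_end opposite_end] by linarith
  finally have "2 * card (one_heavy_low q) \<le> card ?L + lin_const * card V" by simp
  moreover have "card ?L \<le> card (low_edges q)" using finL by (intro card_mono) auto
  ultimately show ?thesis by linarith
qed

section \<open>Weights on the edges outside the hubs\<close>

definition common_hubs :: "nat \<Rightarrow> 'a set \<Rightarrow> nat" where
  "common_hubs q e = card {a \<in> hub q. \<forall>v\<in>e. heavy a v}"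

lemma triangle_types:
  assumes "tri x y z"
  shows "(x, y, z) \<in> light_triples \<or>
    (\<exists>u v w. {x, y, z} = {u, v, w} \<and> light u v \<and> light u w \<and> heavy v w) \<or>
    (\<exists>u v w. {x, y, z} = {u, v, w} \<and> heavy u v \<and> heavy u w \<and> adj v w)"
proof -
  have a: "adj x y" "adj y z" "adj x z" "adj z y" "adj y x" "adj z x"
    using assms tri_rotate[OF assms] unfolding tri_def by blast+
  have perm: "{x, y, z} = {y, x, z}" "{x, y, z} = {z, x, y}" by auto
  show ?thesis
  proof (cases "heavy x y"; cases "heavy y z"; cases "heavy x z")
    assume "\<not> heavy x y" "\<not> heavy y z" "\<not> heavy x z"
    then show ?thesis using a adj_heavy_light unfolding light_triples_def by blast
  next
    assume h: "\<not> heavy x y" "\<not> heavy y z" "heavy x z"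
    then have "light y x" "light y z" using a adj_heavy_light light_commute by blast+
    then show ?thesis using h perm by blast
  next
    assume h: "\<not> heavy x y" "heavy y z" "\<not> heavy x z"
    then have "light x y" "light x z" using a adj_heavy_light by blast+
    then show ?thesis using h by blast
  next
    assume h: "heavy x y" "\<not> heavy y z" "\<not> heavy x z"
    then have "light z x" "light z y" using a adj_heavy_light light_commute by blast+
    then show ?thesis using h perm by blast
  next
    assume h: "\<not> heavy x y" "heavy y z" "heavy x z"
    then have "heavy z x" "heavy z y" using heavy_commute by blast+
    then show ?thesis using a perm by blast
  next
    assume h: "heavy x y" "heavy y z" "heavy x z"
    then have "heavy y x" "heavy y z" using heavy_commute by blast+
    then show ?thesis using a perm by blast
  next
    assume h: "heavy x y" "heavy y z" "\<not> heavy x z"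
    then have "heavy y x" "heavy y z" using heavy_commute by blast+
    then show ?thesis using a perm by blast
  next
    assume h: "heavy x y" "\<not> heavy y z" "heavy x z"
    then show ?thesis using a by blast
  qed
qed

text \<open>Two heavy edges of a triangle meet in a vertex \<open>u\<close>. If \<open>u\<close> is
  no hub, they form a cherry; if a second vertex is a hub, O(n) triangles are possible; otherwise
  \<open>u\<close> is a common hub of the opposite edge.\<close>

lemma card_clq3_le:
  "card (clq 3 V) \<le> card light_triples + card one_heavy + card (cherries q) +
    card (hub q) * (card (hub q) * card V) + (\<Sum>e\<in>clq 2 (V - hub q). common_hubs q e)"
proof -
  let ?s = "\<lambda>(x, y, z). {x, y, z}"
  let ?X = "hub q \<times> (hub q \<times> V)"
  let ?Y = "SIGMA e:clq 2 (V - hub q). {a \<in> hub q. \<forall>v\<in>e. heavy a v}"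
  have finLT: "finite light_triples"
    by (rule finite_subset[of _ "V \<times> V \<times> V"]) (auto simp: light_triples_def adj_V adj_V2 finV dest!: light_adj)
  have finC: "finite (cherries q)" using finV by (simp add: cherries_def)
  have finY: "finite ?Y" using finV finite_clq[of "V - hub q" 2] by auto
  have finX: "finite ?X" using finV by simp
  have "clq 3 V \<subseteq> ?s ` light_triples \<union> one_heavy \<union> ?s ` cherries q \<union> ?s ` ?X \<union> (\<lambda>(e, a). insert a e) ` ?Y"
  proof
    fix T assume T: "T \<in> clq 3 V"
    obtain x y z where xyz: "T = {x, y, z}" "tri x y z" using clq3E[OF T] by metis
    from triangle_types[OF xyz(2)] consider "(x, y, z) \<in> light_triples"
      | u v w where "T = {u, v, w}" "light u v" "light u w" "heavy v w"
      | u v w where "T = {u, v, w}" "heavy u v" "heavy u w" "adj v w"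
      using xyz(1) by blast
    then show "T \<in> ?s ` light_triples \<union> one_heavy \<union> ?s ` cherries q \<union> ?s ` ?X \<union> (\<lambda>(e, a). insert a e) ` ?Y"
    proof cases
      case 1
      then have "T \<in> ?s ` light_triples" by (rule rev_image_eqI) (simp add: xyz(1))
      then show ?thesis by blast
    next
      case (2 u v w)
      then have "T \<in> one_heavy" using T unfolding one_heavy_def by blast
      then show ?thesis by blast
    next
      case (3 u v w)
      have V: "u \<in> V" "v \<in> V" "w \<in> V" using T 3(1) by (auto simp: clq_def)
      show ?thesis
      proof (cases "u \<in> hub q")
        case False
        then have "(u, v, w) \<in> cherries q" using 3 V by (simp add: cherries_def heavy_nbr_def)
        then have "T \<in> ?s ` cherries q" by (rule rev_image_eqI) (simp add: 3(1))
        then show ?thesis by blast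
      next
        case True
        consider "v \<in> hub q" | "w \<in> hub q" | "v \<notin> hub q" "w \<notin> hub q" by blast
        then show ?thesis
        proof cases
          case 1
          then have "(u, v, w) \<in> ?X" using True V by simp
          then have "T \<in> ?s ` ?X" by (rule rev_image_eqI) (simp add: 3(1))
          then show ?thesis by blast
        next
          case 2
          then have "(u, w, v) \<in> ?X" using True V by simp
          then have "T \<in> ?s ` ?X" by (rule rev_image_eqI) (simp add: 3(1) insert_commute)
          then show ?thesis by blast
        next
          case c: 3
          then have "({v, w}, u) \<in> ?Y" using True V 3 by (simp add: pair_in_clq)
          then have "T \<in> (\<lambda>(e, a). insert a e) ` ?Y" by (rule rev_image_eqI) (simp add: 3(1))
          then show ?thesis by blast
        qed
      qed
    qed
  qed
  then have "card (clq 3 V) \<le> card (?s ` light_triples \<union> one_heavy \<union> ?s ` cherries q \<union> ?s ` ?X \<union> (\<lambda>(e, a). insert a e) ` ?Y)"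
    using finLT finite_one_heavy finC finX finY by (intro card_mono) auto
  also have "\<dots> \<le> card light_triples + card one_heavy + card (cherries q) + card ?X + card ?Y"
    by (intro order_trans[OF card_Un_le] add_mono card_image_le finLT finC finX finY order_refl)
  also have "card ?Y = (\<Sum>e\<in>clq 2 (V - hub q). common_hubs q e)"
    using finV finite_clq[of "V - hub q" 2] by (simp add: card_SigmaI common_hubs_def)
  also have "card ?X = card (hub q) * (card (hub q) * card V)" by (simp add: card_cartesian_product)
  finally show ?thesis .
qed

definition full_edges :: "nat \<Rightarrow> 'a set set" where
  "full_edges q = {e \<in> clq 2 (V - hub q). \<exists>S. card S = t \<and> (\<forall>v\<in>e. hub_nbr q v = S)}"

text \<open>The weights are doubled to stay integral. Without overfull ends, a low edge has at most
  t - 1 common hubs and weighs at most 2(t - 1) + 1, an edge neither low nor full weighs at most 2(t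
  - 1), and only a full edge can reach 2t. Edges with an overfull end are charged crudely, as they
  are few.\<close>

lemma edge_weight:
  assumes e: "e \<in> clq 2 (V - hub q)"
  shows "2 * common_hubs q e + of_bool (e \<in> low_edges q) \<le>
    (2 * t - 1) + of_bool (e \<in> full_edges q) + 2 * card (hub q) * of_bool (e \<inter> overfull q \<noteq> {})"
proof -
  obtain x y where xy: "e = {x, y}" "x \<in> V - hub q" "y \<in> V - hub q" using e by (rule clq2E)
  have common_hubs: "common_hubs q e = card (hub_nbr q x \<inter> hub_nbr q y)"
    unfolding common_hubs_def hub_nbr_def xy(1) by (rule arg_cong[of _ _ card]) auto
  have le: "common_hubs q e \<le> card (hub_nbr q x)" "common_hubs q e \<le> card (hub_nbr q y)" "common_hubs q e \<le> card (hub q)"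
    unfolding common_hubs using hub_nbr_subset by (auto intro!: card_mono)
  show ?thesis
  proof (cases "e \<inter> overfull q = {}")
    case False
    then have "e \<notin> low_edges q" unfolding overfull_def low_edges_def by fastforce
    then show ?thesis using False le(3) by simp
  next
    case True
    then have small: "card (hub_nbr q x) \<le> t" "card (hub_nbr q y) \<le> t" using xy unfolding overfull_def by auto
    show ?thesis
    proof (cases "e \<in> low_edges q")
      case True
      then have "card (hub_nbr q x) < t" using xy(1) by (simp add: low_edges_def)
      then show ?thesis using True le(1) by simp
    next
      case False
      show ?thesis
      proof (cases "e \<in> full_edges q")
        case True
        then show ?thesis using False le(1) small t_pos by simp
      next
        case nf: False
        have "common_hubs q e \<noteq> t"
        proof
          assume "common_hubs q e = t"
          then have "card (hub_nbr q x \<inter> hub_nbr q y) = card (hub_nbr q x)" "card (hub_nbr q x \<inter> hub_nbr q y) = card (hub_nbr q y)"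
            using le small common_hubs by auto
          then have "hub_nbr q x \<inter> hub_nbr q y = hub_nbr q x" "hub_nbr q x \<inter> hub_nbr q y = hub_nbr q y"
            by (simp_all add: card_subset_eq)
          then have "hub_nbr q x = hub_nbr q y" "card (hub_nbr q x) = t" using \<open>common_hubs q e = t\<close> common_hubs by auto
          then show False using nf e xy(1) unfolding full_edges_def by auto
        qed
        then have "common_hubs q e < t" using le(1) small(1) by linarith
        then show ?thesis using False nf by simp
      qed
    qed
  qed
qed

text \<open>Full edges stay inside classes of vertices with the same t-set of hubs. The classes are
  disjoint and have at most \<open>x\<close> vertices, so replacing one factor of each squared class
  size by \<open>x\<close> makes the bounds add up to n * x.\<close>

lemma card_full_edges:
  assumes x: "\<And>S. S \<subseteq> V \<Longrightarrow> card S = t \<Longrightarrow> card (attached S) \<le> x"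
  shows "4 * card (full_edges q) \<le> card V * (x + 2 * lin_const)"
proof -
  let ?Ss = "{S. S \<subseteq> hub q \<and> card S = t}" and ?V = "\<lambda>S. {v \<in> V - hub q. hub_nbr q v = S}"
  have fin: "finite ?Ss" by simp
  have "full_edges q \<subseteq> (\<Union>S\<in>?Ss. clq 2 (?V S))"
  proof
    fix e assume e: "e \<in> full_edges q"
    then obtain S where S: "card S = t" "\<forall>v\<in>e. hub_nbr q v = S" and e': "e \<in> clq 2 (V - hub q)"
      unfolding full_edges_def by blast
    obtain a b where "e = {a, b}" using e' by (rule clq2E)
    then have "S \<in> ?Ss" using S hub_nbr_subset[of q a] by auto
    moreover have "e \<in> clq 2 (?V S)" using e' S(2) by (auto simp: clq_def)
    ultimately show "e \<in> (\<Union>S\<in>?Ss. clq 2 (?V S))" by (rule UN_I)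
  qed
  then have "card (full_edges q) \<le> card (\<Union>S\<in>?Ss. clq 2 (?V S))"
    using finV by (intro card_mono) (auto simp: finite_clq)
  also have "\<dots> \<le> (\<Sum>S\<in>?Ss. card (clq 2 (?V S)))" using fin by (rule card_UN_le)
  finally have "4 * card (full_edges q) \<le> (\<Sum>S\<in>?Ss. 4 * card (clq 2 (?V S)))"
    by (simp flip: sum_distrib_left)
  also have "\<dots> \<le> (\<Sum>S\<in>?Ss. card (?V S) * (x + 2 * lin_const))"
  proof (rule sum_mono)
    fix S assume S: "S \<in> ?Ss"
    have "?V S \<subseteq> attached S" using attached_hub_nbr by blast
    then have "card (?V S) \<le> card (attached S)" by (intro card_mono) auto
    also have "\<dots> \<le> x" using S hub_subset by (intro x) auto
    finally have "card (?V S) * card (?V S) \<le> card (?V S) * x" by (rule mult_le_mono2)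
    moreover have "4 * card (clq 2 (?V S)) \<le> card (?V S) * card (?V S) + 2 * lin_const * card (?V S)"
      by (intro card_edges) auto
    moreover have "card (?V S) * (x + 2 * lin_const) = card (?V S) * x + 2 * lin_const * card (?V S)"
      by (simp add: algebra_simps)
    ultimately show "4 * card (clq 2 (?V S)) \<le> card (?V S) * (x + 2 * lin_const)" by linarith
  qed
  also have "\<dots> = (\<Sum>S\<in>?Ss. card (?V S)) * (x + 2 * lin_const)" by (rule sum_distrib_right[symmetric])
  also have "(\<Sum>S\<in>?Ss. card (?V S)) = card (\<Union>S\<in>?Ss. ?V S)"
    using fin finV by (intro card_UN_disjoint[symmetric]) auto
  also have "\<dots> * (x + 2 * lin_const) \<le> card V * (x + 2 * lin_const)"
    using finV by (intro mult_le_mono1 card_mono) auto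
  finally show ?thesis .
qed

lemma card_overfull_edges: "card {e \<in> clq 2 (V - hub q). e \<inter> overfull q \<noteq> {}} \<le> card (overfull q) * card V"
proof (rule card_subset_image_Sigma)
  show "{e \<in> clq 2 (V - hub q). e \<inter> overfull q \<noteq> {}} \<subseteq> (\<lambda>(x, y). {x, y}) ` (SIGMA x:overfull q. V)"
  proof
    fix e assume e: "e \<in> {e \<in> clq 2 (V - hub q). e \<inter> overfull q \<noteq> {}}"
    then obtain x y where xy: "e = {x, y}" "x \<in> V" "y \<in> V" by (auto elim!: clq2E)
    with e have "(x, y) \<in> (SIGMA x:overfull q. V) \<or> (y, x) \<in> (SIGMA x:overfull q. V)" by auto
    then show "e \<in> (\<lambda>(x, y). {x, y}) ` (SIGMA x:overfull q. V)" using xy(1) by (force simp: insert_commute)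
  qed
qed (use finV in \<open>auto simp: overfull_def\<close>)

lemma sum_edge_weights:
  "2 * (\<Sum>e\<in>clq 2 (V - hub q). common_hubs q e) + card (low_edges q) \<le>
    (2 * t - 1) * card (clq 2 V) + card (full_edges q) + 2 * card (hub q) * (card (overfull q) * card V)"
proof -
  let ?E = "clq 2 (V - hub q)"
  have finE: "finite ?E" using finV by (simp add: finite_clq)
  have cnt: "(\<Sum>e\<in>?E. of_bool (P e)) = card {e \<in> ?E. P e}" for P
    using finE by (simp add: sum.If_cases of_bool_def Int_def)
  have "(\<Sum>e\<in>?E. 2 * common_hubs q e + of_bool (e \<in> low_edges q)) \<le>
    (\<Sum>e\<in>?E. (2 * t - 1) + of_bool (e \<in> full_edges q) + 2 * card (hub q) * of_bool (e \<inter> overfull q \<noteq> {}))"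
    by (intro sum_mono edge_weight)
  moreover have "{e \<in> ?E. e \<in> low_edges q} = low_edges q" "{e \<in> ?E. e \<in> full_edges q} = full_edges q"
    by (auto simp: low_edges_def full_edges_def)
  ultimately have "2 * (\<Sum>e\<in>?E. common_hubs q e) + card (low_edges q) \<le>
    (2 * t - 1) * card ?E + card (full_edges q) + 2 * card (hub q) * card {e \<in> ?E. e \<inter> overfull q \<noteq> {}}"
    by (simp only: sum.distrib cnt mult.commute flip: sum_distrib_left) (simp add: mult.commute)
  moreover have "(2 * t - 1) * card ?E \<le> (2 * t - 1) * card (clq 2 V)"
    using finV by (intro mult_le_mono2 card_mono finite_clq clq_mono) auto
  moreover have "2 * card (hub q) * card {e \<in> ?E. e \<inter> overfull q \<noteq> {}} \<le> 2 * card (hub q) * (card (overfull q) * card V)"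
    by (intro mult_le_mono2 card_overfull_edges)
  ultimately show ?thesis by linarith
qed

text \<open>Collects the coefficients of n among the errors in \<open>stability_count\<close>, with
  the number of hubs replaced by its bound \<open>q * lin_const\<close>.\<close>

definition stability_const :: "nat \<Rightarrow> nat" where
  "stability_const q = 12 * lin_const + 8 * ((q * lin_const + 2 ^ (q * lin_const) * (2 * codeg_bound + 3)) * codeg_bound) + 8 * (q * lin_const * (q * lin_const)) +
    8 * (q * lin_const * (2 ^ (q * lin_const) * codeg_bound)) + (2 * t - 1) * (2 * lin_const) + 2 * lin_const"

text \<open>The factor 8 is 4 from the edge bound times 2 from the doubled weights; multiplying by
  \<open>q\<close> avoids a division. With \<open>x\<close> equal to n the main term is 2t * n^2,
  the extremal order. If \<open>x\<close> is smaller by a constant fraction of n, the quadratic loss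
  is multiplied by \<open>q\<close>, while the quadratic error is not.\<close>

lemma stability_count:
  assumes V: "V \<noteq> {}" and x: "\<And>S. S \<subseteq> V \<Longrightarrow> card S = t \<Longrightarrow> card (attached S) \<le> x"
  shows "q * (8 * card (clq 3 V)) \<le> q * ((2 * t - 1) * (card V * card V) + card V * x) +
    8 * lin_const * (card V * card V) + q * (stability_const q * card V)"
proof -
  let ?n = "card V" and ?a = "card (hub q)" and ?b = "q * lin_const" and ?common_hubs = "\<Sum>e\<in>clq 2 (V - hub q). common_hubs q e"
  have a: "?a \<le> ?b" using card_hub[OF V] .
  have pow: "2 ^ ?a \<le> (2::nat) ^ ?b" using a by (intro power_increasing) auto
  have 1: "8 * card (clq 3 V) \<le> 8 * card light_triples + 8 * card one_heavy + 8 * card (cherries q) + 8 * (?a * (?a * ?n)) + 8 * ?common_hubs"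
    using card_clq3_le[of q] by linarith
  have 2: "8 * card one_heavy \<le> 4 * card (low_edges q) + 4 * (lin_const * ?n) + 8 * ((?a + 2 ^ ?a * (2 * codeg_bound + 3)) * (?n * codeg_bound))"
    using card_one_heavy[of q] card_one_heavy_low[of q] by linarith
  have 3: "8 * ?common_hubs + 4 * card (low_edges q) \<le> (2 * t - 1) * (4 * card (clq 2 V)) + 4 * card (full_edges q) +
      8 * (?a * (card (overfull q) * ?n))"
    using sum_edge_weights[of q] by (simp add: algebra_simps)
  have 4: "(2 * t - 1) * (4 * card (clq 2 V)) \<le> (2 * t - 1) * (?n * ?n + 2 * lin_const * ?n)"
    using card_edges[of V] by (intro mult_le_mono2) simp
  have 4: "(2 * t - 1) * (4 * card (clq 2 V)) \<le> (2 * t - 1) * (?n * ?n) + (2 * t - 1) * (2 * lin_const * ?n)"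
    using 4 by (simp only: distrib_left)
  have 5: "4 * card (full_edges q) \<le> ?n * x + 2 * lin_const * ?n" using card_full_edges[OF x, of q] by (simp add: algebra_simps)
  define d where "d = 2 * t - 1"
  have Kn: "stability_const q * ?n = 12 * (lin_const * ?n) + 8 * ((?b + 2 ^ ?b * (2 * codeg_bound + 3)) * (?n * codeg_bound)) + 8 * (?b * (?b * ?n)) +
      8 * (?b * (2 ^ ?b * codeg_bound * ?n)) + (2 * t - 1) * (2 * lin_const * ?n) + 2 * lin_const * ?n"
    unfolding stability_const_def d_def[symmetric] by (simp add: algebra_simps)
  have 6: "?a * (?a * ?n) \<le> ?b * (?b * ?n)" using a by (intro mult_le_mono) auto
  have 7: "?a * (card (overfull q) * ?n) \<le> ?b * (2 ^ ?b * codeg_bound * ?n)"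
    using a card_overfull[of q] pow by (intro mult_le_mono order_refl) (meson mult_le_mono1 order_trans)+
  have 8: "(?a + 2 ^ ?a * (2 * codeg_bound + 3)) * (?n * codeg_bound) \<le> (?b + 2 ^ ?b * (2 * codeg_bound + 3)) * (?n * codeg_bound)"
    using a pow by (intro mult_le_mono1 add_mono) auto
  have "8 * card (clq 3 V) \<le> (2 * t - 1) * (?n * ?n) + ?n * x + stability_const q * ?n + 8 * card (cherries q)"
    unfolding Kn using 1 2 3 4 5 6 7 8 card_light_triples' by linarith
  then have "q * (8 * card (clq 3 V)) \<le> q * ((2 * t - 1) * (?n * ?n) + ?n * x + stability_const q * ?n + 8 * card (cherries q))"
    by (rule mult_le_mono2)
  also have "\<dots> = q * ((2 * t - 1) * (?n * ?n) + ?n * x) + q * (stability_const q * ?n) + 8 * (q * card (cherries q))"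
    by (simp add: algebra_simps)
  also have "\<dots> \<le> q * ((2 * t - 1) * (?n * ?n) + ?n * x) + q * (stability_const q * ?n) + 8 * (lin_const * (?n * ?n))"
    using card_cherries[of q] by linarith
  finally show ?thesis by (simp add: algebra_simps)
qed

end

subsection \<open>Exact counting\<close>

lemma four_mult_le_square_sum: "4 * (a * b) \<le> (a + b) * (a + b)" for a b :: nat
proof -
  have "4 * (a * b) \<le> (a + b) * (a + b)" if "a \<le> b" for a b :: nat
    using that by (auto simp: le_iff_add algebra_simps)
  from this[of a b] this[of b a] show ?thesis by (cases "a \<le> b") (auto simp: algebra_simps)
qed

lemma mult_diff_le_quarter: "a \<le> m \<Longrightarrow> a * (m - a) \<le> m * m div 4" for a m :: nat
  using four_mult_le_square_sum[of a "m - a"] by simp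

text \<open>The left side is \<open>a * (m + 1 - a)\<close>; the extra \<open>a\<close> will pay for
  the pages of a book.\<close>

lemma mult_diff_add_le_quarter: "a \<le> m \<Longrightarrow> a * (m - a) + a \<le> (m + 1) * (m + 1) div 4" for a m :: nat
  using four_mult_le_square_sum[of a "m - a + 1"] by (simp add: algebra_simps)

text \<open>Let \<open>T1\<close> and \<open>T2\<close> meet in \<open>{x, y}\<close>, and let
  \<open>T3\<close> not contain both. A member with an element \<open>w\<close> outside
  \<open>T1 \<union> T2\<close> would be \<open>{x, y, w}\<close> and meet \<open>T3\<close> in at
  most one element. So all members lie in a set of four elements.\<close>

lemma two_intersecting:
  assumes F: "\<And>T. T \<in> F \<Longrightarrow> card T = 3"
    and I: "\<And>T T'. T \<in> F \<Longrightarrow> T' \<in> F \<Longrightarrow> T \<noteq> T' \<Longrightarrow> card (T \<inter> T') = 2"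
  shows "(\<exists>x y. x \<noteq> y \<and> (\<forall>T\<in>F. {x, y} \<subseteq> T)) \<or> (finite F \<and> card F \<le> 4)"
proof (cases "\<exists>T1\<in>F. \<exists>T2\<in>F. T1 \<noteq> T2")
  case False
  then have "F = {} \<or> (\<exists>T. F = {T})" by blast
  then show ?thesis by auto
next
  case True
  then obtain T1 T2 where T12: "T1 \<in> F" "T2 \<in> F" "T1 \<noteq> T2" by blast
  obtain x y where xy: "T1 \<inter> T2 = {x, y}" "x \<noteq> y" using I[OF T12] by (auto simp: card_2_iff)
  have fin: "finite T" if "T \<in> F" for T using F[OF that] card_ge_0_finite[of T] by simp
  show ?thesis
  proof (rule disjCI)
    assume "\<not> (finite F \<and> card F \<le> 4)"
    have "\<forall>T\<in>F. {x, y} \<subseteq> T"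
    proof (rule ccontr)
      assume "\<not> ?thesis"
      then obtain T3 where T3: "T3 \<in> F" "\<not> {x, y} \<subseteq> T3" by blast
      let ?Q = "T1 \<union> T2"
      have outside: "{x, y} = T - {w}" if T: "T \<in> F" "w \<in> T" "w \<notin> ?Q" for T w
      proof -
        have "card (T - {w}) = 2" using F[OF T(1)] T(2) by simp
        moreover have "card (T \<inter> T1) = 2" "card (T \<inter> T2) = 2" using I[OF T(1)] T12 T by blast+
        moreover have "T \<inter> T1 \<subseteq> T - {w}" "T \<inter> T2 \<subseteq> T - {w}" using T(3) by blast+
        ultimately have "T \<inter> T1 = T - {w}" "T \<inter> T2 = T - {w}"
          using fin[OF T(1)] by (simp_all add: card_subset_eq)
        then have "T - {w} \<subseteq> {x, y}" using xy(1) by blast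
        moreover have "card {x, y} = 2" using xy(2) by simp
        ultimately have "T - {w} = {x, y}" using \<open>card (T - {w}) = 2\<close> by (intro card_subset_eq) auto
        then show ?thesis by simp
      qed
      have "T \<subseteq> ?Q" if T: "T \<in> F" for T
      proof
        fix w assume w: "w \<in> T"
        show "w \<in> ?Q"
        proof (rule ccontr)
          assume no: "w \<notin> ?Q"
          have T_eq: "{x, y} = T - {w}" using outside[OF T w no] .
          then have "T \<noteq> T3" using T3(2) by blast
          then have c2: "card (T \<inter> T3) = 2" using I[OF T T3(1)] by blast
          have "w \<notin> T3" using outside[OF T3(1) _ no] T3(2) by blast
          then have "T \<inter> T3 \<subseteq> {x, y} \<inter> T3" using T_eq by blast
          moreover have "{x, y} \<inter> T3 \<subseteq> {x} \<or> {x, y} \<inter> T3 \<subseteq> {y}" using T3(2) by blast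
          ultimately have "T \<inter> T3 \<subseteq> {x} \<or> T \<inter> T3 \<subseteq> {y}" by blast
          then have "card (T \<inter> T3) \<le> 1" using card_mono[of "{x}"] card_mono[of "{y}"] by force
          then show False using c2 by simp
        qed
      qed
      then have sub: "F \<subseteq> {T. T \<subseteq> ?Q \<and> card T = 3}" using F by blast
      have "card T1 + card T2 = card ?Q + card (T1 \<inter> T2)" using fin T12 by (intro card_Un_Int)
      then have "card ?Q = 4" using F T12 I[OF T12] by simp
      moreover have finQ: "finite ?Q" using fin T12 by blast
      ultimately have c4: "card {T. T \<subseteq> ?Q \<and> card T = 3} = 4"
        by (simp only: n_subsets) (simp add: eval_nat_numeral)
      have finQ3: "finite {T. T \<subseteq> ?Q \<and> card T = 3}" using finQ by simp
      have "finite F \<and> card F \<le> 4"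
        using card_mono[OF finQ3 sub] finite_subset[OF sub finQ3] unfolding c4 by simp
      then show False using \<open>\<not> (finite F \<and> card F \<le> 4)\<close> by blast
    qed
    then show "\<exists>x y. x \<noteq> y \<and> (\<forall>T\<in>F. {x, y} \<subseteq> T)" using xy(2) by blast
  qed
qed

section \<open>Mantel's theorem with a prescribed independent set\<close>

context ugraph
begin

text \<open>Take a largest independent set \<open>C\<close>. Neighbourhoods are independent, so
  degrees are at most \<open>card C\<close>, and every edge has an end outside \<open>C\<close>.
  Keeping \<alpha> in the bound is what later rewards a large set of pages.\<close>

lemma triangle_free_edges:
  assumes tf: "clq 3 V = {}" and I: "I \<subseteq> V" "\<And>x y. x \<in> I \<Longrightarrow> y \<in> I \<Longrightarrow> \<not> adj x y"
  shows "\<exists>\<alpha>. card I \<le> \<alpha> \<and> \<alpha> \<le> card V \<and> card (clq 2 V) \<le> \<alpha> * (card V - \<alpha>)"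
proof -
  define ind where "ind C \<longleftrightarrow> C \<subseteq> V \<and> (\<forall>x\<in>C. \<forall>y\<in>C. \<not> adj x y)" for C
  have "ind I" using I unfolding ind_def by blast
  moreover have "\<forall>C. ind C \<longrightarrow> card C < Suc (card V)"
    using finV card_mono unfolding ind_def by (simp add: card_mono le_imp_less_Suc)
  ultimately obtain C where C: "ind C" "\<forall>C'. ind C' \<longrightarrow> card C' \<le> card C"
    using ex_has_greatest_nat[of ind I card "Suc (card V)"] by blast
  have nbr: "card (nbr v) \<le> card C" for v
  proof -
    have "\<not> adj x y" if "adj v x" "adj v y" for x y
      using tri_clq[of v x y V] that tf adj_V adj_V2 unfolding tri_def by blast
    then have "ind (nbr v)" unfolding ind_def nbr_def using adj_V2 by blast
    then show ?thesis using C(2) by blast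
  qed
  have CV: "C \<subseteq> V" using C(1) unfolding ind_def by blast
  have "clq 2 V \<subseteq> (\<lambda>(x, y). {x, y}) ` Sigma (V - C) nbr"
  proof
    fix e assume "e \<in> clq 2 V"
    then obtain x y where xy: "e = {x, y}" "x \<in> V" "y \<in> V" "adj x y" by (rule clq2E)
    then have "(x, y) \<in> Sigma (V - C) nbr \<or> (y, x) \<in> Sigma (V - C) nbr"
      using C(1) adj_sym unfolding ind_def nbr_def by blast
    then show "e \<in> (\<lambda>(x, y). {x, y}) ` Sigma (V - C) nbr" using xy(1) by (force simp: insert_commute)
  qed
  then have "card (clq 2 V) \<le> card (V - C) * card C"
    using finV nbr by (intro card_subset_image_Sigma) auto
  also have "card (V - C) = card V - card C" using CV finV by (simp add: card_Diff_subset finite_subset)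
  finally show ?thesis using C \<open>ind I\<close> CV finV by (intro exI[of _ "card C"]) (auto simp: card_mono mult.commute)
qed

text \<open>Deleting the pairs in \<open>R\<close> destroys all triangles. \<open>R\<close> may
  contain non-edges, so it can be taken to include all pairs inside a given set.\<close>

lemma edges_after_deletion:
  assumes W: "W \<subseteq> V" and R: "finite R" and hit: "\<And>T. T \<in> clq 3 W \<Longrightarrow> \<exists>x\<in>T. \<exists>y\<in>T. x \<noteq> y \<and> {x, y} \<in> R"
    and I: "I \<subseteq> W" "\<And>x y. x \<in> I \<Longrightarrow> y \<in> I \<Longrightarrow> \<not> adj x y"
  shows "\<exists>\<alpha>. card I \<le> \<alpha> \<and> \<alpha> \<le> card W \<and> card (clq 2 W) \<le> card R + \<alpha> * (card W - \<alpha>)"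
proof -
  interpret R: ugraph W "\<lambda>x y. adj x y \<and> x \<in> W \<and> y \<in> W \<and> {x, y} \<notin> R"
    using W finV finite_subset adj_sym adj_irrefl by unfold_locales (auto simp: insert_commute)
  have "R.clq 3 W = {}"
  proof (rule ccontr)
    assume "R.clq 3 W \<noteq> {}"
    then obtain T where T: "T \<in> R.clq 3 W" by blast
    then have "T \<in> clq 3 W" unfolding R.clq_def clq_def pairwise_def by blast
    then obtain x y where "x \<in> T" "y \<in> T" "x \<noteq> y" "{x, y} \<in> R" using hit by blast
    then show False using R.clq3_adj[OF T] by blast
  qed
  then obtain \<alpha> where \<alpha>: "card I \<le> \<alpha>" "\<alpha> \<le> card W" "card (R.clq 2 W) \<le> \<alpha> * (card W - \<alpha>)"
    using R.triangle_free_edges[of I] I by blast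
  have "clq 2 W \<subseteq> R \<union> R.clq 2 W"
  proof
    fix e assume "e \<in> clq 2 W"
    then obtain x y where "e = {x, y}" "x \<in> W" "y \<in> W" "adj x y" by (rule clq2E)
    then show "e \<in> R \<union> R.clq 2 W" by (auto simp: R.pair_in_clq)
  qed
  then have "card (clq 2 W) \<le> card (R \<union> R.clq 2 W)"
    using R R.finite_clq[OF R.finV] by (intro card_mono) auto
  also have "\<dots> \<le> card R + card (R.clq 2 W)" by (rule card_Un_le)
  finally show ?thesis using \<alpha> by (intro exI[of _ \<alpha>]) auto
qed

lemma mantel_after_deletion:
  assumes "W \<subseteq> V" "finite R" "\<And>T. T \<in> clq 3 W \<Longrightarrow> \<exists>x\<in>T. \<exists>y\<in>T. x \<noteq> y \<and> {x, y} \<in> R"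
  shows "card (clq 2 W) \<le> card R + card W * card W div 4"
proof -
  obtain \<alpha> where "\<alpha> \<le> card W" "card (clq 2 W) \<le> card R + \<alpha> * (card W - \<alpha>)"
    using edges_after_deletion[OF assms, of "{}"] by auto
  then show ?thesis using mult_diff_le_quarter[of \<alpha> "card W"] by linarith
qed

end

text \<open>The number of triangles of \<^term>\<open>S_plus n t\<close> for \<^term>\<open>m = n - t\<close>, using that
  \<^term>\<open>(m + 1) * (m + 1) div 4\<close> is the sum of \<^term>\<open>m * m div 4\<close> and the upper half of \<^term>\<open>m\<close>.\<close>

definition ext_count :: "nat \<Rightarrow> nat \<Rightarrow> nat" where
  "ext_count t m = (t choose 3) + (t choose 2) * m + (t - 1) * (m * m div 4 + 1) +
    ((m + 1) * (m + 1) div 4 + 1)"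

context lpath_free
begin

text \<open>The triangles avoiding \<^term>\<open>S\<close> and touching its attached vertices either form a book,
  which gives the first alternative, or there are few of them.\<close>

lemma outer_triangles:
  fixes S :: "'a set"
  defines "W \<equiv> V - S" and "U \<equiv> attached S"
  defines "M \<equiv> W - U" and "H \<equiv> {T \<in> clq 3 W. T \<inter> U \<noteq> {}}"
  assumes S: "card S = t" and codeg_bound: "codeg_bound \<le> card U"
  shows "(card (clq 2 U) + card H \<le> 1 + (card U + 1) * (card U + 1) div 4 + card M \<and>
      card (clq 2 W) \<le> 1 + card M * card M + card W * card W div 4) \<or>
    (card H \<le> 4 + card M * card M \<and> card (clq 2 U) \<le> 4 + card U * card U div 4 \<and>
      card (clq 2 W) \<le> 4 + card M * card M + card W * card W div 4)"
proof -
  \<comment> \<open>All pairs inside \<open>M\<close>: they hit every triangle of \<open>W\<close>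
    outside \<open>H\<close>, as such a triangle lies in \<open>M\<close>.\<close>
  define RM where "RM = (\<lambda>(x, y). {x, y}) ` (M \<times> M)"
  have sub: "U \<subseteq> W" "M \<subseteq> W" "W \<subseteq> V" "W = U \<union> M" "U \<subseteq> V"
    unfolding U_def W_def M_def attached_def by auto
  have fin: "finite U" "finite M" "finite W" "finite V" using sub finV finite_subset by blast+
  have finRM: "finite RM" unfolding RM_def using fin by simp
  have cardRM: "card RM \<le> card M * card M"
    unfolding RM_def using card_image_le[of "M \<times> M"] fin by (simp add: card_cartesian_product)
  have inRM: "{x, y} \<in> RM" if "x \<in> M" "y \<in> M" for x y
    unfolding RM_def using that by (auto simp: image_iff intro!: bexI[of _ "(x, y)"])
  have finH: "finite H" unfolding H_def using fin finite_clq by simp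
  have HW: "T \<in> clq 3 W" "T \<inter> U \<noteq> {}" if "T \<in> H" for T using that unfolding H_def by auto
  have U_H: "T \<in> H" if "T \<in> clq 3 U" for T
  proof -
    have "T \<noteq> {}" "T \<subseteq> U" using that by (auto simp: clq_def)
    then show ?thesis using that clq_mono[OF sub(1)] unfolding H_def by blast
  qed
  have not_H: "\<exists>x\<in>T. \<exists>y\<in>T. x \<noteq> y \<and> {x, y} \<in> RM" if T: "T \<in> clq 3 W" "T \<notin> H" for T
  proof -
    have "T \<subseteq> M" using T sub(4) unfolding H_def clq_def by blast
    then show ?thesis using T(1) inRM by (elim clq3E) blast
  qed
  have meet: "T \<inter> T' \<noteq> {}" if "T \<in> H" "T' \<in> H" for T T'
    using touching_triangles_meet[OF S, of T T'] codeg_bound HW[OF that(1)] HW[OF that(2)] unfolding U_def W_def by blast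
  have bow: "T' \<inter> U \<subseteq> {v}" if "T \<in> clq 3 W" "T' \<in> clq 3 W" "T \<inter> T' = {v}" for T T' v
    using no_touching_bowtie[OF S, of T T' v] codeg_bound that unfolding U_def W_def by blast
  have card3: "card T = 3" "finite T" if "T \<in> H" for T
    using HW(1)[OF that] card_ge_0_finite[of T] by (auto simp: clq_def)
  \<comment> \<open>The second alternative holds once at most four pairs hit all triangles inside
    \<open>U\<close> and, together with \<open>RM\<close>, all of \<open>H\<close>.\<close>
  have few: ?thesis
    if H4: "card H \<le> 4 + card M * card M" and R: "finite R" "card R \<le> 4"
      and hit: "\<And>T. T \<in> H \<Longrightarrow> \<exists>x\<in>T. \<exists>y\<in>T. x \<noteq> y \<and> {x, y} \<in> R \<union> RM"
      and hitU: "\<And>T. T \<in> clq 3 U \<Longrightarrow> \<exists>x\<in>T. \<exists>y\<in>T. x \<noteq> y \<and> {x, y} \<in> R" for R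
  proof -
    have "card (clq 2 W) \<le> card (R \<union> RM) + card W * card W div 4"
      using R(1) finRM hit not_H by (intro mantel_after_deletion sub) blast+
    moreover have "card (R \<union> RM) \<le> 4 + card M * card M"
      using card_Un_le[of R RM] R(2) cardRM by linarith
    moreover have "card (clq 2 U) \<le> card R + card U * card U div 4"
      using R(1) hitU by (intro mantel_after_deletion sub) blast+
    ultimately show ?thesis using H4 R(2) by linarith
  qed
  show ?thesis
  proof (cases "\<forall>T\<in>H. \<forall>T'\<in>H. T \<noteq> T' \<longrightarrow> card (T \<inter> T') = 2")
    case True
    have "(\<exists>x y. x \<noteq> y \<and> (\<forall>T\<in>H. {x, y} \<subseteq> T)) \<or> (finite H \<and> card H \<le> 4)"
      using True card3(1) by (intro two_intersecting) blast+
    then consider x y where "x \<noteq> y" "\<forall>T\<in>H. {x, y} \<subseteq> T" | "card H \<le> 4" by blast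
    then show ?thesis
    proof cases
      case (1 x y)
      \<comment> \<open>The pages inside \<open>U\<close>. Two adjacent pages would form with
        \<open>x\<close> a triangle of \<open>H\<close> that misses \<open>y\<close>.\<close>
      define I where "I = {w \<in> U. {x, y, w} \<in> H}"
      have w_ne: "w \<noteq> x \<and> w \<noteq> y" if "{x, y, w} \<in> H" for w
        using card3(1)[OF that] 1(1) by (auto simp: card_insert_if split: if_splits)
      have "H \<subseteq> (\<lambda>w. {x, y, w}) ` (I \<union> M)"
      proof
        fix T assume T: "T \<in> H"
        have xyT: "x \<in> T" "y \<in> T" using 1(2) T by blast+
        obtain a b where ab: "T = {x, a, b}" by (rule clq3_obtain[OF HW(1)[OF T] xyT(1)])
        then obtain w where w: "T = {x, y, w}" using xyT(2) 1(1) by blast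
        then have "w \<in> W" using HW(1)[OF T] by (auto simp: clq_def)
        then have "w \<in> I \<union> M" using T w sub(4) unfolding I_def by blast
        then show "T \<in> (\<lambda>w. {x, y, w}) ` (I \<union> M)" using w by blast
      qed
      then have "card H \<le> card (I \<union> M)" using fin by (intro surj_card_le) (auto simp: I_def)
      then have H_le: "card H \<le> card I + card M" using card_Un_le[of I M] by linarith
      have indep: "\<not> adj w w'" if w: "w \<in> I" "w' \<in> I" for w w'
      proof
        assume a: "adj w w'"
        have T: "{x, y, w} \<in> H" "{x, y, w'} \<in> H" "w \<in> U" "w' \<in> U" using w unfolding I_def by auto
        have "adj x w" "adj x w'" "x \<in> W"
          using clq3_adj[OF HW(1)[OF T(1)], of x w] clq3_adj[OF HW(1)[OF T(2)], of x w']
            w_ne[OF T(1)] w_ne[OF T(2)] HW(1)[OF T(1)] by (auto simp: clq_def)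
        then have "{x, w, w'} \<in> clq 3 W" using a T(3,4) sub(1) by (intro tri_clq) (auto simp: tri_def)
        then have "{x, w, w'} \<in> H" using T(3) unfolding H_def by blast
        with 1(2) have "{x, y} \<subseteq> {x, w, w'}" by (rule bspec)
        then show False using 1(1) w_ne[OF T(1)] w_ne[OF T(2)] by auto
      qed
      have "\<exists>\<alpha>. card I \<le> \<alpha> \<and> \<alpha> \<le> card U \<and> card (clq 2 U) \<le> card {{x, y}} + \<alpha> * (card U - \<alpha>)"
      proof (rule edges_after_deletion[OF sub(5) _ _ _ indep])
        fix T assume "T \<in> clq 3 U"
        then have "x \<in> T" "y \<in> T" using U_H 1(2) by auto
        then show "\<exists>x'\<in>T. \<exists>y'\<in>T. x' \<noteq> y' \<and> {x', y'} \<in> {{x, y}}" using 1(1) by blast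
      qed (auto simp: I_def)
      then obtain \<alpha> where \<alpha>: "card I \<le> \<alpha>" "\<alpha> \<le> card U" "card (clq 2 U) \<le> card {{x, y}} + \<alpha> * (card U - \<alpha>)"
        by blast
      \<comment> \<open>Since \<alpha> is at least \<open>card I\<close>, it pays for the pages
        inside \<open>U\<close>; the others number at most \<open>card M\<close>.\<close>
      have "card (clq 2 U) + card H \<le> 1 + (card U + 1) * (card U + 1) div 4 + card M"
        using \<alpha> H_le mult_diff_add_le_quarter[OF \<alpha>(2)] by simp
      moreover have "card (clq 2 W) \<le> card (insert {x, y} RM) + card W * card W div 4"
      proof (rule mantel_after_deletion)
        fix T assume "T \<in> clq 3 W"
        then show "\<exists>x'\<in>T. \<exists>y'\<in>T. x' \<noteq> y' \<and> {x', y'} \<in> insert {x, y} RM"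
        proof (cases "T \<in> H")
          case True
          then have "x \<in> T" "y \<in> T" using 1(2) by auto
          then show ?thesis using 1(1) by blast
        next
          case False
          then show ?thesis using not_H[OF \<open>T \<in> clq 3 W\<close>] by blast
        qed
      qed (use sub finRM in auto)
      moreover have "card (insert {x, y} RM) \<le> 1 + card M * card M"
        using cardRM finRM by (simp add: card_insert_if)
      ultimately show ?thesis by linarith
    next
      case 2
      have "\<exists>e x y. e = {x, y} \<and> x \<in> T \<and> y \<in> T \<and> x \<noteq> y" if T: "T \<in> H" for T
      proof -
        obtain x y z where "T = {x, y, z}" "x \<noteq> y" using clq3E[OF HW(1)[OF T]] by metis
        then show ?thesis by blast
      qed
      then have "\<exists>r. \<forall>T\<in>H. \<exists>x y. r T = {x, y} \<and> x \<in> T \<and> y \<in> T \<and> x \<noteq> y"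
        by (intro bchoice ballI)
      then obtain r where r: "\<And>T. T \<in> H \<Longrightarrow> \<exists>x y. r T = {x, y} \<and> x \<in> T \<and> y \<in> T \<and> x \<noteq> y"
        by blast
      have "card (r ` H) \<le> 4" using card_image_le[OF finH, of r] 2 by linarith
      moreover have hit: "\<exists>x\<in>T. \<exists>y\<in>T. x \<noteq> y \<and> {x, y} \<in> r ` H" if T: "T \<in> H" for T
      proof -
        obtain x y where "r T = {x, y}" "x \<in> T" "y \<in> T" "x \<noteq> y" using r[OF T] by blast
        moreover have "r T \<in> r ` H" using T by (rule imageI)
        ultimately show ?thesis by auto
      qed
      ultimately show ?thesis
      proof (intro few[of "r ` H"])
        show "card H \<le> 4 + card M * card M" using 2 by simp
        show "finite (r ` H)" using finH by simp
        show "\<exists>x\<in>T. \<exists>y\<in>T. x \<noteq> y \<and> {x, y} \<in> r ` H \<union> RM" if "T \<in> H" for T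
          using hit[OF that] by blast
        show "\<exists>x\<in>T. \<exists>y\<in>T. x \<noteq> y \<and> {x, y} \<in> r ` H" if "T \<in> clq 3 U" for T
          using hit[OF U_H[OF that]] .
      qed
    qed
  next
    case False
    then obtain T T' where T: "T \<in> H" "T' \<in> H" "T \<noteq> T'" "card (T \<inter> T') \<noteq> 2" by blast
    have c1: "card (X \<inter> Y) \<in> {1, 2}" if "X \<in> H" "Y \<in> H" "X \<noteq> Y" for X Y
    proof -
      have "card (X \<inter> Y) \<noteq> 0" using meet[OF that(1,2)] card3(2)[OF that(1)] by simp
      moreover have "card (X \<inter> Y) \<le> 3" using card_mono[of X "X \<inter> Y"] card3[OF that(1)] by simp
      moreover have "card (X \<inter> Y) \<noteq> 3"
      proof
        assume "card (X \<inter> Y) = 3"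
        then have "X \<inter> Y = X" "X \<inter> Y = Y"
          using card3[OF that(1)] card3[OF that(2)] by (simp_all add: card_subset_eq)
        then show False using that(3) by blast
      qed
      ultimately show ?thesis by auto
    qed
    \<comment> \<open>The degenerate case. Two triangles meeting in one vertex \<open>v\<close> have
      no other vertex in \<open>U\<close>; then all of \<open>H\<close> consists of \<open>v\<close>
      and pairs in \<open>M\<close>, so \<open>RM\<close> alone hits every triangle.\<close>
    have "card (T \<inter> T') = 1" using c1[OF T(1-3)] T(4) by simp
    then obtain v where v: "T \<inter> T' = {v}" by (auto simp: card_1_singleton_iff)
    have bow': "X - {v'} \<subseteq> M" "Y - {v'} \<subseteq> M" if "X \<in> H" "Y \<in> H" "X \<inter> Y = {v'}" for X Y v'
    proof -
      have "Y \<inter> U \<subseteq> {v'}" "X \<inter> U \<subseteq> {v'}"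
        using bow[of X Y v'] bow[of Y X v'] HW(1) that by (auto simp: Int_commute)
      then show "X - {v'} \<subseteq> M" "Y - {v'} \<subseteq> M"
        using HW(1)[OF that(1)] HW(1)[OF that(2)] sub(4) by (auto simp: clq_def)
    qed
    have M: "T - {v} \<subseteq> M" "T' - {v} \<subseteq> M" using bow' T v by blast+
    have vU: "v \<in> U" using M(1) HW(2)[OF T(1)] unfolding M_def by blast
    have all: "v \<in> X \<and> X - {v} \<subseteq> M" if X: "X \<in> H" for X
    proof -
      \<comment> \<open>If \<open>X\<close> and \<open>Y\<close> met in a single vertex
        \<open>w\<close>, both would lie in \<open>M\<close> apart from \<open>w\<close>. As
        \<open>v\<close> is in \<open>Y\<close> but not in \<open>M\<close>, this forces
        \<open>w = v\<close>, and \<open>X\<close> would have the claimed form.\<close>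
      have two: "card (X \<inter> Y) = 2" if Y: "Y \<in> H" "X \<noteq> Y" "v \<in> Y" "\<not> (v \<in> X \<and> X - {v} \<subseteq> M)" for Y
      proof (rule ccontr)
        assume "card (X \<inter> Y) \<noteq> 2"
        then have "card (X \<inter> Y) = 1" using c1[OF X Y(1,2)] by simp
        then obtain w where w: "X \<inter> Y = {w}" by (auto simp: card_1_singleton_iff)
        have "X - {w} \<subseteq> M" "Y - {w} \<subseteq> M" using bow'[OF X Y(1) w] .
        moreover have "v \<notin> M" using vU unfolding M_def by blast
        ultimately have "w = v" using Y(3) by blast
        then show False using w \<open>X - {w} \<subseteq> M\<close> Y(4) by blast
      qed
      show ?thesis
      proof (rule ccontr)
        assume no: "\<not> ?thesis"
        then have ne: "X \<noteq> T" "X \<noteq> T'" using M v by blast+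
        have 2: "card (X \<inter> T) = 2" "card (X \<inter> T') = 2" using two T(1,2) ne v no by blast+
        \<comment> \<open>Two pairs inside the three-element set \<open>X\<close> overlap, and they
          can only do so in \<open>v\<close>; hence they cover \<open>X\<close> and \<open>v\<close>
          belongs to it.\<close>
        have "(X \<inter> T) \<inter> (X \<inter> T') = X \<inter> {v}" using v by blast
        then have "card (X \<inter> T \<union> X \<inter> T') + card (X \<inter> {v}) = 4"
          using card_Un_Int[of "X \<inter> T" "X \<inter> T'"] 2 card3(2)[OF X] by simp
        moreover have "card (X \<inter> T \<union> X \<inter> T') \<le> 3"
          using card_mono[of X "X \<inter> T \<union> X \<inter> T'"] card3[OF X] by auto
        ultimately have *: "card (X \<inter> {v}) = 1" "card (X \<inter> T \<union> X \<inter> T') = 3"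
          using card_mono[of "{v}" "X \<inter> {v}"] by auto
        then have "v \<in> X" by (cases "v \<in> X") auto
        have "X \<inter> T \<union> X \<inter> T' = X" using *(2) card3[OF X] by (intro card_subset_eq) auto
        then have "X - {v} \<subseteq> M" using M by blast
        then show False using no \<open>v \<in> X\<close> by blast
      qed
    qed
    have rep: "\<exists>a\<in>M. \<exists>b\<in>M. X = {v, a, b} \<and> a \<noteq> b" if X: "X \<in> H" for X
    proof -
      have vX: "v \<in> X" using all[OF X] by blast
      obtain a b where ab: "X = {v, a, b}" "v \<noteq> a" "v \<noteq> b" "a \<noteq> b" by (rule clq3_obtain[OF HW(1)[OF X] vX])
      then show ?thesis using all[OF X] by blast
    qed
    have "H \<subseteq> (\<lambda>(a, b). {v, a, b}) ` (M \<times> M)" using rep by force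
    then have "card H \<le> card (M \<times> M)" using fin by (intro surj_card_le) auto
    then have "card H \<le> card M * card M" by (simp add: card_cartesian_product)
    moreover have "\<exists>x\<in>X. \<exists>y\<in>X. x \<noteq> y \<and> {x, y} \<in> RM" if "X \<in> H" for X
      using rep[OF that] inRM by blast
    moreover have "X \<notin> clq 3 U" for X
    proof
      assume "X \<in> clq 3 U"
      then have "X \<subseteq> U" "X \<in> H" using U_H by (auto simp: clq_def)
      then show False using rep unfolding M_def by blast
    qed
    ultimately show ?thesis using few[of "{}"] by auto
  qed
qed

text \<open>Triangles are sorted by their number of vertices in \<open>S\<close>; for three and two
  such vertices the trivial bounds are those attained by \<open>S_plus\<close>.\<close>

lemma card_clq3_split:
  assumes S: "S \<subseteq> V"
  shows "card (clq 3 V) \<le> (card S choose 3) + (card S choose 2) * card (V - S) +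
    card {(s, e). s \<in> S \<and> e \<in> clq 2 (V - S) \<and> insert s e \<in> clq 3 V} + card (clq 3 (V - S))"
proof -
  let ?W = "V - S" and ?Sj = "\<lambda>j. {X. X \<subseteq> S \<and> card X = j}"
  let ?B = "{(s, e). s \<in> S \<and> e \<in> clq 2 ?W \<and> insert s e \<in> clq 3 V}"
  let ?f = "\<lambda>(X, w). insert w X" and ?g = "\<lambda>(s, e). insert s e"
  have finS: "finite S" using S finV finite_subset by blast
  have finB: "finite ?B"
    by (rule finite_subset[of _ "S \<times> clq 2 ?W"]) (use finS finV finite_clq in auto)
  have "clq 3 V \<subseteq> ?Sj 3 \<union> ?f ` (?Sj 2 \<times> ?W) \<union> ?g ` ?B \<union> clq 3 ?W"
  proof
    fix T assume T: "T \<in> clq 3 V"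
    have T': "card T = 3" "finite T" "T \<subseteq> V" "pairwise adj T"
      using T card_ge_0_finite[of T] by (auto simp: clq_def)
    have sum3: "card (T \<inter> S) + card (T - S) = 3"
      using T'(1,2) by (metis card_Int_Diff)
    have T_eq: "T = (T \<inter> S) \<union> (T - S)" by blast
    consider "card (T - S) = 0" | "card (T - S) = 1" | "card (T - S) = 2" | "card (T \<inter> S) = 0"
      using sum3 by linarith
    then show "T \<in> ?Sj 3 \<union> ?f ` (?Sj 2 \<times> ?W) \<union> ?g ` ?B \<union> clq 3 ?W"
    proof cases
      case 1
      then have "T \<in> ?Sj 3" using T'(1,2) by simp
      then show ?thesis by blast
    next
      case 2
      then obtain w where w: "T - S = {w}" by (auto simp: card_1_singleton_iff)
      then have "(T \<inter> S, w) \<in> ?Sj 2 \<times> ?W" using sum3 2 T'(3) by auto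
      then have "T \<in> ?f ` (?Sj 2 \<times> ?W)" by (rule rev_image_eqI) (use w in auto)
      then show ?thesis by blast
    next
      case 3
      then obtain s where s: "T \<inter> S = {s}" using sum3 by (auto simp: card_1_singleton_iff)
      have eq: "insert s (T - S) = T" using s by blast
      have "T - S \<in> clq 2 ?W" using 3 T' by (auto simp: clq_def elim: pairwise_subset)
      then have "(s, T - S) \<in> ?B" using s eq T by auto
      then have "T \<in> ?g ` ?B" by (rule rev_image_eqI) (use eq in simp)
      then show ?thesis by blast
    next
      case 4
      then have "T \<in> clq 3 ?W" using T' by (auto simp: clq_def)
      then show ?thesis by blast
    qed
  qed
  then have "card (clq 3 V) \<le> card (?Sj 3 \<union> ?f ` (?Sj 2 \<times> ?W) \<union> ?g ` ?B \<union> clq 3 ?W)"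
    using finS finV finB finite_clq by (intro card_mono) auto
  also have "\<dots> \<le> card (?Sj 3) + card (?Sj 2 \<times> ?W) + card ?B + card (clq 3 ?W)"
    using finS finV finB by (intro order_trans[OF card_Un_le] add_mono card_image_le order_refl) auto
  finally show ?thesis using finS by (simp add: n_subsets card_cartesian_product)
qed

text \<open>An edge inside the attached set may use all t vertices of \<open>S\<close>. Any other
  edge has an unattached end, which lacks a heavy edge to some \<open>miss\<close> in
  \<open>S\<close>. The other t - 1 choices are allowed freely, while a triangle through
  \<open>miss\<close> contains a light edge there and so occurs at most \<open>codeg_bound\<close>
  times per unattached vertex.\<close>

lemma card_hub_edges:
  assumes S: "S \<subseteq> V" "card S = t"
  shows "card {(s, e). s \<in> S \<and> e \<in> clq 2 (V - S) \<and> insert s e \<in> clq 3 V} \<le>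
    card (clq 2 (attached S)) + (t - 1) * card (clq 2 (V - S)) + card (V - S - attached S) * codeg_bound"
proof -
  let ?W = "V - S" and ?U = "attached S" and ?M = "V - S - attached S"
  let ?B = "{(s, e). s \<in> S \<and> e \<in> clq 2 ?W \<and> insert s e \<in> clq 3 V}"
  have finS: "finite S" using S finV finite_subset by blast
  have UW: "?U \<subseteq> ?W" by (auto simp: attached_def)
  have fin: "finite (clq 2 ?W)" "finite (clq 2 ?U)" using finV by (simp_all add: finite_clq)
  have "\<forall>v\<in>?M. \<exists>s. s \<in> S \<and> \<not> heavy s v" by (auto simp: attached_def)
  then obtain miss where miss: "\<And>v. v \<in> ?M \<Longrightarrow> miss v \<in> S \<and> \<not> heavy (miss v) v" by metis
  have "\<forall>e\<in>clq 2 ?W - clq 2 ?U. \<exists>v. v \<in> e \<and> v \<in> ?M" by (auto simp: clq_def)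
  then obtain v where v: "\<And>e. e \<in> clq 2 ?W - clq 2 ?U \<Longrightarrow> v e \<in> e \<and> v e \<in> ?M" by metis
  let ?X = "S \<times> clq 2 ?U"
  let ?Y = "SIGMA e:clq 2 ?W - clq 2 ?U. S - {miss (v e)}"
  let ?Z = "SIGMA u:?M. light_cod (miss u) u"
  have "?B \<subseteq> ?X \<union> (\<lambda>(e, s). (s, e)) ` ?Y \<union> (\<lambda>(u, w). (miss u, {u, w})) ` ?Z"
  proof (rule subsetI, rule ccontr)
    fix \<zeta> assume "\<zeta> \<in> ?B"
      and no': "\<zeta> \<notin> ?X \<union> (\<lambda>(e, s). (s, e)) ` ?Y \<union> (\<lambda>(u, w). (miss u, {u, w})) ` ?Z"
    then obtain s e where s: "\<zeta> = (s, e)" "s \<in> S" and e: "e \<in> clq 2 ?W" and T: "insert s e \<in> clq 3 V"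
      by blast
    have no: "(s, e) \<notin> (\<lambda>(u, w). (miss u, {u, w})) ` ?Z" "(s, e) \<notin> (\<lambda>(e, s). (s, e)) ` ?Y" "(s, e) \<notin> ?X"
      using no' unfolding s(1) by simp_all
    have e': "e \<in> clq 2 ?W - clq 2 ?U" using e no(3) s(2) by blast
    show False
    proof (cases "s = miss (v e)")
      case False
      then have "(e, s) \<in> ?Y" using s(2) e' by blast
      then have "(s, e) \<in> (\<lambda>(e, s). (s, e)) ` ?Y" by force
      then show False using no(2) by blast
    next
      case True
      obtain w where w: "e = {v e, w}" "adj (v e) w" "w \<in> ?W"
      proof -
        obtain a b where ab: "e = {a, b}" "a \<in> ?W" "b \<in> ?W" "adj a b" using e by (rule clq2E)
        then have "v e = a \<or> v e = b" using v[OF e'] by blast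
        then show ?thesis
        proof
          assume "v e = a" then show ?thesis using that[of b] ab by simp
        next
          assume "v e = b" then show ?thesis using that[of a] ab adj_sym by (simp add: insert_commute)
        qed
      qed
      have "s \<noteq> v e" "s \<noteq> w" using s(2) v[OF e'] w(3) by auto
      moreover have "v e \<in> insert s e" "w \<in> insert s e" using w(1) by blast+
      ultimately have "adj s (v e)" "adj s w" using clq3_adj[OF T] by blast+
      then have "w \<in> light_cod s (v e)"
        using miss[of "v e"] v[OF e'] True w(2) adj_heavy_light unfolding in_light_cod by blast
      then have "(v e, w) \<in> ?Z" using v[OF e'] True by blast
      then have "(s, e) \<in> (\<lambda>(u, w). (miss u, {u, w})) ` ?Z"
        by (rule rev_image_eqI) (use w(1) True in auto)
      then show False using no(1) by blast
    qed
  qed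
  then have "card ?B \<le> card (?X \<union> (\<lambda>(e, s). (s, e)) ` ?Y \<union> (\<lambda>(u, w). (miss u, {u, w})) ` ?Z)"
    using finS finV fin light_cod by (intro card_mono) auto
  also have "\<dots> \<le> t * card (clq 2 ?U) + card ?Y + card ?M * codeg_bound"
  proof (intro order_trans[OF card_Un_le] add_mono)
    show "card ?X \<le> t * card (clq 2 ?U)" using S(2) by (simp add: card_cartesian_product)
    show "card ((\<lambda>(e, s). (s, e)) ` ?Y) \<le> card ?Y" using finS fin by (intro card_image_le) auto
    show "card ((\<lambda>(u, w). (miss u, {u, w})) ` ?Z) \<le> card ?M * codeg_bound"
      using finV light_cod by (intro card_subset_image_Sigma[OF order_refl]) auto
  qed
  also have "card ?Y = (card (clq 2 ?W) - card (clq 2 ?U)) * (t - 1)"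
  proof -
    have "card ?Y = (\<Sum>e\<in>clq 2 ?W - clq 2 ?U. card (S - {miss (v e)}))"
      using fin finS by (intro card_SigmaI) auto
    also have "\<dots> = (\<Sum>e\<in>clq 2 ?W - clq 2 ?U. t - 1)"
      using v miss S(2) finS by (intro sum.cong refl) (simp add: card_Diff_singleton)
    also have "\<dots> = (card (clq 2 ?W) - card (clq 2 ?U)) * (t - 1)"
      using fin clq_mono[OF UW] by (simp add: card_Diff_subset)
    finally show ?thesis .
  qed
  also have "t * card (clq 2 ?U) + (card (clq 2 ?W) - card (clq 2 ?U)) * (t - 1) + card ?M * codeg_bound =
      card (clq 2 ?U) + (t - 1) * card (clq 2 ?W) + card ?M * codeg_bound"
  proof -
    have "card (clq 2 ?U) \<le> card (clq 2 ?W)" using fin clq_mono[OF UW] by (intro card_mono) auto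
    then obtain d where "card (clq 2 ?W) = card (clq 2 ?U) + d" using le_Suc_ex by blast
    moreover obtain t' where "t = Suc t'" using t_pos by (cases t) auto
    ultimately show ?thesis by (simp add: algebra_simps)
  qed
  finally show ?thesis .
qed

text \<open>The summands absorb the errors in \<open>exact_count\<close>: light edges at unattached
  vertices, triangles among these vertices, the t-fold edge error, and constants. The factor 4
  clears the division by 4.\<close>

definition size_ratio :: nat where "size_ratio = 4 * (codeg_bound + lin_const + 4 * t + 10)"

lemma div4_add: "a div 4 + b \<le> c div 4" if "a + 4 * b \<le> c" for a b c :: nat
  using that by linarith

text \<open>With u attached and \<mu> unattached vertices outside \<open>S\<close>, (m + 1)^2
  exceeds (u + 1)^2 by at least 2\<mu>u. For a book the unattached vertices cause errors of order
  \<mu> + \<mu>^2 only, which \<open>big\<close> makes smaller than this gain; for \<mu> = 0 these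
  errors vanish.\<close>

lemma exact_count:
  assumes S: "S \<subseteq> V" "card S = t" and big: "size_ratio * (card (V - S - attached S) + 1) \<le> card (attached S)"
  shows "card (clq 3 V) \<le> ext_count t (card V - t)"
proof -
  let ?W = "V - S" and ?U = "attached S" and ?M = "V - S - attached S"
  let ?H = "{T \<in> clq 3 ?W. T \<inter> ?U \<noteq> {}}"
  define m \<mu> u where "m = card ?W" "\<mu> = card ?M" "u = card ?U"
  have finS: "finite S" using S finV finite_subset by blast
  have UW: "?U \<subseteq> ?W" by (auto simp: attached_def)
  have m: "m = card V - t" "m = u + \<mu>"
    unfolding m_\<mu>_u_def using S finS finV UW card_mono[of ?W ?U]
    by (simp_all add: card_Diff_subset)
  have "size_ratio * 1 \<le> size_ratio * (\<mu> + 1)" by (intro mult_le_mono2) simp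
  then have "codeg_bound \<le> u" using big unfolding m_\<mu>_u_def by (simp add: size_ratio_def)
  then have codeg_bound: "codeg_bound \<le> card ?U" unfolding m_\<mu>_u_def .
  have "clq 3 ?W \<subseteq> ?H \<union> clq 3 ?M" by (auto simp: clq_def)
  then have "card (clq 3 ?W) \<le> card (?H \<union> clq 3 ?M)"
    using finV by (intro card_mono) (auto simp: finite_clq)
  also have "\<dots> \<le> card ?H + card (clq 3 ?M)" by (rule card_Un_le)
  also have "card (clq 3 ?M) \<le> lin_const * (\<mu> * \<mu>)" unfolding m_\<mu>_u_def by (intro card_triangles) auto
  finally have H: "card (clq 3 ?W) \<le> card ?H + lin_const * (\<mu> * \<mu>)" by simp
  have \<tau>: "card (clq 3 V) \<le> (t choose 3) + (t choose 2) * m + (t - 1) * card (clq 2 ?W) +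
      (card (clq 2 ?U) + card ?H) + (\<mu> * codeg_bound + lin_const * (\<mu> * \<mu>))"
    using card_clq3_split[OF S(1)] card_hub_edges[OF S] H unfolding m_\<mu>_u_def S(2) by linarith
  have bigu: "size_ratio * \<mu> + size_ratio \<le> u" using big unfolding m_\<mu>_u_def by simp
  have sq: "(m + 1) * (m + 1) = (u + 1) * (u + 1) + 2 * (\<mu> * u) + 2 * \<mu> + \<mu> * \<mu>"
    unfolding m(2) by (simp add: algebra_simps)
  have "(size_ratio * \<mu> + size_ratio) * \<mu> \<le> u * \<mu>" using bigu by (rule mult_le_mono1)
  then have \<mu>u: "size_ratio * (\<mu> * \<mu>) + size_ratio * \<mu> \<le> \<mu> * u" by (simp add: algebra_simps)
  have ratio_mult: "size_ratio * x = 4 * (x * codeg_bound) + 4 * (lin_const * x) + 16 * (t * x) + 40 * x" for x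
    by (simp add: size_ratio_def algebra_simps)
  obtain t' where t': "t = Suc t'" using t_pos by (cases t) auto
  have t1: "(t - 1) * (a + \<mu> * \<mu> + b) \<le> (t - 1) * (b + 1) + t * a + t * (\<mu> * \<mu>)"
    and t1': "(t - 1) * (1 + \<mu> * \<mu> + b) \<le> (t - 1) * (b + 1) + t * (\<mu> * \<mu>)" for a b :: nat
    unfolding t' by (simp_all add: algebra_simps)
  from outer_triangles[OF S(2) codeg_bound, folded m_\<mu>_u_def] show ?thesis
  proof
    assume "card (clq 2 ?U) + card ?H \<le> 1 + (u + 1) * (u + 1) div 4 + \<mu> \<and>
      card (clq 2 ?W) \<le> 1 + \<mu> * \<mu> + m * m div 4"
    then have 1: "card (clq 2 ?U) + card ?H \<le> 1 + (u + 1) * (u + 1) div 4 + \<mu>"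
      and "card (clq 2 ?W) \<le> 1 + \<mu> * \<mu> + m * m div 4" by blast+
    then have "(t - 1) * card (clq 2 ?W) \<le> (t - 1) * (1 + \<mu> * \<mu> + m * m div 4)" by (intro mult_le_mono2)
    then have 2: "(t - 1) * card (clq 2 ?W) \<le> (t - 1) * (m * m div 4 + 1) + t * (\<mu> * \<mu>)"
      using t1' order_trans by blast
    have "(u + 1) * (u + 1) + 4 * (\<mu> + t * (\<mu> * \<mu>) + \<mu> * codeg_bound + lin_const * (\<mu> * \<mu>)) \<le> (m + 1) * (m + 1)"
    proof -
      \<comment> \<open>Products are replaced by variables, so that linear arithmetic
        remains.\<close>
      have "w + 4 * (\<mu> + qt + pD + qc) \<le> w + 2 * s + 2 * \<mu> + q"
        if "k2 + k1 \<le> s" "k1 = 4 * pD + 4 * pc + 16 * pt + 40 * \<mu>" "k2 = 4 * qD + 4 * qc + 16 * qt + 40 * q"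
        for w qt pD qc s q k1 k2 pc pt qD :: nat
        using that by simp
      from this[OF \<mu>u ratio_mult[of \<mu>] ratio_mult[of "\<mu> * \<mu>"]] show ?thesis unfolding sq .
    qed
    then have "(u + 1) * (u + 1) div 4 + (\<mu> + t * (\<mu> * \<mu>) + \<mu> * codeg_bound + lin_const * (\<mu> * \<mu>)) \<le> (m + 1) * (m + 1) div 4"
      by (rule div4_add)
    then show ?thesis using \<tau> 1 2 unfolding ext_count_def m(1)[symmetric] by linarith
  next
    \<comment> \<open>Here only u^2 / 4 appears in place of (u + 1)^2 / 4, and the gap, linear in u,
      absorbs the additive constants.\<close>
    assume "card ?H \<le> 4 + \<mu> * \<mu> \<and> card (clq 2 ?U) \<le> 4 + u * u div 4 \<and>
      card (clq 2 ?W) \<le> 4 + \<mu> * \<mu> + m * m div 4"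
    then have 1: "card ?H \<le> 4 + \<mu> * \<mu>" "card (clq 2 ?U) \<le> 4 + u * u div 4"
      and "card (clq 2 ?W) \<le> 4 + \<mu> * \<mu> + m * m div 4" by blast+
    then have "(t - 1) * card (clq 2 ?W) \<le> (t - 1) * (4 + \<mu> * \<mu> + m * m div 4)" by (intro mult_le_mono2)
    then have 2: "(t - 1) * card (clq 2 ?W) \<le> (t - 1) * (m * m div 4 + 1) + t * 4 + t * (\<mu> * \<mu>)"
      using t1[of 4 "m * m div 4"] by linarith
    have "(u + 1) * (u + 1) = u * u + 2 * u + 1" by (simp add: algebra_simps)
    have "u * u + 4 * (8 + \<mu> * \<mu> + t * 4 + t * (\<mu> * \<mu>) + \<mu> * codeg_bound + lin_const * (\<mu> * \<mu>)) \<le> (m + 1) * (m + 1)"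
    proof -
      have "w + 4 * (8 + q + t * 4 + qt + pD + qc) \<le> w + 2 * u + 1 + 2 * s + 2 * \<mu> + q"
        if "k2 + k1 \<le> s" "k1 + k \<le> u" "k1 = 4 * pD + 4 * pc + 16 * pt + 40 * \<mu>"
          "k2 = 4 * qD + 4 * qc + 16 * qt + 40 * q" "k = 4 * (codeg_bound + lin_const + 4 * t + 10)"
        for w qt pD qc s q k1 k2 k pc pt qD :: nat
        using that by simp
      from this[OF \<mu>u bigu ratio_mult[of \<mu>] ratio_mult[of "\<mu> * \<mu>"] size_ratio_def] show ?thesis
        unfolding sq \<open>(u + 1) * (u + 1) = u * u + 2 * u + 1\<close> .
    qed
    then have "u * u div 4 + (8 + \<mu> * \<mu> + t * 4 + t * (\<mu> * \<mu>) + \<mu> * codeg_bound + lin_const * (\<mu> * \<mu>)) \<le> (m + 1) * (m + 1) div 4"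
      by (rule div4_add)
    then show ?thesis using \<tau> 1 2 unfolding ext_count_def m(1)[symmetric] by linarith
  qed
qed

text \<open>In \<open>triangle_upper_bound\<close>, \<open>y\<close> is about n / (4 *
  \<open>size_ratio\<close>), so \<open>hub_ratio * y\<close> is about 16 * \<open>lin_const\<close>
  * n, twice the error coming from cherries.\<close>

definition hub_ratio :: nat where "hub_ratio = 64 * size_ratio * lin_const"

text \<open>Depends on \<open>t\<close> alone, so one value serves all graphs. The part
  \<open>6 * t + 4 * (t * t)\<close> is the linear loss in \<open>ext_count_lower\<close>.\<close>

definition threshold :: nat where "threshold = hub_ratio * (1 + stability_const hub_ratio + (6 * t + 4 * (t * t))) + t + 1"

text \<open>The loss 6t comes from rounding \<open>m * m div 4\<close>, and 4t^2 from passing from n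
  - t to n.\<close>

lemma ext_count_lower: "2 * (t * (n * n)) \<le> 8 * ext_count t (n - t) + (6 * t + 4 * (t * t)) * n"
  if n: "t < n"
proof -
  obtain m where m: "n = m + t" using n by (metis less_imp_add_positive add.commute)
  obtain t' where t': "t = Suc t'" using t_pos by (cases t) auto
  have "m * m div 4 \<le> (m + 1) * (m + 1) div 4" by (intro div_le_mono mult_le_mono) auto
  then have "t * (m * m div 4) \<le> ext_count t m"
    unfolding ext_count_def unfolding t' by (simp add: algebra_simps)
  moreover have "t * (m * m) \<le> t * (4 * (m * m div 4) + 3)"
    by (intro mult_le_mono2) linarith
  ultimately have 1: "2 * (t * (m * m)) \<le> 8 * ext_count t m + 6 * t" by (simp add: algebra_simps)
  have "2 * (t * (n * n)) \<le> 2 * (t * (m * m)) + 4 * (t * t) * n" unfolding m by (simp add: algebra_simps)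
  moreover have "6 * t \<le> 6 * t * n" using n by simp
  ultimately have "2 * (t * (n * n)) \<le> 8 * ext_count t m + 6 * t * n + 4 * (t * t) * n" using 1 by linarith
  then show ?thesis unfolding m by (simp add: algebra_simps)
qed

lemma lin_const_pos: "1 \<le> lin_const" using fiber_bound_pos by (simp add: lin_const_def)

text \<open>If the bound failed, \<open>exact_count\<close> would keep every set attached to a t-set
  below n - y + 1. Then \<open>stability_count\<close> with \<open>x\<close> equal to n - y loses n
  * y against the extremal order, a quadratic amount that the errors cannot make up for.\<close>

lemma triangle_upper_bound:
  assumes n: "threshold \<le> card V"
  shows "card (clq 3 V) \<le> ext_count t (card V - t)"
proof (rule ccontr)
  assume "\<not> ?thesis"
  then have gt: "ext_count t (card V - t) < card (clq 3 V)" by simp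
  let ?n = "card V"
  define y where "y = ?n div (4 * size_ratio)"
  have size_ratio: "1 \<le> size_ratio" by (simp add: size_ratio_def)
  have tn: "t < ?n" using n by (simp add: threshold_def)
  then have V: "V \<noteq> {}" by auto
  have y_le: "4 * size_ratio * y \<le> ?n" unfolding y_def by simp
  have y_n: "y \<le> ?n" unfolding y_def by simp
  have "0 < 4 * size_ratio" using size_ratio by simp
  then have "?n < 4 * size_ratio + 4 * size_ratio * (?n div (4 * size_ratio))" by (rule dividend_less_times_div)
  then have "?n < 4 * size_ratio * (y + 1)" unfolding y_def by (simp only: distrib_left mult_1_right add.commute)
  have small: "card (attached S) \<le> ?n - y" if S: "S \<subseteq> V" "card S = t" for S
  proof (rule ccontr)
    assume "\<not> ?thesis"
    then have U: "?n - y < card (attached S)" by simp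
    have "attached S \<subseteq> V - S" by (auto simp: attached_def)
    then have "card (V - S - attached S) = ?n - t - card (attached S)" "card (attached S) \<le> ?n - t"
      using S finV card_mono[of "V - S" "attached S"] by (simp_all add: card_Diff_subset finite_subset)
    then have "card (V - S - attached S) + 1 \<le> y" using U y_n tn t_pos by linarith
    then have "size_ratio * (card (V - S - attached S) + 1) \<le> size_ratio * y" by (rule mult_le_mono2)
    moreover have "1 * y \<le> size_ratio * y" using size_ratio by (rule mult_le_mono1)
    ultimately have "size_ratio * (card (V - S - attached S) + 1) \<le> card (attached S)" using U y_le by linarith
    then show False using exact_count[OF S] gt by simp
  qed
  have 1: "hub_ratio * (8 * card (clq 3 V)) \<le> hub_ratio * ((2 * t - 1) * (?n * ?n) + ?n * (?n - y)) +
    8 * lin_const * (?n * ?n) + hub_ratio * (stability_const hub_ratio * ?n)"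
    using stability_count[OF V small] .
  have "?n * (?n - y) + ?n * y = ?n * ?n"
    using y_n by (simp flip: distrib_left)
  moreover have "(2 * t - 1) * (?n * ?n) + ?n * ?n = 2 * (t * (?n * ?n))"
    using t_pos by (cases t) (auto simp: algebra_simps)
  ultimately have "(2 * t - 1) * (?n * ?n) + ?n * (?n - y) + ?n * y = 2 * (t * (?n * ?n))" by linarith
  also have "\<dots> \<le> 8 * card (clq 3 V) + (6 * t + 4 * (t * t)) * ?n"
    using ext_count_lower[OF tn] gt by linarith
  finally have "hub_ratio * ((2 * t - 1) * (?n * ?n) + ?n * (?n - y) + ?n * y) \<le>
      hub_ratio * (8 * card (clq 3 V) + (6 * t + 4 * (t * t)) * ?n)" by (rule mult_le_mono2)
  then have "hub_ratio * ((2 * t - 1) * (?n * ?n) + ?n * (?n - y)) + hub_ratio * (?n * y) \<le>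
      hub_ratio * (8 * card (clq 3 V)) + hub_ratio * ((6 * t + 4 * (t * t)) * ?n)" by (simp only: distrib_left)
  then have "hub_ratio * (?n * y) \<le> 8 * lin_const * (?n * ?n) + hub_ratio * (stability_const hub_ratio * ?n) + hub_ratio * ((6 * t + 4 * (t * t)) * ?n)"
    using 1 by linarith
  then have "(hub_ratio * y) * ?n \<le> (8 * lin_const * ?n + hub_ratio * (stability_const hub_ratio + (6 * t + 4 * (t * t)))) * ?n"
    by (simp add: algebra_simps)
  then have 2: "hub_ratio * y \<le> 8 * lin_const * ?n + hub_ratio * (stability_const hub_ratio + (6 * t + 4 * (t * t)))" using tn by simp
  have "16 * lin_const * ?n \<le> 16 * lin_const * (4 * size_ratio * (y + 1))"
    using \<open>?n < 4 * size_ratio * (y + 1)\<close> by (intro mult_le_mono2) simp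
  also have "\<dots> = hub_ratio * y + hub_ratio" by (simp add: hub_ratio_def algebra_simps)
  finally have "16 * lin_const * ?n \<le> 8 * lin_const * ?n + hub_ratio * (1 + stability_const hub_ratio + (6 * t + 4 * (t * t)))"
    using 2 by (simp add: algebra_simps)
  then have "8 * lin_const * ?n \<le> hub_ratio * (1 + stability_const hub_ratio + (6 * t + 4 * (t * t)))" by linarith
  moreover have "1 * ?n \<le> 8 * lin_const * ?n" using lin_const_pos by (intro mult_le_mono1) simp
  ultimately show False using n unfolding threshold_def by linarith
qed

end



subsection \<open>The extremal graph\<close>

lemma triangles_eq_clq:
  assumes "simple_graph G"
  shows "triangles G = ugraph.clq (induced_adj G) 3 (verts G)"
proof -
  interpret ugraph "verts G" "induced_adj G" using ugraph_of_simple_graph[OF assms] .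
  show ?thesis unfolding triangles_def clq_def pairwise_def induced_adj_def by blast
qed

lemma lpath_free_of_copy_free:
  assumes "simple_graph G" "\<not> contains_copy G (tri_blowup (path_graph (2 * t + 2)))" "1 \<le> t"
  shows "lpath_free (verts G) (induced_adj G) t"
proof -
  interpret ugraph "verts G" "induced_adj G" using ugraph_of_simple_graph[OF assms(1)] .
  show ?thesis
  proof
    show "1 \<le> t" by fact
    show "\<not> lpath (2 * t + 2) v P" for v P
      using assms(2) lpath_contains_copy[OF assms(1)] by blast
  qed
qed

lemma S_plus_verts: "verts (S_plus n t) = {..<n}"
  by (simp add: S_plus_def verts_def Let_def)

text \<open>With \<open>t + 4 \<le> n\<close> the smaller part has at least two vertices, so the
  extra edge really lies inside it.\<close>

lemma S_plus_edge_iff: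
  assumes "t + 4 \<le> n"
  shows "{x, y} \<in> edges (S_plus n t) \<longleftrightarrow> x < n \<and> y < n \<and> x \<noteq> y \<and>
    (x < t \<or> y < t \<or> (x < t + (n - t) div 2) \<noteq> (y < t + (n - t) div 2) \<or> {x, y} = {t, Suc t})"
    (is "_ \<longleftrightarrow> ?R x y")
proof
  have h: "t + (n - t) div 2 \<le> n" "Suc t < t + (n - t) div 2" using assms by linarith+
  show "{x, y} \<in> edges (S_plus n t) \<Longrightarrow> ?R x y"
    using h unfolding S_plus_def edges_def Let_def
    by (auto simp: doubleton_eq_iff)
  have *: "{x, y} \<in> edges (S_plus n t)" if R: "?R x y" and xy: "x < y" for x y
  proof -
    from R consider "x < t" "y < t" | "x < t" "t \<le> y" | "{x, y} = {t, Suc t}"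
      | "t \<le> x" "(x < t + (n - t) div 2) \<noteq> (y < t + (n - t) div 2)"
      using xy by linarith
    then show ?thesis
    proof cases
      case 1
      then have "x \<in> {..<t}" "y \<in> {..<t}" "x \<noteq> y" using xy by auto
      then show ?thesis unfolding S_plus_def edges_def Let_def snd_conv by blast
    next
      case 2
      then have "y \<in> {t..<t + (n - t) div 2} \<union> {t + (n - t) div 2..<n}" using R by auto
      then show ?thesis using 2 unfolding S_plus_def edges_def Let_def snd_conv by blast
    next
      case 3
      then show ?thesis unfolding S_plus_def edges_def Let_def by simp
    next
      case 4
      then have "x \<in> {t..<t + (n - t) div 2}" "y \<in> {t + (n - t) div 2..<n}" using R xy by auto
      then show ?thesis unfolding S_plus_def edges_def Let_def snd_conv by blast
    qed
  qed
  show "?R x y \<Longrightarrow> {x, y} \<in> edges (S_plus n t)"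
    using *[of x y] *[of y x] by (cases "x < y") (auto simp: insert_commute)
qed

lemma S_plus_simple:
  assumes "t + 4 \<le> n"
  shows "simple_graph (S_plus n t)"
proof -
  have "e \<subseteq> verts (S_plus n t) \<and> card e = 2" if e: "e \<in> edges (S_plus n t)" for e
  proof -
    have "\<exists>x y. e = {x, y}" using e unfolding S_plus_def edges_def Let_def by auto
    then obtain x y where xy: "e = {x, y}" by blast
    then show ?thesis using e S_plus_edge_iff[OF assms, of x y] by (auto simp: S_plus_verts)
  qed
  then show ?thesis by (auto simp: simple_graph_def S_plus_verts)
qed

text \<open>Every vertex of the path lies in at most two of its triangles, so the clique part meets at most
  \<^term>\<open>2 * t\<close> of them; two of the remaining triangles would share the extra edge.\<close>

lemma S_plus_copy_free:
  assumes n: "t + 4 \<le> n"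
  shows "\<not> contains_copy (S_plus n t) (tri_blowup (path_graph (2 * t + 2)))"
proof
  let ?F = "tri_blowup (path_graph (2 * t + 2))" and ?k = "2 * t + 2"
  assume "contains_copy (S_plus n t) ?F"
  then obtain f where inj: "inj_on f (verts ?F)" and E: "\<And>e. e \<in> edges ?F \<Longrightarrow> f ` e \<in> edges (S_plus n t)"
    unfolding contains_copy_def by blast
  \<comment> \<open>The i-th triangle of the blown-up path.\<close>
  define X :: "nat \<Rightarrow> (nat + nat set) set" where "X i = {Inl i, Inl (Suc i), Inr {i, Suc i}}" for i
  have XV: "X i \<subseteq> verts ?F" if "i < ?k" for i
    using that by (auto simp: X_def tri_blowup_def verts_def edges_def path_graph_def)
  have X_card: "\<exists>B. {i. z \<in> X i} \<subseteq> B \<and> finite B \<and> card B \<le> 2" for z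
  proof (cases z)
    case (Inl j)
    then show ?thesis by (intro exI[of _ "{j, j - 1}"]) (auto simp: X_def card_insert_if)
  next
    case (Inr e)
    then show ?thesis by (intro exI[of _ "{Min e}"]) (auto simp: X_def)
  qed
  have edge_inj: "i = j" if "{i, Suc i} = {j, Suc j}" for i j :: nat
    using that by (metis Min_path_edge)
  have X_int: "z = Inl (max i j)" if "i \<noteq> j" "z \<in> X i" "z \<in> X j" for i j z
    using that edge_inj[of i j] by (auto simp: X_def max_def)
  define I where "I = {i. i < ?k \<and> f ` X i \<inter> {..<t} \<noteq> {}}"
  have "card {i. i < ?k \<and> a \<in> f ` X i} \<le> 2" for a
  proof (cases "{i. i < ?k \<and> a \<in> f ` X i} = {}")
    case False
    then obtain i z where z: "i < ?k" "z \<in> X i" "a = f z" by blast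
    have "{i. i < ?k \<and> a \<in> f ` X i} \<subseteq> {i. z \<in> X i}"
      using inj XV z unfolding inj_on_def by blast
    then show ?thesis using X_card[of z] by (meson card_mono order_trans)
  next
    case True
    then show ?thesis by (simp only: card.empty zero_le)
  qed
  then have "(\<Sum>a<t. card {i. i < ?k \<and> a \<in> f ` X i}) \<le> (\<Sum>a<t. 2)" by (intro sum_mono)
  moreover have "I = (\<Union>a<t. {i. i < ?k \<and> a \<in> f ` X i})" by (auto simp: I_def)
  then have "card I \<le> (\<Sum>a<t. card {i. i < ?k \<and> a \<in> f ` X i})" by (simp only: card_UN_le finite_lessThan)
  ultimately have "card I \<le> 2 * t" by simp
  moreover have "I \<subseteq> {..<?k}" by (auto simp: I_def)
  then have "card ({..<?k} - I) = ?k - card I" by (simp add: card_Diff_subset finite_subset)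
  ultimately have "2 \<le> card ({..<?k} - I)" by linarith
  then obtain J where J: "J \<subseteq> {..<?k} - I" "card J = 2" by (metis obtain_subset_with_card_n)
  then obtain i j where ij: "i \<noteq> j" "i \<in> {..<?k} - I" "j \<in> {..<?k} - I" by (auto simp: card_2_iff)
  \<comment> \<open>Outside the clique part the graph is bipartite except for the edge
    \<open>{t, Suc t}\<close>, so every triangle there contains this edge.\<close>
  have in_T: "t \<in> f ` X l \<and> Suc t \<in> f ` X l" if l: "l \<in> {..<?k} - I" for l
  proof -
    let ?a = "f (Inl l)" and ?b = "f (Inl (Suc l))" and ?c = "f (Inr {l, Suc l})"
    have e: "{Inl l, Inl (Suc l)} \<in> edges ?F" "{Inl l, Inr {l, Suc l}} \<in> edges ?F"
      "{Inl (Suc l), Inr {l, Suc l}} \<in> edges ?F"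
      using l by (auto simp: tri_blowup_def edges_def path_graph_def)
    have adj: "{?a, ?b} \<in> edges (S_plus n t)" "{?a, ?c} \<in> edges (S_plus n t)" "{?b, ?c} \<in> edges (S_plus n t)"
      using E[OF e(1)] E[OF e(2)] E[OF e(3)] by simp_all
    have "\<not> ?a < t" "\<not> ?b < t" "\<not> ?c < t" using l by (auto simp: I_def X_def)
    then have "{?a, ?b} = {t, Suc t} \<or> {?a, ?c} = {t, Suc t} \<or> {?b, ?c} = {t, Suc t}"
      using adj unfolding S_plus_edge_iff[OF n] by blast
    then show ?thesis unfolding X_def by (auto simp: doubleton_eq_iff)
  qed
  obtain z z' where z: "z \<in> X i" "f z = t" "z' \<in> X i" "f z' = Suc t" using in_T[OF ij(2)] by (metis imageE)
  obtain w w' where w: "w \<in> X j" "f w = t" "w' \<in> X j" "f w' = Suc t" using in_T[OF ij(3)] by (metis imageE)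
  have ijk: "i < ?k" "j < ?k" using ij by auto
  have "z = w" "z' = w'" using inj_onD[OF inj] XV[OF ijk(1)] XV[OF ijk(2)] z w by (metis subsetD)+
  \<comment> \<open>Distinct triangles of the path share at most one vertex, but both preimages of
    the extra edge's ends are shared.\<close>
  then have "z = z'" using X_int[OF ij(1)] z(1,3) w(1,3) by metis
  then show False using z by simp
qed

lemma quarter: "(4 * x + 1) div 4 = x" "4 * x div 4 = x" for x :: nat
  by linarith+

lemma half_mult_half: "(m div 2) * (m - m div 2) = m * m div 4" (is ?A)
  and half_square_Suc: "(m + 1) * (m + 1) div 4 = m * m div 4 + (m - m div 2)" (is ?B) for m :: nat
proof -
  have "m = 2 * (m div 2) \<or> m = 2 * (m div 2) + 1" by linarith
  then obtain h where "m = 2 * h \<or> m = 2 * h + 1" by blast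
  then show ?A ?B
  proof (atomize(full), elim disjE, goal_cases)
    case 1
    then have "m div 2 = h" "m - h = h" "m * m = 4 * (h * h)" "(m + 1) * (m + 1) = 4 * (h * h + h) + 1"
      by (simp_all add: algebra_simps)
    then show ?case by (simp only: quarter)
  next
    case 2
    then have "m div 2 = h" "m - h = h + 1" "m * m = 4 * (h * h + h) + 1"
        "(m + 1) * (m + 1) = 4 * (h * h + h + (h + 1))"
      by (simp_all add: algebra_simps)
    then show ?case by (simp only: quarter) (simp add: algebra_simps)
  qed
qed

text \<open>A lower bound suffices, because \<open>triangle_upper_bound\<close> applies to the
  copy-free graph \<open>S_plus\<close> as well. The families \<open>X3\<close> to \<open>X0\<close>
  are told apart by their number of vertices in the clique part.\<close>

lemma card_S_plus_triangles:
  assumes n: "t + 4 \<le> n" and t: "1 \<le> t"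
  shows "ext_count t (n - t) \<le> card (triangles (S_plus n t))"
proof -
  define h where "h = (n - t) div 2"
  let ?m = "n - t" and ?A = "{..<t}" and ?W = "{t..<n}" and ?B = "{t..<t + h}" and ?C = "{t + h..<n}"
  have h: "2 \<le> h" "t + h \<le> n" "?m - h = n - (t + h)" unfolding h_def using n by linarith+
  interpret ugraph "{..<n}" "induced_adj (S_plus n t)"
    using ugraph_of_simple_graph[OF S_plus_simple[OF n]] by (simp add: S_plus_verts)
  have adj: "induced_adj (S_plus n t) x y \<longleftrightarrow> x < n \<and> y < n \<and> x \<noteq> y \<and>
    (x < t \<or> y < t \<or> (x < t + h) \<noteq> (y < t + h) \<or> {x, y} = {t, Suc t})" for x y
    unfolding induced_adj_def S_plus_edge_iff[OF n] h_def ..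
  let ?Tri = "triangles (S_plus n t)"
  have Tri: "?Tri = clq 3 {..<n}"
    using triangles_eq_clq[OF S_plus_simple[OF n]] by (simp add: S_plus_verts)
  have inTri: "{x, y, z} \<in> ?Tri" if "induced_adj (S_plus n t) x y" "induced_adj (S_plus n t) y z"
      "induced_adj (S_plus n t) x z" for x y z
    unfolding Tri using that by (intro tri_clq) (simp_all add: tri_def adj)
  \<comment> \<open>The edges outside the clique part: complete bipartite, plus the extra
    edge.\<close>
  define E where "E = insert {t, Suc t} ((\<lambda>(b, c). {b, c}) ` (?B \<times> ?C))"
  let ?Aj = "\<lambda>j. {X. X \<subseteq> ?A \<and> card X = j}"
  define X3 X2 X1 X0 where "X3 = ?Aj 3" and "X2 = (\<lambda>(X, w). insert w X) ` (?Aj 2 \<times> ?W)"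
    and "X1 = (\<lambda>(s, e). insert s e) ` (?A \<times> E)" and "X0 = (\<lambda>c. {t, Suc t, c}) ` ?C"
  have E_W: "e \<subseteq> ?W \<and> finite e" if "e \<in> E" for e using that h unfolding E_def by auto
  have cardE: "card E = ?m * ?m div 4 + 1"
  proof -
    have "inj_on (\<lambda>(b, c). {b, c}) (?B \<times> ?C)" by (auto simp: inj_on_def doubleton_eq_iff)
    then have "card ((\<lambda>(b, c). {b, c}) ` (?B \<times> ?C)) = h * (?m - h)"
      using h by (simp add: card_image card_cartesian_product)
    moreover have "{t, Suc t} \<notin> (\<lambda>(b, c). {b, c}) ` (?B \<times> ?C)" using h(1) by (auto simp: doubleton_eq_iff)
    ultimately show ?thesis unfolding E_def h_def half_mult_half[symmetric] by simp
  qed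
  have finE: "finite E" unfolding E_def by simp
  have sub: "X3 \<union> X2 \<union> (X1 \<union> X0) \<subseteq> ?Tri"
  proof (intro Un_least subsetI)
    fix T assume "T \<in> X3"
    then obtain x y z where "T = {x, y, z}" "x \<noteq> y" "y \<noteq> z" "x \<noteq> z" "x < t" "y < t" "z < t"
      unfolding X3_def by (auto simp: card_3_iff)
    then show "T \<in> ?Tri" using inTri[of x y z] n by (simp add: adj)
  next
    fix T assume "T \<in> X2"
    then obtain x y w where "T = {w, x, y}" "x \<noteq> y" "x < t" "y < t" "t \<le> w" "w < n"
      unfolding X2_def by (auto simp: card_2_iff)
    then show "T \<in> ?Tri" using inTri[of w x y] n by (simp add: adj)
  next
    fix T assume "T \<in> X1"
    then obtain s e where T: "T = insert s e" "s < t" "e \<in> E" unfolding X1_def by auto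
    then consider "e = {t, Suc t}" | b c where "e = {b, c}" "b \<in> ?B" "c \<in> ?C" unfolding E_def by auto
    then show "T \<in> ?Tri"
    proof cases
      case 1
      then show ?thesis using inTri[of s t "Suc t"] T n by (simp add: adj)
    next
      case 2
      then show ?thesis using inTri[of s b c] T n by (simp add: adj)
    qed
  next
    fix T assume "T \<in> X0"
    then obtain c where c: "T = {t, Suc t, c}" "c \<in> ?C" unfolding X0_def by auto
    then show "T \<in> ?Tri" using inTri[of t "Suc t" c] h n by (simp add: adj)
  qed
  have cap: "T \<in> X3 \<Longrightarrow> card (T \<inter> ?A) = 3" "T \<in> X2 \<Longrightarrow> card (T \<inter> ?A) = 2"
    "T \<in> X1 \<Longrightarrow> card (T \<inter> ?A) = 1" "T \<in> X0 \<Longrightarrow> card (T \<inter> ?A) = 0" for T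
  proof -
    show "card (T \<inter> ?A) = 3" if "T \<in> X3" using that unfolding X3_def by (auto simp: Int_absorb2)
    show "card (T \<inter> ?A) = 2" if "T \<in> X2" using that unfolding X2_def by (auto simp: Int_absorb2)
    show "card (T \<inter> ?A) = 1" if T: "T \<in> X1"
    proof -
      obtain s e where "T = insert s e" "s < t" "e \<in> E" using T unfolding X1_def by auto
      then have "T \<inter> ?A = {s}" using E_W by fastforce
      then show ?thesis by simp
    qed
    show "card (T \<inter> ?A) = 0" if "T \<in> X0"
      using that unfolding X0_def by (auto simp: Int_insert_left)
  qed
  have c3: "card X3 = (t choose 3)" unfolding X3_def by (simp add: n_subsets)
  have c2: "card X2 = (t choose 2) * ?m"
  proof -
    have "inj_on (\<lambda>(X, w). insert w X) (?Aj 2 \<times> ?W)"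
    proof (rule inj_onI, clarify)
      fix X w X' w' assume a: "X \<subseteq> ?A" "w \<in> ?W" "X' \<subseteq> ?A" "w' \<in> ?W" "insert w X = insert w' X'"
      have "insert w X \<inter> ?A = X" "insert w' X' \<inter> ?A = X'" using a(1-4) by auto
      moreover have "insert w X - ?A = {w}" "insert w' X' - ?A = {w'}" using a(1-4) by auto
      ultimately have "X = X'" "{w} = {w'}" using a(5) by simp_all
      then show "X = X' \<and> w = w'" by simp
    qed
    then show ?thesis unfolding X2_def by (simp add: card_image card_cartesian_product n_subsets)
  qed
  have c1: "card X1 = t * (?m * ?m div 4 + 1)"
  proof -
    have "inj_on (\<lambda>(s, e). insert s e) (?A \<times> E)"
    proof (rule inj_onI)
      fix q q' assume "q \<in> ?A \<times> E" "q' \<in> ?A \<times> E"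
        and eq: "(case q of (s, e) \<Rightarrow> insert s e) = (case q' of (s, e) \<Rightarrow> insert s e)"
      then obtain s e s' e' where q: "q = (s, e)" "q' = (s', e')"
        and a: "s \<in> ?A" "e \<in> E" "s' \<in> ?A" "e' \<in> E" by blast
      have a5: "insert s e = insert s' e'" using eq q by simp
      have "insert s e - ?A = e" "insert s' e' - ?A = e'" using a(1,3) E_W[OF a(2)] E_W[OF a(4)] by auto
      moreover have "insert s e \<inter> ?A = {s}" "insert s' e' \<inter> ?A = {s'}"
        using a(1,3) E_W[OF a(2)] E_W[OF a(4)] by auto
      ultimately have "e = e'" "{s} = {s'}" using a5 by simp_all
      then show "q = q'" using q by simp
    qed
    then show ?thesis unfolding X1_def by (simp add: card_image card_cartesian_product cardE)
  qed
  have c0: "card X0 = ?m - h"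
  proof -
    have "inj_on (\<lambda>c. {t, Suc t, c}) ?C"
    proof (rule inj_onI)
      fix c c' assume a: "c \<in> ?C" "c' \<in> ?C" "{t, Suc t, c} = {t, Suc t, c'}"
      have "{c} = {t, Suc t, c} - {t, Suc t}" using a(1) h(1) by auto
      also have "\<dots> = {t, Suc t, c'} - {t, Suc t}" by (simp only: a(3))
      also have "\<dots> = {c'}" using a(2) h(1) by auto
      finally show "c = c'" by simp
    qed
    then show ?thesis unfolding X0_def using h(3) by (simp add: card_image)
  qed
  have fin: "finite X3" "finite X2" "finite X1" "finite X0"
    unfolding X3_def X2_def X1_def X0_def using finE by auto
  have "card (X3 \<union> X2 \<union> (X1 \<union> X0)) = card X3 + card X2 + (card X1 + card X0)"
  proof -
    have "card (T \<inter> ?A) \<in> {2, 3}" if "T \<in> X3 \<union> X2" for T using that cap(1,2) by blast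
    moreover have "card (T \<inter> ?A) \<in> {0, 1}" if "T \<in> X1 \<union> X0" for T using that cap(3,4) by blast
    ultimately have "(X3 \<union> X2) \<inter> (X1 \<union> X0) = {}" by fastforce
    moreover have "X3 \<inter> X2 = {}" "X1 \<inter> X0 = {}" using cap by fastforce+
    ultimately show ?thesis using fin by (simp add: card_Un_disjoint)
  qed
  moreover have "card (X3 \<union> X2 \<union> (X1 \<union> X0)) \<le> card ?Tri"
    using sub finite_clq[OF finV, of 3] unfolding Tri by (rule card_mono[rotated])
  ultimately have "(t choose 3) + (t choose 2) * ?m + (t * (?m * ?m div 4 + 1) + (?m - h)) \<le> card ?Tri"
    unfolding c3 c2 c1 c0 by simp
  \<comment> \<open>The last summand of \<open>ext_count\<close> splits into
    \<open>?m * ?m div 4 + 1\<close>, which raises the factor t - 1 to t, and the larger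
    half.\<close>
  moreover have "ext_count t ?m = (t choose 3) + (t choose 2) * ?m + (t * (?m * ?m div 4 + 1) + (?m - h))"
  proof -
    obtain t' where "t = Suc t'" using t by (cases t) auto
    then show ?thesis unfolding ext_count_def half_square_Suc h_def by simp
  qed
  ultimately show ?thesis by simp
qed

theorem theorem1p8:
  fixes t :: nat
  assumes "t \<ge> 1"
  shows "\<exists>N. \<forall>n \<ge> N. ex_K3 n (tri_blowup (path_graph (2 * t + 2))) = card (S_plus_bi n t)"
proof (intro exI[of _ "max (lpath_free.threshold t) (t + 4)"] allI impI)
  fix n assume "max (lpath_free.threshold t) (t + 4) \<le> n"
  then have n: "lpath_free.threshold t \<le> n" "t + 4 \<le> n" by auto
  let ?F = "tri_blowup (path_graph (2 * t + 2))"
  let ?X = "{card (triangles G) | G :: nat graph. simple_graph G \<and> verts G = {..<n} \<and> \<not> contains_copy G ?F}"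
  have ub: "x \<le> ext_count t (n - t)" if x: "x \<in> ?X" for x
  proof -
    obtain G :: "nat graph" where G: "x = card (triangles G)" "simple_graph G" "verts G = {..<n}"
      "\<not> contains_copy G ?F" using x by blast
    interpret lpath_free "verts G" "induced_adj G" t using lpath_free_of_copy_free[OF G(2,4) assms] .
    show ?thesis using triangle_upper_bound n(1) unfolding G(1) triangles_eq_clq[OF G(2)] by (simp add: G(3))
  qed
  have lb: "ext_count t (n - t) \<le> card (triangles (S_plus n t))"
    using card_S_plus_triangles[OF n(2) assms] .
  have mem: "card (triangles (S_plus n t)) \<in> ?X"
    using S_plus_simple[OF n(2)] S_plus_copy_free[OF n(2)] S_plus_verts by blast
  \<comment> \<open>\<open>Max\<close> is characterised only on finite sets; the upper bound
    provides finiteness.\<close>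
  have "finite ?X" by (rule finite_subset[of _ "{..ext_count t (n - t)}"]) (use ub in auto)
  then have "Max ?X = card (triangles (S_plus n t))"
  proof (rule Max_eqI)
    show "x \<le> card (triangles (S_plus n t))" if "x \<in> ?X" for x using ub[OF that] lb by linarith
  qed (rule mem)
  then show "ex_K3 n ?F = card (S_plus_bi n t)" unfolding ex_K3_def S_plus_bi_def .
qed

end
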